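(* Let $m\in\mathbb N$. The character and the supercharacter of the N=3 module $H(\Lambda^{[K(m),0]})$ are given by the following formulas. 1) $$\begin{aligned} {\rm ch}^{(+)}_{H(\Lambda^{[K(m),0]})}(\tau,z)={}&-i\,e^{-\frac{\pi im}{4}}\,\frac{\eta(2\tau)^2}{\eta(\frac\tau2)}\cdot\frac{\vartheta_{00}(\tau,z)}{\vartheta_{11}(\tau,z)}\cdot\frac{1}{\theta_{-\frac m2,m+1}(\tau,\frac12)}\Bigg\{\frac{\theta_{\frac12,m+1}(\tau,z)}{\theta_{-\frac12,1}(\tau,z)}-\frac{\theta_{-\frac12,m+1}(\tau,z)}{\theta_{\frac12,1}(\tau,z)}\Bigg\}\\ &+q^{\frac{m^2}{16(m+1)}}e^{-\frac{\pi im}{4}}\frac{1}{\eta(\frac\tau2)\eta(2\tau)}\cdot\frac{\vartheta_{00}(\tau,z)}{\vartheta_{11}(\tau,z)}\cdot\frac{1}{\theta_{-\frac m2,m+1}(\tau,\frac12)}\\ &\times\Bigg\{\sum_{j=1}^\infty\sum_{r=1}^j\sum_{\substack{k=1\\k\ {\rm odd}}}^{m-1}(-1)^jq^{(m+1)j^2-\frac1{4m}(2mr-k)^2-\frac m{16}}\Big[q^{(j+\frac14)(2mr-k)}e^{\frac{\pi i}2(2mr+k)}+q^{(j-\frac14)(2mr-k)}e^{\frac{\pi i}2(2mr-k)}\Big]\big[\theta_{k,m}-\theta_{-k,m}\big](\tau,z)\\ &\quad-\sum_{j=1}^\infty\sum_{r=0}^{j-1}\sum_{\substack{k=1\\k\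 {\rm odd}}}^{m-1}(-1)^jq^{(m+1)j^2-\frac1{4m}(2mr+k)^2-\frac m{16}}\Big[q^{(j+\frac14)(2mr+k)}e^{\frac{\pi i}2(2mr-k)}+q^{(j-\frac14)(2mr+k)}e^{\frac{\pi i}2(2mr+k)}\Big]\big[\theta_{k,m}-\theta_{-k,m}\big](\tau,z)\Bigg\}. \end{aligned}$$ 2) $$\begin{aligned} {\rm ch}^{(-)}_{H(\Lambda^{[K(m),0]})}(\tau,z)={}&\frac{\eta(\frac\tau2)\eta(2\tau)^3}{\eta(\tau)^3}\cdot\frac{\vartheta_{01}(\tau,z)}{\vartheta_{11}(\tau,z)}\cdot\frac{1}{\theta^{(-)}_{\frac m2,m+1}(\tau,0)}\Bigg\{\frac{\theta^{(-)}_{\frac12,m+1}(\tau,z)}{\theta^{(-)}_{-\frac12,1}(\tau,z)}-\frac{\theta^{(-)}_{-\frac12,m+1}(\tau,z)}{\theta^{(-)}_{\frac12,1}(\tau,z)}\Bigg\}\\ &+q^{\frac{m^2}{16(m+1)}}\frac{\eta(\frac\tau2)}{\eta(\tau)^3}\cdot\frac{\vartheta_{01}(\tau,z)}{\vartheta_{11}(\tau,z)}\cdot\frac{1}{\theta^{(-)}_{\frac m2,m+1}(\tau,0)}\\ &\times\Bigg\{\sum_{j=1}^\infty\sum_{r=1}^j\sum_{\substack{k=1\\k\ {\rm odd}}}^{m-1}(-1)^jq^{(m+1)j^2-\frac1{4m}(2mr-k)^2-\frac m{16}}\big\{q^{(j+\frac14)(2mr-k)}+q^{(j-\frac14)(2mr-k)}\big\}\big[\theta_{k,m}-\theta_{-k,m}\big](\tau,z)\\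 &\quad-\sum_{j=1}^\infty\sum_{r=0}^{j-1}\sum_{\substack{k=1\\k\ {\rm odd}}}^{m-1}(-1)^jq^{(m+1)j^2-\frac1{4m}(2mr+k)^2-\frac m{16}}\big\{q^{(j+\frac14)(2mr+k)}+q^{(j-\frac14)(2mr+k)}\big\}\big[\theta_{k,m}-\theta_{-k,m}\big](\tau,z)\Bigg\}. \end{aligned}$$
   Context: Notation. $\mathbb N$ = positive integers; $\tau$ in the upper half-plane; $z,z_1,z_2,t\in\mathbb C$; $q=e^{2\pi i\tau}$, $q^a:=e^{2\pi ia\tau}$. $\theta_{k,m}(\tau,z)=\sum_{j\in\mathbb Z}e^{2\pi im(j+\frac k{2m})z}q^{m(j+\frac k{2m})^2}$, $\theta^{(-)}_{k,m}(\tau,z)=\sum_{j\in\mathbb Z}(-1)^je^{2\pi im(j+\frac k{2m})z}q^{m(j+\frac k{2m})^2}$; $[\theta_{k,m}-\theta_{-k,m}](\tau,z)=\theta_{k,m}(\tau,z)-\theta_{-k,m}(\tau,z)$; $\eta$ is the Dedekind eta function; $\vartheta_{ab}(\tau,z)=\sum_{n\in\mathbb Z}e^{\pi i(n+\frac a2)^2\tau+2\pi i(n+\frac a2)(z+\frac b2)}$ ($a,b\in\{0,1\}$) are Mumford's theta functions. For $m\in\frac12\mathbb N$, $s\in\frac12\mathbb Z$, $\Phi^{[m,s]}=\Phi_1^{[m,s]}-\Phi_2^{[m,s]}$ with $$\Phi^{[m,s]}_1(\tau,z_1,z_2,t)=e^{-2\pi imt}\sum_{j\in\mathbb Z}\frac{e^{2\pi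 imj(z_1+z_2)+2\pi isz_1}q^{mj^2+sj}}{1-e^{2\pi iz_1}q^j},\quad \Phi^{[m,s]}_2(\tau,z_1,z_2,t)=e^{-2\pi imt}\sum_{j\in\mathbb Z}\frac{e^{-2\pi imj(z_1+z_2)-2\pi isz_2}q^{mj^2+sj}}{1-e^{-2\pi iz_2}q^j}.$$ In these definitions $q$ is attached to the first argument (first argument $2\tau$ means $q\mapsto q^2$). Empty sums are $0$. Modules. Let $\widehat B(1,1)=\widehat{osp}(3|2)$ be the affine Lie superalgebra with simple roots $\alpha_0,\alpha_1,\alpha_2$ ($\alpha_1$ odd isotropic, $\alpha_0,\alpha_2$ even, $\theta=2\alpha_1+2\alpha_2$ the highest root, $(\theta|\theta)=2$) and fundamental weight $\Lambda_0$. For $m\in\mathbb N$ and an integer $0\le m_2\le m$ put $K(m)=-\frac{m+2}4$, $\Lambda^{[K(m),m_2]}=K(m)\Lambda_0-\frac{m_2}2\alpha_1$, let $L(\Lambda^{[K(m),m_2]})$ be the irreducible highest weight module, and let $H(\Lambda^{[K(m),m_2]})$ be the module over the N=3 superconformal algebra obtained from it by quantum Hamiltonian reduction. Its character ${\rm ch}^{(+)}$ and supercharacter ${\rm ch}^{(-)}$ are known (from earlier work) to be determined by $$R^{(+)}{\rm ch}^{(+)}_{H(\Lambda^{[K(m),m_2]})}(\tau,z)=q^{-\frac m{16}}\Phi^{[\frac m2,\frac{m_2+1}2]}\big(2\tau,z+\tfrac\tau2-\tfrac12,z-\tfrac\tau2+\tfrac12,0\big),$$ $$R^{(-)}{\rm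 ch}^{(-)}_{H(\Lambda^{[K(m),m_2]})}(\tau,z)=q^{-\frac m{16}}\Phi^{[\frac m2,\frac{m_2+1}2]}\big(2\tau,z+\tfrac\tau2,z-\tfrac\tau2,0\big),$$ where $R^{(+)}(\tau,z)=\eta(\frac\tau2)\eta(2\tau)\frac{\vartheta_{11}(\tau,z)}{\vartheta_{00}(\tau,z)}$ and $R^{(-)}(\tau,z)=\frac{\eta(\tau)^3}{\eta(\frac\tau2)}\cdot\frac{\vartheta_{11}(\tau,z)}{\vartheta_{01}(\tau,z)}$.
   Formalization: In all four triple sums the exponent (m+1)j^2 is corrected to j^2; as printed the formulas fail for m ≥ 2 (for m=2 the supercharacter sums must begin with q^{3/2}, but the printed ones begin with q^{7/2}), and for m=1 the sums are empty. *)

theory Defs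
  imports "HOL-Analysis.Analysis"
begin

text \<open>
  Throughout, \<open>\<tau>\<close> is a point of the upper half-plane and \<open>q\<^sup>a\<close> means \<open>exp (2 \<pi> i a \<tau>)\<close>, so that
  fractional powers of \<open>q\<close> involve no choice of branch.  Replacing the first argument \<open>\<tau>\<close> by
  \<open>2 \<tau>\<close> replaces \<open>q\<close> by \<open>q\<^sup>2\<close>.
\<close>

definition qpow :: "complex \<Rightarrow> real \<Rightarrow> complex" where
  "qpow \<tau> a = exp (2 * of_real pi * \<i> * of_real a * \<tau>)"

definition dedekind_eta :: "complex \<Rightarrow> complex" where
  "dedekind_eta \<tau> = qpow \<tau> (1/24) * (\<Prod>n. 1 - qpow \<tau> (real (Suc n)))"

definition theta :: "real \<Rightarrow> real \<Rightarrow> complex \<Rightarrow> complex \<Rightarrow> complex" where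
  "theta k m \<tau> z = (\<Sum>\<^sub>\<infinity>j\<in>(UNIV::int set).
     exp (2 * of_real pi * \<i> * of_real (m * (of_int j + k / (2 * m))) * z)
     * qpow \<tau> (m * (of_int j + k / (2 * m))^2))"

definition theta_minus :: "real \<Rightarrow> real \<Rightarrow> complex \<Rightarrow> complex \<Rightarrow> complex" where
  "theta_minus k m \<tau> z = (\<Sum>\<^sub>\<infinity>j\<in>(UNIV::int set).
     (-1) powi j
     * exp (2 * of_real pi * \<i> * of_real (m * (of_int j + k / (2 * m))) * z)
     * qpow \<tau> (m * (of_int j + k / (2 * m))^2))"

definition theta_diff :: "real \<Rightarrow> real \<Rightarrow> complex \<Rightarrow> complex \<Rightarrow> complex" where
  "theta_diff k m \<tau> z = theta k m \<tau> z - theta (-k) m \<tau> z"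

text \<open>Mumford's theta functions; the characteristics \<open>a\<close> and \<open>b\<close> are 0 or 1.\<close>

definition mumford_theta :: "nat \<Rightarrow> nat \<Rightarrow> complex \<Rightarrow> complex \<Rightarrow> complex" where
  "mumford_theta a b \<tau> z = (\<Sum>\<^sub>\<infinity>n\<in>(UNIV::int set).
     exp (of_real pi * \<i> * of_real ((of_int n + real a / 2)^2) * \<tau>
          + 2 * of_real pi * \<i> * of_real (of_int n + real a / 2) * (z + of_real (real b / 2))))"

text \<open>
  The indices \<open>m\<close> and \<open>s\<close> below are half-integers, \<open>m\<close> being positive.
\<close>

definition Phi1 :: "real \<Rightarrow> real \<Rightarrow> complex \<Rightarrow> complex \<Rightarrow> complex \<Rightarrow> complex \<Rightarrow> complex" where
  "Phi1 m s \<tau> z1 z2 t = exp (- 2 * of_real pi * \<i> * of_real m * t) *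
     (\<Sum>\<^sub>\<infinity>j\<in>(UNIV::int set).
        exp (2 * of_real pi * \<i> * of_real (m * of_int j) * (z1 + z2)
             + 2 * of_real pi * \<i> * of_real s * z1)
        * qpow \<tau> (m * (of_int j)^2 + s * of_int j)
        / (1 - exp (2 * of_real pi * \<i> * z1) * qpow \<tau> (of_int j)))"

definition Phi2 :: "real \<Rightarrow> real \<Rightarrow> complex \<Rightarrow> complex \<Rightarrow> complex \<Rightarrow> complex \<Rightarrow> complex" where
  "Phi2 m s \<tau> z1 z2 t = exp (- 2 * of_real pi * \<i> * of_real m * t) *
     (\<Sum>\<^sub>\<infinity>j\<in>(UNIV::int set).
        exp (- 2 * of_real pi * \<i> * of_real (m * of_int j) * (z1 + z2)
             - 2 * of_real pi * \<i> * of_real s * z2)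
        * qpow \<tau> (m * (of_int j)^2 + s * of_int j)
        / (1 - exp (- 2 * of_real pi * \<i> * z2) * qpow \<tau> (of_int j)))"

definition Phi :: "real \<Rightarrow> real \<Rightarrow> complex \<Rightarrow> complex \<Rightarrow> complex \<Rightarrow> complex \<Rightarrow> complex" where
  "Phi m s \<tau> z1 z2 t = Phi1 m s \<tau> z1 z2 t - Phi2 m s \<tau> z1 z2 t"

text \<open>
  The denominators of the N=3 superconformal algebra.  As functions of \<open>z\<close>, \<open>R_plus\<close> has poles
  at the zeros of \<open>mumford_theta 0 0\<close> and \<open>R_minus\<close> at those of \<open>mumford_theta 0 1\<close>; both vanish
  at the zeros of \<open>mumford_theta 1 1\<close>.  All three zero sets have to be excluded where division
  is totalised.
\<close>

definition R_plus :: "complex \<Rightarrow> complex \<Rightarrow> complex" where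
  "R_plus \<tau> z = dedekind_eta (\<tau>/2) * dedekind_eta (2*\<tau>)
     * (mumford_theta 1 1 \<tau> z / mumford_theta 0 0 \<tau> z)"

definition R_minus :: "complex \<Rightarrow> complex \<Rightarrow> complex" where
  "R_minus \<tau> z = dedekind_eta \<tau> ^ 3 / dedekind_eta (\<tau>/2)
     * (mumford_theta 1 1 \<tau> z / mumford_theta 0 1 \<tau> z)"

text \<open>
  A weight \<open>K \<Lambda>\<^sub>0 + c \<alpha>\<^sub>1\<close> of affine osp(3|2) is represented by the pair \<open>(K, c)\<close>;
  \<open>Lambda m m2\<close> is \<open>K(m) \<Lambda>\<^sub>0 - (m2/2) \<alpha>\<^sub>1\<close>.  Such a weight stands for the N=3 module obtained by
  quantum Hamiltonian reduction from the irreducible highest weight module it determines.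
  The (super)character of that module is a function of \<open>(\<tau>, z)\<close>; the modules themselves are not
  constructed, and the (super)characters enter through the product formulas for \<open>R_plus\<close> and
  \<open>R_minus\<close> times the (super)character, which determine them.
\<close>

type_synonym weight = "real \<times> real"

definition K_level :: "nat \<Rightarrow> real" where
  "K_level m = - (real m + 2) / 4"

definition Lambda :: "nat \<Rightarrow> nat \<Rightarrow> weight" where
  "Lambda m m2 = (K_level m, - real m2 / 2)"

definition odd_upto :: "nat \<Rightarrow> nat set" where
  "odd_upto n = {k \<in> {1..n}. odd k}"

text \<open>
  In the four triple sums of the character formulas stated with these definitions, the leading
  power of \<open>q\<close> is \<open>q\<close> to the \<open>j\<^sup>2 - (2mr \<plusminus> k)\<^sup>2/(4m) - m/16\<close>.  The source prints \<open>(m+1) j\<^sup>2\<close> in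
  place of \<open>j\<^sup>2\<close>, which is a misprint: for \<open>m = 2\<close> the triple sums for the supercharacter
  have to start with \<open>q\<close> to the \<open>3/2\<close>, whereas the printed exponent makes them start with \<open>q\<close> to
  the \<open>7/2\<close>.
\<close>

end

theory Submission
  imports Defs
begin

text \<open>Put \<open>q = exp (2 \<pi> i \<tau>)\<close> and \<open>x = exp (2 \<pi> i z)\<close>.  Up to a power of \<open>q\<close>, the product of \<open>R_minus\<close> and the
supercharacter is \<open>\<Phi> = \<Phi>\<^sub>1(z) - \<Phi>\<^sub>1(-z)\<close>, where
\<open>\<Phi>\<^sub>1\<close> is the sum over all integers \<open>n\<close> of \<open>x^(mn) q^(m n^2) h(n)\<close>, with \<open>y = x q^(2n + 1/2)\<close> and
\<open>h(n) = y^(1/2) / (1 - y)\<close> (\<open>appell_kernel\<close>).  The formula says that a theta constant times \<open>\<Phi>\<close> is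
\<open>\<eta>(2\<tau>)^3\<close> times an antisymmetrised quotient of theta functions, up to a combination of the
\<open>\<theta>\<^sub>k - \<theta>\<^sub>-\<^sub>k\<close>.  Both sides have the same simple poles and the same quasi-periodicity in \<open>z\<close>.  The
proof makes the correction explicit by rearranging series.

First, the reciprocal of a theta function is a sum over the same poles.  The moments
\<open>G\<^sub>l = \<Sum> (-1)^n q^(n^2 - 2nl) h(n)\<close> satisfy \<open>G\<^sub>l = (x q^(1/2))^l G\<^sub>0\<close>, because each step leaves a theta series
that changes sign under a reflection of the summation index (\<open>kernel_moment_shift\<close>).  Multiplying
\<open>G\<^sub>0\<close> by the denominator theta series therefore removes \<open>x\<close> from the numerators, and the resulting
double series collapses to \<open>\<Sum> (-1)^p (2p+1) q^(p^2+p)\<close>, which is the cube of an Euler product by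
Jacobi's identity (\<open>jacobi_cube\<close>, \<open>theta_reciprocal\<close>).

Secondly, multiplying \<open>G\<^sub>0\<close> by the numerator theta series of index \<open>m + 1\<close> and using the same relation
gives \<open>\<Sum> (-1)^j q^(j^2) W\<^sub>j\<close>, where \<open>W\<^sub>j\<close> is \<open>\<Phi>\<^sub>1\<close> with its Gaussian factor moved \<open>j\<close> places against the
poles (\<open>theta_numerator_times_kernel\<close>).

Thirdly, moving the Gaussian factor back multiplies \<open>h(n)\<close> by \<open>y^(-mj)\<close>.  Since \<open>1 - y\<close> divides
\<open>1 - y^(-mj)\<close>, the sum \<open>W\<^sub>j\<close> is \<open>q^(m j^2 + mj/2) \<Phi>\<^sub>1\<close> plus finitely many theta functions
(\<open>appell_sum_char_step\<close>).  Summed over \<open>j\<close> and antisymmetrised in \<open>z\<close>, the multiples of \<open>\<Phi>\<close> assemble into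
the theta constant and the theta functions into the triple sums (\<open>appell_diff_expansion\<close>,
\<open>theta_times_Appell\<close>).

Finally, the character identity is the supercharacter identity at \<open>\<tau> - 1\<close>: integral powers of \<open>q\<close> are
unchanged and the fractional ones give the phases (\<open>theta_times_Appell_shifted\<close>).\<close>

section \<open>Jacobi's series for the cube of the Euler product\<close>

text \<open>The Pochhammer symbol \<open>(q; q)\<^sub>n\<close>.\<close>

definition qpoch :: "complex \<Rightarrow> nat \<Rightarrow> complex" where
  "qpoch q n = (\<Prod>k<n. 1 - q ^ Suc k)"

text \<open>A quotient, so that the symmetry under \<open>k \<mapsto> n - k\<close> is immediate; for \<open>norm q < 1\<close> the denominator does not vanish.\<close>

definition gauss_binom :: "complex \<Rightarrow> nat \<Rightarrow> nat \<Rightarrow> complex" where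
  "gauss_binom q n k = qpoch q n / (qpoch q k * qpoch q (n - k))"

lemma one_minus_power_nonzero:
  fixes q :: complex
  assumes "norm q < 1"
  shows "1 - q ^ Suc k \<noteq> 0"
proof
  assume "1 - q ^ Suc k = 0"
  then have "norm q ^ Suc k = 1" by (metis eq_iff_diff_eq_0 norm_one norm_power)
  then show False using assms power_less_one_iff[of "norm q" "Suc k"] by auto
qed

lemma qpoch_nonzero: "norm q < 1 \<Longrightarrow> qpoch q n \<noteq> 0"
  unfolding qpoch_def using one_minus_power_nonzero by auto

lemma qpoch_0 [simp]: "qpoch q 0 = 1" by (simp add: qpoch_def)

lemma qpoch_Suc: "qpoch q (Suc n) = qpoch q n * (1 - q ^ Suc n)"
  by (simp add: qpoch_def)

lemma gauss_binom_0: "norm q < 1 \<Longrightarrow> gauss_binom q n 0 = 1"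
  by (simp add: gauss_binom_def qpoch_nonzero)

lemma gauss_binom_self: "norm q < 1 \<Longrightarrow> gauss_binom q n n = 1"
  by (simp add: gauss_binom_def qpoch_nonzero)

lemma gauss_binom_pascal:
  assumes q: "norm q < 1" and "j < n"
  shows "gauss_binom q (Suc n) (Suc j) = gauss_binom q n (Suc j) + q ^ (n - j) * gauss_binom q n j"
proof -
  obtain d where n: "n = Suc (j + d)" using \<open>j < n\<close> less_iff_Suc_add by auto
  have "n - j = Suc d" "n - Suc j = d" "Suc n - Suc j = Suc d" using n by auto
  have z: "1 - q * q ^ d \<noteq> 0" "1 - q * q ^ j \<noteq> 0"
    using one_minus_power_nonzero[OF q, of d] one_minus_power_nonzero[OF q, of j] by auto
  have e: "q ^ n = q * q ^ j * q ^ d" by (simp add: n power_add)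
  show ?thesis
    unfolding gauss_binom_def \<open>n - j = Suc d\<close> \<open>n - Suc j = d\<close> \<open>Suc n - Suc j = Suc d\<close>
    using qpoch_nonzero[OF q, of d] qpoch_nonzero[OF q, of j] z
    by (simp add: qpoch_Suc divide_simps e) (simp add: algebra_simps)
qed

text \<open>Multiplying by the next factor \<open>1 - w q^n\<close> is the Pascal rule for Gaussian binomials, so the expansion follows by induction.\<close>

lemma cauchy_binomial:
  assumes q: "norm q < 1"
  shows "(\<Prod>k<n. 1 - w * q ^ k) = (\<Sum>j\<le>n. (-1) ^ j * q ^ (j choose 2) * gauss_binom q n j * w ^ j)"
proof (induction n)
  case 0
  then show ?case by (simp add: gauss_binom_def numeral_2_eq_2)
next
  case (Suc n)
  define c where "c n j = (-1) ^ j * q ^ (j choose 2) * gauss_binom q n j" for n j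
  have rec: "c (Suc n) (Suc j) = c n (Suc j) - q ^ n * c n j" if "j < n" for j
  proof -
    have "q ^ n = q ^ (n - j) * q ^ j" using that by (simp flip: power_add)
    then show ?thesis
      using gauss_binom_pascal[OF q that]
      by (simp add: c_def numeral_2_eq_2 power_add algebra_simps)
  qed
  have top: "c (Suc n) (Suc n) = - (q ^ n * c n n)"
    by (simp add: c_def gauss_binom_self[OF q] numeral_2_eq_2 power_add)
  have "(\<Sum>j\<le>Suc n. c (Suc n) j * w ^ j)
      = c (Suc n) 0 + (\<Sum>j\<le>n. c (Suc n) (Suc j) * w ^ Suc j)"
    by (subst sum.atMost_Suc_shift) simp
  also have "(\<Sum>j\<le>n. c (Suc n) (Suc j) * w ^ Suc j)
      = (\<Sum>j<n. c (Suc n) (Suc j) * w ^ Suc j) + c (Suc n) (Suc n) * w ^ Suc n"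
    by (simp add: lessThan_Suc_atMost[symmetric])
  also have "(\<Sum>j<n. c (Suc n) (Suc j) * w ^ Suc j)
      = (\<Sum>j<n. c n (Suc j) * w ^ Suc j) - (\<Sum>j<n. q ^ n * w * (c n j * w ^ j))"
    unfolding sum_subtractf[symmetric] by (intro sum.cong) (auto simp: rec algebra_simps)
  also have "c (Suc n) 0 + ((\<Sum>j<n. c n (Suc j) * w ^ Suc j) - (\<Sum>j<n. q ^ n * w * (c n j * w ^ j))
        + c (Suc n) (Suc n) * w ^ Suc n)
      = (c n 0 + (\<Sum>j<n. c n (Suc j) * w ^ Suc j))
        - ((\<Sum>j<n. q ^ n * w * (c n j * w ^ j)) + q ^ n * w * (c n n * w ^ n))"
    by (simp add: top) (simp add: c_def gauss_binom_0[OF q] algebra_simps)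
  also have "c n 0 + (\<Sum>j<n. c n (Suc j) * w ^ Suc j) = (\<Sum>j\<le>n. c n j * w ^ j)"
    by (subst sum.atMost_shift) simp
  also have "(\<Sum>j<n. q ^ n * w * (c n j * w ^ j)) + q ^ n * w * (c n n * w ^ n)
      = q ^ n * w * (\<Sum>j\<le>n. c n j * w ^ j)"
    by (simp add: lessThan_Suc_atMost[symmetric] sum_distrib_left distrib_left)
  also have "(\<Sum>j\<le>n. c n j * w ^ j) = (\<Prod>k<n. 1 - w * q ^ k)"
    using Suc by (simp add: c_def)
  finally show ?case by (simp add: c_def algebra_simps)
qed

lemma twice_choose_two: "2 * (Suc n choose 2) = n * Suc n"
  by (induction n) (auto simp: numeral_2_eq_2)

text \<open>This and the next lemma clear negative powers of \<open>q\<close> whose exponents are symbolic.\<close>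

lemma cross_multiply:
  fixes x :: complex
  assumes "b \<noteq> 0" "c \<noteq> 0" "x * b = r * s * c"
  shows "x * inverse c = r * inverse b * s"
  using assms by (simp add: field_simps)

lemma cancel_common_powers:
  fixes x :: complex
  assumes "c \<noteq> 0" "d \<noteq> 0" "a * d = c * c" "a * inverse c * x = c * inverse d * s"
  shows "x = s"
proof -
  have "(a * d) * x = c * d * (a * inverse c * x)" using assms(1) by simp
  also have "\<dots> = (c * c) * s" unfolding assms(4) using assms(2) by simp
  finally show ?thesis using assms(1) unfolding assms(3) by simp
qed

text \<open>The polynomial \<open>(1 - w) (1 - wq) \<dots> (1 - w q^(2n))\<close> has a simple zero at \<open>w = q^(-n)\<close>.  Its derivative there
is, up to a power of \<open>q\<close> and a sign, \<open>(q; q)\<^sub>n^2\<close>; in the expansion by the Cauchy binomial theorem, the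
terms of index \<open>n - p\<close> and \<open>n + 1 + p\<close> carry equal powers of \<open>q\<close> and opposite signs, and their factors
from differentiation add up to \<open>2p + 1\<close>.\<close>

lemma finite_jacobi_cube:
  assumes q: "norm q < 1" "q \<noteq> 0"
  shows "qpoch q n ^ 2 = (\<Sum>p\<le>n. (-1) ^ p * of_nat (2 * p + 1) * q ^ (Suc p choose 2)
           * gauss_binom q (2 * n + 1) (n - p))"
proof -
  define w where "w = inverse q ^ n"
  define a where "a j = (-1) ^ j * q ^ (j choose 2) * gauss_binom q (2 * n + 1) j" for j
  define f where "f w = (\<Prod>k<2*n+1. 1 - w * q ^ k)" for w
  \<comment> \<open>the cofactor of \<open>f\<close> at its zero \<open>w\<close>, hence the derivative there\<close>
  define g where "g w = - (q ^ n) * (\<Prod>k\<in>{..<2*n+1} - {n}. 1 - w * q ^ k)" for w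
  have wq: "w * q ^ n = 1" using q by (simp add: w_def power_inverse)
  have fg: "f x = (1 - x * q ^ n) * (\<Prod>k\<in>{..<2*n+1} - {n}. 1 - x * q ^ k)" for x
    unfolding f_def by (subst prod.remove[of _ n]) auto
  have "DERIV f w :> g w"
    unfolding CARAT_DERIV
  proof (intro exI[of _ g] conjI allI)
    fix x
    have "1 - x * q ^ n = - (q ^ n) * (x - w)" using wq by (simp add: algebra_simps)
    then show "f x - f w = g x * (x - w)"
      unfolding fg wq by (simp add: g_def algebra_simps)
    show "isCont g w" unfolding g_def by (intro continuous_intros)
  qed auto
  moreover have "DERIV f w :> (\<Sum>j\<le>2*n+1. a j * (of_nat j * w ^ (j - 1)))"
  proof -
    have "f = (\<lambda>w. \<Sum>j\<le>2*n+1. a j * w ^ j)"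
      unfolding f_def a_def by (intro ext cauchy_binomial q)
    moreover have "DERIV (\<lambda>w. \<Sum>j\<le>N. a j * w ^ j) w :> (\<Sum>j\<le>N. a j * (of_nat j * w ^ (j - 1)))" for N
      by (auto intro!: derivative_eq_intros sum.cong)
    ultimately show ?thesis by (simp only:)
  qed
  ultimately have "g w = (\<Sum>j\<le>2*n+1. a j * (of_nat j * w ^ (j - 1)))"
    by (rule DERIV_unique)
  \<comment> \<open>pair the indices \<open>n - p\<close> and \<open>n + 1 + p\<close>\<close>
  also have "\<dots> = (\<Sum>j\<in>{..n} \<union> {n+1..2*n+1}. a j * (of_nat j * w ^ (j - 1)))"
    by (rule sum.cong) auto
  also have "\<dots> = (\<Sum>j\<le>n. a j * (of_nat j * w ^ (j - 1)))
      + (\<Sum>j=n+1..2*n+1. a j * (of_nat j * w ^ (j - 1)))"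
    by (rule sum.union_disjoint) auto
  also have "(\<Sum>j\<le>n. a j * (of_nat j * w ^ (j - 1)))
      = (\<Sum>p\<le>n. a (n - p) * (of_nat (n - p) * w ^ (n - p - 1)))"
    by (rule sum.reindex_bij_witness[of _ "\<lambda>p. n - p" "\<lambda>p. n - p"]) auto
  also have "(\<Sum>j=n+1..2*n+1. a j * (of_nat j * w ^ (j - 1)))
      = (\<Sum>p\<le>n. a (n + 1 + p) * (of_nat (n + 1 + p) * w ^ (n + p)))"
    by (rule sum.reindex_bij_witness[of _ "\<lambda>p. n + 1 + p" "\<lambda>j. j - n - 1"]) auto
  also have "(\<Sum>p\<le>n. a (n - p) * (of_nat (n - p) * w ^ (n - p - 1))) + \<dots>
      = (\<Sum>p\<le>n. (-1) ^ Suc n * q ^ (Suc n choose 2) * inverse q ^ (n * n) *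
          ((-1) ^ p * of_nat (2 * p + 1) * q ^ (Suc p choose 2) * gauss_binom q (2 * n + 1) (n - p)))"
    unfolding sum.distrib[symmetric]
  proof (rule sum.cong)
    fix p assume "p \<in> {..n}"
    then obtain j where n: "n = j + p" by (metis add.commute atMost_iff le_iff_add)
    then have "n - p = j" by simp
    have gs: "gauss_binom q (2 * n + 1) (n + 1 + p) = gauss_binom q (2 * n + 1) (n - p)"
    proof -
      have "2 * n + 1 - (n + 1 + p) = n - p" "2 * n + 1 - (n - p) = n + 1 + p" using n by auto
      then show ?thesis by (simp add: gauss_binom_def mult.commute)
    qed
    have up: "q ^ ((n + 1 + p) choose 2) * w ^ (n + p)
        = q ^ (Suc n choose 2) * inverse q ^ (n * n) * q ^ (Suc p choose 2)"
    proof -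
      have "2 * ((n + 1 + p) choose 2) = 2 * ((Suc n choose 2) + (Suc p choose 2) + n * p)"
        using twice_choose_two[of "n + p"] twice_choose_two[of n] twice_choose_two[of p]
        by (simp add: algebra_simps)
      then have "(n + 1 + p) choose 2 = (Suc n choose 2) + (Suc p choose 2) + n * p" by simp
      moreover have "q ^ (n * p) * inverse q ^ (n * p) = 1" using q by (simp add: power_inverse)
      moreover have "w ^ (n + p) = inverse q ^ (n * n) * inverse q ^ (n * p)"
        by (simp add: w_def power_mult[symmetric] power_add[symmetric] algebra_simps)
      ultimately show ?thesis by (simp add: power_add algebra_simps)
    qed
    have down: "of_nat j * (q ^ (j choose 2) * w ^ (j - 1))
        = of_nat j * (q ^ (Suc n choose 2) * inverse q ^ (n * n) * q ^ (Suc p choose 2))"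
    proof (cases j)
      case (Suc i)
      have "2 * ((j choose 2) + n * n) = 2 * ((Suc n choose 2) + (Suc p choose 2) + n * i)"
        using twice_choose_two[of i] twice_choose_two[of n] twice_choose_two[of p] n Suc
        by (simp add: algebra_simps)
      then have "(j choose 2) + n * n = (Suc n choose 2) + (Suc p choose 2) + n * i" by simp
      then have "q ^ (j choose 2) * q ^ (n * n) = q ^ (Suc n choose 2) * q ^ (Suc p choose 2) * q ^ (n * i)"
        by (simp flip: power_add)
      then have "q ^ (j choose 2) * inverse (q ^ (n * i))
          = q ^ (Suc n choose 2) * inverse (q ^ (n * n)) * q ^ (Suc p choose 2)"
        by (intro cross_multiply) (use q in simp_all)
      moreover have "w ^ (j - 1) = inverse (q ^ (n * i))"
        by (simp add: w_def Suc power_mult[symmetric] power_inverse)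
      ultimately show ?thesis by (metis power_inverse)
    qed simp
    have e1: "a (n - p) * (of_nat (n - p) * w ^ (n - p - 1))
       = (-1) ^ j * gauss_binom q (2*n+1) j * (of_nat j * (q ^ (j choose 2) * w ^ (j - 1)))"
      by (simp add: a_def n)
    have e2: "a (n + 1 + p) * (of_nat (n + 1 + p) * w ^ (n + p))
       = (-1) ^ (n + 1 + p) * gauss_binom q (2*n+1) j * (of_nat (n + 1 + p) * (q ^ ((n + 1 + p) choose 2) * w ^ (n + p)))"
      unfolding a_def gs by (simp add: n)
    have sgn: "(-1) ^ j = (-1) ^ n * (-1 :: complex) ^ p" by (simp add: n power_add)
    have num: "of_nat (n + 1 + p) = (of_nat j + of_nat (2 * p + 1) :: complex)"
      by (simp add: n)
    show "a (n - p) * (of_nat (n - p) * w ^ (n - p - 1)) + a (n + 1 + p) * (of_nat (n + 1 + p) * w ^ (n + p)) =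
         (-1) ^ Suc n * q ^ (Suc n choose 2) * inverse q ^ (n * n) *
         ((-1) ^ p * of_nat (2 * p + 1) * q ^ (Suc p choose 2) * gauss_binom q (2 * n + 1) (n - p))"
      unfolding e1 e2
      unfolding up down sgn num \<open>n - p = j\<close>
      by (simp only: power_add power_one_right power_Suc) (simp add: algebra_simps)
  qed simp
  also have "\<dots> = (-1) ^ Suc n * q ^ (Suc n choose 2) * inverse q ^ (n * n) *
      (\<Sum>p\<le>n. (-1) ^ p * of_nat (2 * p + 1) * q ^ (Suc p choose 2) * gauss_binom q (2 * n + 1) (n - p))"
    (is "_ = _ * ?S") by (simp only: sum_distrib_left)
  finally have sumside: "g w = (-1) ^ Suc n * q ^ (Suc n choose 2) * inverse q ^ (n * n) * ?S" .
  have "(\<Prod>k\<in>{..<2*n+1} - {n}. 1 - w * q ^ k)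
      = (\<Prod>k\<in>{..<n} \<union> {Suc n..<2*n+1}. 1 - w * q ^ k)"
    by (rule prod.cong) auto
  also have "\<dots> = (\<Prod>k<n. 1 - w * q ^ k) * (\<Prod>k=Suc n..<2*n+1. 1 - w * q ^ k)"
    by (rule prod.union_disjoint) auto
  also have "(\<Prod>k=Suc n..<2*n+1. 1 - w * q ^ k) = qpoch q n"
    unfolding qpoch_def
  proof (rule prod.reindex_bij_witness[of _ "\<lambda>i. Suc n + i" "\<lambda>k. k - Suc n"])
    fix k assume "k \<in> {Suc n..<2*n+1}"
    then obtain i where k: "k = Suc n + i" by (metis atLeastLessThan_iff le_iff_add)
    show "1 - q ^ Suc (k - Suc n) = 1 - w * q ^ k"
      using wq by (simp add: k power_add mult.assoc[symmetric])
  qed auto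
  also have "(\<Prod>k<n. 1 - w * q ^ k) = (\<Prod>i<n. - (inverse q ^ Suc i) * (1 - q ^ Suc i))"
  proof (rule prod.reindex_bij_witness[of _ "\<lambda>i. n - Suc i" "\<lambda>k. n - Suc k"])
    fix k assume "k \<in> {..<n}"
    then obtain d where n: "n = k + Suc d" using less_imp_add_positive[of k n] by (metis Suc_pred lessThan_iff)
    show "- (inverse q ^ Suc (n - Suc k)) * (1 - q ^ Suc (n - Suc k)) = 1 - w * q ^ k"
      using q by (simp add: n w_def power_add field_simps)
  qed auto
  also have "\<dots> = (-1) ^ n * inverse q ^ (Suc n choose 2) * qpoch q n"
    unfolding qpoch_def
  proof (induction n)
    case (Suc n)
    have "Suc (Suc n) choose 2 = (Suc n choose 2) + Suc n" by (simp add: numeral_2_eq_2)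
    then show ?case using Suc by (simp add: power_add)
  qed (simp add: numeral_2_eq_2)
  finally have "g w = (-1) ^ Suc n * q ^ n * inverse q ^ (Suc n choose 2) * qpoch q n ^ 2"
    by (simp add: g_def power2_eq_square)
  with sumside have "(-1) ^ Suc n * (q ^ n * inverse q ^ (Suc n choose 2) * qpoch q n ^ 2)
      = (-1) ^ Suc n * (q ^ (Suc n choose 2) * inverse q ^ (n * n) * ?S)"
    by (simp only: mult.assoc)
  then have e: "q ^ n * inverse (q ^ (Suc n choose 2)) * qpoch q n ^ 2
      = q ^ (Suc n choose 2) * inverse (q ^ (n * n)) * ?S"
    unfolding power_inverse by (subst (asm) mult_cancel_left) auto
  have d: "q ^ n * q ^ (n * n) = q ^ (Suc n choose 2) * q ^ (Suc n choose 2)"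
    unfolding power_add[symmetric] using twice_choose_two[of n]
    by (intro arg_cong[of _ _ "\<lambda>k. q ^ k"]) simp
  show ?thesis
    by (rule cancel_common_powers[OF _ _ d e]) (use q in auto)
qed

lemma qpoch_LIMSEQ:
  fixes q :: complex
  assumes q: "norm q < 1"
  shows "qpoch q \<longlonglongrightarrow> (\<Prod>n. 1 - q ^ Suc n)" and "(\<Prod>n. 1 - q ^ Suc n) \<noteq> 0"
proof -
  have "summable (\<lambda>n. norm (q ^ Suc n))"
    using q by (subst summable_Suc_iff) (auto simp: norm_power)
  then have c: "convergent_prod (\<lambda>n. 1 - q ^ Suc n)"
    by (intro abs_convergent_prod_imp_convergent_prod summable_imp_abs_convergent_prod) simp
  show "qpoch q \<longlonglongrightarrow> (\<Prod>n. 1 - q ^ Suc n)"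
    unfolding qpoch_def[abs_def] by (rule has_prod_imp_tendsto'[OF convergent_prod_has_prod[OF c]])
  show "(\<Prod>n. 1 - q ^ Suc n) \<noteq> 0"
    using prodinf_nonzero[OF c] one_minus_power_nonzero[OF q] by blast
qed

text \<open>The limit of the finite identity: each Gaussian binomial tends to the inverse of the Euler product,
and all of them are bounded by one constant, so that Tannery's theorem applies.\<close>

theorem jacobi_cube:
  fixes q :: complex
  assumes q: "norm q < 1" "q \<noteq> 0"
  shows "summable (\<lambda>p. norm ((-1) ^ p * of_nat (2 * p + 1) * q ^ (Suc p choose 2)))"
    and "(\<Prod>n. 1 - q ^ Suc n) ^ 3 = (\<Sum>p. (-1) ^ p * of_nat (2 * p + 1) * q ^ (Suc p choose 2))"
proof -
  define L where "L = (\<Prod>n. 1 - q ^ Suc n)"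
  define c where "c p = (-1) ^ p * of_nat (2 * p + 1) * q ^ (Suc p choose 2)" for p
  have L: "qpoch q \<longlonglongrightarrow> L" "L \<noteq> 0" using qpoch_LIMSEQ[OF q(1)] by (auto simp: L_def)
  obtain D where D: "\<And>n. norm (qpoch q n) \<le> D" "D > 0"
    using convergent_imp_Bseq[of "qpoch q"] L unfolding Bseq_def convergent_def by auto
  have "(\<lambda>n. inverse (qpoch q n)) \<longlonglongrightarrow> inverse L" using L by (intro tendsto_intros)
  then obtain C where C: "\<And>n. norm (inverse (qpoch q n)) \<le> C" "C > 0"
    using convergent_imp_Bseq[of "\<lambda>n. inverse (qpoch q n)"] unfolding Bseq_def convergent_def by auto
  have gb: "norm (gauss_binom q n k) \<le> D * (C * C)" for n k
  proof -
    have "norm (gauss_binom q n k)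
        = norm (qpoch q n) * (norm (inverse (qpoch q k)) * norm (inverse (qpoch q (n - k))))"
      by (simp add: gauss_binom_def divide_inverse norm_mult)
    also have "\<dots> \<le> D * (C * C)" using C D by (intro mult_mono) auto
    finally show ?thesis .
  qed
  have c_bound: "norm (c p) \<le> 2 * (of_nat (Suc p) * norm q ^ p)" for p
  proof -
    have "p \<le> Suc p choose 2" by (induction p) (auto simp: numeral_2_eq_2)
    then have "norm q ^ (Suc p choose 2) \<le> norm q ^ p" using q by (intro power_decreasing) auto
    moreover have "norm (of_nat (2 * p + 1) :: complex) = real (2 * p + 1)" by (rule norm_of_nat)
    ultimately have "norm (c p) \<le> real (2 * p + 1) * norm q ^ p"
      by (simp only: c_def norm_mult norm_power norm_minus_cancel norm_one power_one mult_1_left)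
         (intro mult_left_mono, auto)
    also have "\<dots> \<le> (2 * real (Suc p)) * norm q ^ p" by (intro mult_right_mono) auto
    finally show ?thesis by (simp only: mult.assoc)
  qed
  have geo: "summable (\<lambda>p. of_nat (Suc p) * norm q ^ p)"
    using geometric_deriv_sums[of "norm q"] q by (auto simp: summable_def)
  then have "summable (\<lambda>p. 2 * (of_nat (Suc p) * norm q ^ p))" by (rule summable_mult)
  then have "summable (\<lambda>p. norm (c p))"
    by (rule summable_comparison_test'[where N = 0]) (use c_bound in simp)
  then show "summable (\<lambda>p. norm ((-1) ^ p * of_nat (2 * p + 1) * q ^ (Suc p choose 2)))"
    by (simp add: c_def)
  have csum: "summable c" using \<open>summable (\<lambda>p. norm (c p))\<close> by (rule summable_norm_cancel)
  define a where "a p n = (if p \<le> n then c p * gauss_binom q (2 * n + 1) (n - p) else 0)" for p n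
  have lim: "(\<lambda>n. a p n) \<longlonglongrightarrow> c p * inverse L" for p
  proof -
    have 1: "filterlim (\<lambda>n::nat. 2 * n + 1) at_top at_top" "filterlim (\<lambda>n::nat. n - p) at_top at_top"
         "filterlim (\<lambda>n::nat. n + 1 + p) at_top at_top"
      by (auto intro!: filterlim_subseq filterlim_minus_const_nat_at_top simp: strict_mono_def)
    have "(\<lambda>n. c p * (qpoch q (2 * n + 1) / (qpoch q (n - p) * qpoch q (n + 1 + p)))) \<longlonglongrightarrow> c p * (L / (L * L))"
      using L 1[THEN filterlim_compose[OF L(1)]] by (intro tendsto_intros) auto
    moreover have "eventually (\<lambda>n. c p * (qpoch q (2 * n + 1) / (qpoch q (n - p) * qpoch q (n + 1 + p))) = a p n) sequentially"
      using eventually_ge_at_top[of p]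
    proof eventually_elim
      case (elim n)
      then have "2 * n + 1 - (n - p) = n + 1 + p" by simp
      with elim show ?case by (simp add: a_def gauss_binom_def)
    qed
    ultimately show ?thesis using L by (simp add: tendsto_cong divide_simps)
  qed
  have bound: "norm (a p n) \<le> norm (c p) * (D * (C * C))" for p n
    using gb[of "2*n+1" "n-p"] C D by (auto simp: a_def norm_mult intro!: mult_left_mono)
  have "(\<lambda>n. suminf (\<lambda>p. a p n)) \<longlonglongrightarrow> suminf (\<lambda>p. c p * inverse L)"
    using tannerys_theorem[of a "\<lambda>p. c p * inverse L" sequentially "\<lambda>p. norm (c p) * (D * (C * C))"]
      lim bound \<open>summable (\<lambda>p. norm (c p))\<close>
      always_eventually[of "\<lambda>(k, n). norm (a k n) \<le> norm (c k) * (D * (C * C))" "sequentially \<times>\<^sub>F sequentially"]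
      summable_mult2[of "\<lambda>p. norm (c p)" "D * (C * C)"]
    by simp
  moreover have "suminf (\<lambda>p. a p n) = qpoch q n ^ 2" for n
  proof -
    have "suminf (\<lambda>p. a p n) = (\<Sum>p\<le>n. a p n)" by (rule suminf_finite) (auto simp: a_def)
    also have "\<dots> = qpoch q n ^ 2" unfolding finite_jacobi_cube[OF q] by (rule sum.cong) (auto simp: a_def c_def)
    finally show ?thesis .
  qed
  ultimately have "(\<lambda>n. qpoch q n ^ 2) \<longlonglongrightarrow> suminf c * inverse L"
    by (simp add: suminf_mult2[OF csum])
  moreover have "(\<lambda>n. qpoch q n ^ 2) \<longlonglongrightarrow> L ^ 2" using L by (intro tendsto_intros)
  ultimately have "L ^ 2 = suminf c * inverse L" by (rule LIMSEQ_unique[symmetric])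
  then have "L ^ 3 = suminf c" using L by (simp add: field_simps power3_eq_cube power2_eq_square)
  then show "(\<Prod>n. 1 - q ^ Suc n) ^ 3 = (\<Sum>p. (-1) ^ p * of_nat (2 * p + 1) * q ^ (Suc p choose 2))"
    unfolding L_def c_def .
qed

section \<open>Summation over the integers\<close>

lemma geometric_int_summable:
  fixes r :: real
  assumes "0 \<le> r" "r < 1"
  shows "(\<lambda>j::int. r ^ nat \<bar>j\<bar>) summable_on UNIV"
proof -
  have nat: "(\<lambda>n::nat. r ^ n) summable_on UNIV"
    by (rule norm_summable_imp_summable_on) (use assms in simp)
  have pos: "(\<lambda>j::int. r ^ nat \<bar>j\<bar>) summable_on {0..}"
    by (rule summable_on_reindex_bij_witness[of _ int nat UNIV "\<lambda>n. r ^ n", THEN iffD2]) (use nat in auto)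
  have neg: "(\<lambda>j::int. r ^ nat \<bar>j\<bar>) summable_on {..0}"
    by (rule summable_on_reindex_bij_witness[of _ "\<lambda>n. - int n" "\<lambda>j. nat (- j)" UNIV "\<lambda>n. r ^ n", THEN iffD2])
       (use nat in auto)
  have "UNIV = {0..} \<union> {..0::int}" by auto
  then show ?thesis using summable_on_union[OF pos neg] by simp
qed

lemma gaussian_int_summable:
  assumes "\<alpha> > 0"
  shows "(\<lambda>j::int. exp (- \<alpha> * of_int j ^ 2 + \<beta> * of_int j :: real)) summable_on UNIV"
proof (rule summable_on_comparison_test)
  \<comment> \<open>the maximum of \<open>(\<bar>\<beta>\<bar> + 1) x - \<alpha> x^2\<close>, so that a geometric series dominates\<close>
  define C where "C = (\<bar>\<beta>\<bar> + 1)\<^sup>2 / (4 * \<alpha>)"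
  show "(\<lambda>j::int. exp C * exp (-1) ^ nat \<bar>j\<bar>) summable_on UNIV"
    by (intro summable_on_cmult_right geometric_int_summable) auto
  fix j :: int
  define x where "x = \<bar>real_of_int j\<bar>"
  have "\<alpha> * (x - (\<bar>\<beta>\<bar> + 1) / (2 * \<alpha>))\<^sup>2 \<ge> 0" using assms by simp
  also have "\<alpha> * (x - (\<bar>\<beta>\<bar> + 1) / (2 * \<alpha>))\<^sup>2 = \<alpha> * x\<^sup>2 - (\<bar>\<beta>\<bar> + 1) * x + C"
    using assms by (simp add: C_def power2_eq_square field_simps)
  finally have "- \<alpha> * x\<^sup>2 + \<bar>\<beta>\<bar> * x \<le> C - x" by (simp add: algebra_simps)
  moreover have "\<beta> * of_int j \<le> \<bar>\<beta>\<bar> * x" unfolding x_def by (metis abs_ge_self abs_mult)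
  ultimately have "- \<alpha> * of_int j ^ 2 + \<beta> * of_int j \<le> C - x" by (simp add: x_def)
  moreover have "exp (-1) ^ nat \<bar>j\<bar> = exp (- x)"
    by (simp add: x_def exp_of_nat_mult[symmetric])
  ultimately show "exp (- \<alpha> * of_int j ^ 2 + \<beta> * of_int j) \<le> exp C * exp (-1) ^ nat \<bar>j\<bar>"
    by (simp add: exp_add[symmetric])
qed auto

text \<open>A double series is summable if, after a change of the pair of indices, it is dominated by a product of two single series.\<close>

lemma product_summable:
  fixes u v :: "int \<Rightarrow> real" and f :: "int \<times> int \<Rightarrow> complex"
  assumes g: "bij g"
    and u: "u summable_on UNIV" and v: "v summable_on UNIV" and nonneg: "\<And>k. u k \<ge> 0" "\<And>k. v k \<ge> 0"
    and bound: "\<And>k l. norm (f (k, l)) \<le> u (fst (g (k, l))) * v (snd (g (k, l)))"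
  shows "f summable_on UNIV"
proof -
  have "(\<lambda>(k, l). u k * v l) summable_on UNIV \<times> UNIV"
  proof (rule summable_on_SigmaI)
    fix k
    show "((\<lambda>l. (case (k, l) of (k, l) \<Rightarrow> u k * v l)) has_sum (u k * infsum v UNIV)) UNIV"
      using has_sum_cmult_right[OF has_sum_infsum[OF v]] by simp
    show "(\<lambda>k. u k * infsum v UNIV) summable_on UNIV" by (intro summable_on_cmult_left u)
  qed (use nonneg in auto)
  then have "(\<lambda>x. (\<lambda>(k, l). u k * v l) (g x)) summable_on UNIV"
    using summable_on_reindex_bij_betw[of g UNIV UNIV "\<lambda>(k, l). u k * v l"] g by simp
  moreover have "norm (f x) \<le> (\<lambda>(k, l). u k * v l) (g x)" for x
    using bound by (cases x) (auto simp: case_prod_beta)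
  ultimately have "(\<lambda>x. norm (f x)) summable_on UNIV"
    using Infinite_Sum.abs_summable_on_comparison_test'[of "\<lambda>x. (\<lambda>(k, l). u k * v l) (g x)" UNIV f] by blast
  then show ?thesis by (rule abs_summable_summable)
qed

text \<open>The substitution \<open>n \<mapsto> c - n\<close> turns the sum into its negative; a divergent series has \<open>infsum\<close> zero by convention.\<close>

lemma infsum_antisym:
  fixes f :: "int \<Rightarrow> complex"
  assumes "\<And>n. f (c - n) = - f n"
  shows "infsum f UNIV = 0"
proof -
  have "infsum f UNIV = infsum (\<lambda>n. - f n) UNIV"
    by (rule infsum_reindex_bij_witness[of _ "\<lambda>n. c - n" "\<lambda>n. c - n"]) (use assms in auto)
  then show ?thesis by (simp add: infsum_uminus)
qed

section \<open>Monomials and signs\<close>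

text \<open>The monomial \<open>x^a q^b\<close> with real exponents.  Keeping \<open>z\<close> and \<open>\<tau>\<close> inside the exponential makes fractional
powers single valued and reduces every identity of monomials to one of exponents.\<close>

definition xq :: "complex \<Rightarrow> complex \<Rightarrow> real \<Rightarrow> real \<Rightarrow> complex" where
  "xq \<tau> z a b = exp (2 * of_real pi * \<i> * (of_real a * z + of_real b * \<tau>))"

lemma xq_mult: "xq \<tau> z a b * xq \<tau> z c d = xq \<tau> z (a + c) (b + d)"
  by (simp add: xq_def exp_add[symmetric] algebra_simps)

lemma xq_mult_left: "xq \<tau> z a b * (xq \<tau> z c d * w) = xq \<tau> z (a + c) (b + d) * w"
  by (simp add: xq_mult[symmetric] mult.assoc)

lemma xq_nonzero [simp]: "xq \<tau> z a b \<noteq> 0" by (simp add: xq_def)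

lemma xq_0 [simp]: "xq \<tau> z 0 0 = 1" by (simp add: xq_def)

lemma qpow_xq: "qpow \<tau> b = xq \<tau> z 0 b"
  by (simp add: xq_def qpow_def mult_ac)

lemma norm_xq: "norm (xq \<tau> z a b) = exp (- 2 * pi * (a * Im z + b * Im \<tau>))"
  by (simp add: xq_def norm_exp_eq_Re)

lemma xq_uminus: "xq \<tau> (-z) a b = xq \<tau> z (-a) b"
  by (simp add: xq_def)

lemma xq_abs_summable:
  assumes "Im \<tau> > 0" "\<alpha> > 0"
    and "\<And>j. A j = a * of_int j + a0" "\<And>j. B j = \<alpha> * of_int j ^ 2 + \<beta> * of_int j + \<gamma>"
  shows "(\<lambda>j::int. norm (xq \<tau> z (A j) (B j))) summable_on UNIV"
proof -
  have "norm (xq \<tau> z (A j) (B j)) = exp (- 2 * pi * (a0 * Im z + \<gamma> * Im \<tau>)) *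
     exp (- (2 * pi * \<alpha> * Im \<tau>) * of_int j ^ 2 + (- 2 * pi * (a * Im z + \<beta> * Im \<tau>)) * of_int j)" for j
    by (simp add: norm_xq exp_add[symmetric] assms algebra_simps)
  moreover have "(\<lambda>j. exp (- 2 * pi * (a0 * Im z + \<gamma> * Im \<tau>)) *
     exp (- (2 * pi * \<alpha> * Im \<tau>) * of_int j ^ 2 + (- 2 * pi * (a * Im z + \<beta> * Im \<tau>)) * of_int j)) summable_on UNIV"
    using assms by (intro summable_on_cmult_right gaussian_int_summable) simp
  ultimately show ?thesis by simp
qed

lemma minus_one_powi: "(-1) powi k = (if even k then 1 else -1 :: complex)"
  by (auto simp: power_int_def minus_one_power_iff even_nat_iff)

lemma norm_minus_one_powi [simp]: "norm ((-1) powi k :: complex) = 1"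
  by (simp add: minus_one_powi)

section \<open>The kernel of the Appell sums and its moments\<close>

text \<open>The pole of index \<open>n\<close> of the Appell sums lies where \<open>x q^(2n + 1/2) = 1\<close>.\<close>

definition pole_free :: "complex \<Rightarrow> complex \<Rightarrow> bool" where
  "pole_free \<tau> z \<longleftrightarrow> (\<forall>n::int. xq \<tau> z 1 (2 * of_int n + 1/2) \<noteq> 1)"

text \<open>\<open>y^(1/2) / (1 - y)\<close> at \<open>y = x q^(2n + 1/2)\<close>; the half power makes it decay as \<open>n\<close> tends to either infinity.\<close>

definition appell_kernel :: "complex \<Rightarrow> complex \<Rightarrow> int \<Rightarrow> complex" where
  "appell_kernel \<tau> z n = xq \<tau> z (1/2) (of_int n + 1/4) / (1 - xq \<tau> z 1 (2 * of_int n + 1/2))"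

lemma appell_kernel_denominator:
  assumes "pole_free \<tau> z"
  shows "appell_kernel \<tau> z n * (1 - xq \<tau> z 1 (2 * of_int n + 1/2)) = xq \<tau> z (1/2) (of_int n + 1/4)"
proof -
  have "1 - xq \<tau> z 1 (2 * of_int n + 1/2) \<noteq> 0" using assms by (metis eq_iff_diff_eq_0 pole_free_def)
  then show ?thesis by (simp add: appell_kernel_def)
qed

text \<open>If \<open>norm y\<close> is at most \<open>1/2\<close> or at least \<open>2\<close>, then \<open>norm (1 - y)\<close> is at least half the square root of
\<open>norm y\<close>; only finitely many indices lie in between.  At a pole the kernel is \<open>0\<close>, since division by zero gives zero.\<close>

lemma appell_kernel_bounded:
  assumes "Im \<tau> > 0"
  obtains K where "K > 0" "\<And>n. norm (appell_kernel \<tau> z n) \<le> K"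
proof -
  define t where "t n = norm (xq \<tau> z (1/2) (of_int n + 1/4))" for n :: int
  define F where "F = {n. 1/2 < t n ^ 2 \<and> t n ^ 2 < 2}"
  have t2: "norm (xq \<tau> z 1 (2 * of_int n + 1/2)) = t n ^ 2" for n
    by (simp add: t_def power2_eq_square norm_mult[symmetric] xq_mult)
  have tpos: "t n > 0" for n by (simp add: t_def)
  have "F \<subseteq> {n. \<bar>real_of_int n\<bar> \<le> (\<bar>Im z\<bar> + Im \<tau> + 1) / Im \<tau>}"
  proof
    fix n assume "n \<in> F"
    define e where "e = - 2 * pi * (Im z + (2 * of_int n + 1/2) * Im \<tau>)"
    have "t n ^ 2 = exp e" by (simp add: t2[symmetric] norm_xq e_def)
    with \<open>n \<in> F\<close> have "exp e < 2" "1/2 < exp e" by (auto simp: F_def)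
    moreover have "exp e \<ge> 1 + e" "exp (-e) \<ge> 1 + (-e)" by (rule exp_ge_add_one_self)+
    moreover have "exp (-e) < 2" using \<open>1/2 < exp e\<close> by (simp add: exp_minus field_simps)
    ultimately have "\<bar>e\<bar> < 1" by linarith
    have "2 * pi * \<bar>Im z + (2 * of_int n + 1/2) * Im \<tau>\<bar> < 1"
      using \<open>\<bar>e\<bar> < 1\<close> by (simp add: e_def abs_mult)
    moreover have "1 * \<bar>Im z + (2 * of_int n + 1/2) * Im \<tau>\<bar> \<le> 2 * pi * \<bar>Im z + (2 * of_int n + 1/2) * Im \<tau>\<bar>"
      using pi_gt3 by (intro mult_right_mono) auto
    ultimately have "\<bar>Im z + (2 * of_int n + 1/2) * Im \<tau>\<bar> < 1" by simp
    then have "\<bar>2 * (of_int n * Im \<tau>)\<bar> \<le> \<bar>Im z\<bar> + Im \<tau> + 1" using assms by (simp add: algebra_simps)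
    moreover have "\<bar>of_int n * Im \<tau>\<bar> = \<bar>of_int n\<bar> * Im \<tau>" using assms by (simp add: abs_mult)
    ultimately have "\<bar>of_int n\<bar> * Im \<tau> \<le> \<bar>Im z\<bar> + Im \<tau> + 1" by arith
    then show "n \<in> {n. \<bar>real_of_int n\<bar> \<le> (\<bar>Im z\<bar> + Im \<tau> + 1) / Im \<tau>}"
      using assms by (simp add: field_simps)
  qed
  also have "\<dots> \<subseteq> {- \<lceil>(\<bar>Im z\<bar> + Im \<tau> + 1) / Im \<tau>\<rceil> .. \<lceil>(\<bar>Im z\<bar> + Im \<tau> + 1) / Im \<tau>\<rceil>}"
    by (auto simp: abs_le_iff) linarith+
  finally have fin: "finite F" using finite_subset by blast
  have b: "norm (appell_kernel \<tau> z n) \<le> 2 + (\<Sum>n\<in>F. norm (appell_kernel \<tau> z n))" for n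
  proof (cases "n \<in> F")
    case True
    then have "norm (appell_kernel \<tau> z n) \<le> (\<Sum>n\<in>F. norm (appell_kernel \<tau> z n))"
      using fin by (intro member_le_sum) auto
    then show ?thesis by simp
  next
    case False
    define y where "y = xq \<tau> z 1 (2 * of_int n + 1/2)"
    have k: "norm (appell_kernel \<tau> z n) = t n / norm (1 - y)" by (simp add: appell_kernel_def t_def y_def norm_divide)
    have ny: "norm y = t n ^ 2" by (simp add: y_def t2)
    from False consider "t n ^ 2 \<le> 1/2" | "t n ^ 2 \<ge> 2" by (force simp: F_def)
    then have "t n \<le> 2 * norm (1 - y)"
    proof cases
      case 1
      have "norm (1 - y) \<ge> 1 - norm y" by (metis norm_one norm_triangle_ineq2)
      with 1 have "norm (1 - y) \<ge> 1/2" by (simp add: ny)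
      moreover have "t n \<le> 1" using 1 tpos[of n] by (auto intro: power2_le_imp_le[of _ 1])
      ultimately show ?thesis by simp
    next
      case 2
      have "norm (1 - y) \<ge> norm y - 1" by (metis norm_minus_commute norm_one norm_triangle_ineq2)
      with 2 have "2 * norm (1 - y) \<ge> t n ^ 2" by (simp add: ny)
      moreover have "t n \<ge> 1"
      proof (rule ccontr)
        assume "\<not> t n \<ge> 1"
        then have "t n ^ 2 \<le> 1" using tpos[of n] by (intro power_le_one) auto
        with 2 show False by simp
      qed
      then have "t n \<le> t n ^ 2" by (simp add: self_le_power)
      ultimately show ?thesis by simp
    qed
    moreover have "norm (1 - y) > 0" using calculation tpos[of n] by linarith
    ultimately have "norm (appell_kernel \<tau> z n) \<le> 2" by (simp add: k field_simps)
    also have "\<dots> \<le> 2 + (\<Sum>n\<in>F. norm (appell_kernel \<tau> z n))" by (simp add: sum_nonneg)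
    finally show ?thesis .
  qed
  show ?thesis
    by (rule that[OF _ b]) (simp add: add_pos_nonneg sum_nonneg)
qed

lemma appell_kernel_sum_summable:
  assumes "Im \<tau> > 0" and "(\<lambda>n. norm (f n)) summable_on UNIV"
  shows "(\<lambda>n. norm (f n * appell_kernel \<tau> z n)) summable_on UNIV"
proof -
  obtain K where K: "K > 0" "\<And>n. norm (appell_kernel \<tau> z n) \<le> K" by (rule appell_kernel_bounded[OF assms(1), of z]) blast
  have "(\<lambda>n. norm (f n) * K) summable_on UNIV" by (intro summable_on_cmult_left assms)
  then show ?thesis
    by (rule Infinite_Sum.abs_summable_on_comparison_test') (use K in \<open>auto simp: norm_mult intro!: mult_left_mono\<close>)
qed

definition kernel_moment :: "complex \<Rightarrow> complex \<Rightarrow> int \<Rightarrow> complex" where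
  "kernel_moment \<tau> z l = (\<Sum>\<^sub>\<infinity>n\<in>UNIV. (-1) powi n * xq \<tau> z 0 (of_int n ^ 2 - 2 * of_int n * of_int l) * appell_kernel \<tau> z n)"

lemma kernel_moment_summable:
  assumes "Im \<tau> > 0"
  shows "(\<lambda>n. (-1) powi n * xq \<tau> z 0 (of_int n ^ 2 - 2 * of_int n * of_int l) * appell_kernel \<tau> z n) summable_on UNIV"
proof (rule abs_summable_summable, rule appell_kernel_sum_summable[OF assms])
  show "(\<lambda>n. norm ((-1) powi n * xq \<tau> z 0 (of_int n ^ 2 - 2 * of_int n * of_int l))) summable_on UNIV"
    using xq_abs_summable[of \<tau> 1 "\<lambda>_. 0" 0 0 "\<lambda>n. of_int n ^ 2 - 2 * of_int n * of_int l" "- 2 * of_int l" 0 z] assms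
    by (simp add: norm_mult algebra_simps)
qed

text \<open>In the difference the factor \<open>1 - y\<close> cancels the denominator of the kernel.  The theta series that remains
is odd under \<open>n \<mapsto> 2l + 1 - n\<close> and hence vanishes.\<close>

lemma kernel_moment_Suc:
  assumes "Im \<tau> > 0" "pole_free \<tau> z"
  shows "kernel_moment \<tau> z (l + 1) = xq \<tau> z 1 (1/2) * kernel_moment \<tau> z l"
proof -
  let ?f = "\<lambda>l n. (-1) powi n * xq \<tau> z 0 (of_int n ^ 2 - 2 * of_int n * of_int l) * appell_kernel \<tau> z n"
  let ?g = "\<lambda>n. (-1) powi n * xq \<tau> z (1/2) (of_int n ^ 2 - (2 * of_int l + 1) * of_int n + 1/4)"
  have "?f (l + 1) n - xq \<tau> z 1 (1/2) * ?f l n = ?g n" for n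
  proof -
    have "xq \<tau> z 1 (1/2) * xq \<tau> z 0 (of_int n ^ 2 - 2 * of_int n * of_int l)
        = xq \<tau> z 0 (of_int n ^ 2 - 2 * of_int n * of_int (l + 1)) * xq \<tau> z 1 (2 * of_int n + 1/2)"
      by (simp add: xq_mult algebra_simps)
    moreover have "xq \<tau> z 1 (1/2) * ?f l n
      = (-1) powi n * (xq \<tau> z 1 (1/2) * xq \<tau> z 0 (of_int n ^ 2 - 2 * of_int n * of_int l)) * appell_kernel \<tau> z n"
      by (simp only: mult_ac)
    ultimately have "?f (l + 1) n - xq \<tau> z 1 (1/2) * ?f l n
      = (-1) powi n * (xq \<tau> z 0 (of_int n ^ 2 - 2 * of_int n * of_int (l + 1))
          * (appell_kernel \<tau> z n * (1 - xq \<tau> z 1 (2 * of_int n + 1/2))))"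
      by (simp add: right_diff_distrib mult_ac)
    also have "\<dots> = ?g n"
      unfolding appell_kernel_denominator[OF assms(2)] by (simp add: xq_mult algebra_simps)
    finally show ?thesis .
  qed
  then have "infsum ?g UNIV = infsum (\<lambda>n. ?f (l + 1) n + (- (xq \<tau> z 1 (1/2))) * ?f l n) UNIV"
    by (intro infsum_cong) (simp add: algebra_simps)
  also have "\<dots> = kernel_moment \<tau> z (l + 1) + (- (xq \<tau> z 1 (1/2))) * kernel_moment \<tau> z l"
    unfolding kernel_moment_def
    by (subst infsum_cmult_right'[symmetric], rule infsum_add)
       (intro kernel_moment_summable summable_on_cmult_right assms)+
  finally have "infsum ?g UNIV = kernel_moment \<tau> z (l + 1) - xq \<tau> z 1 (1/2) * kernel_moment \<tau> z l" by simp
  moreover have "infsum ?g UNIV = 0"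
    by (rule infsum_antisym[of _ "2 * l + 1"])
       (auto simp: minus_one_powi power2_eq_square algebra_simps)
  ultimately show ?thesis by simp
qed

lemma kernel_moment_shift:
  assumes "Im \<tau> > 0" "pole_free \<tau> z"
  shows "kernel_moment \<tau> z l = xq \<tau> z (of_int l) (of_int l / 2) * kernel_moment \<tau> z 0"
proof (induction l rule: int_induct[of _ 0])
  case base
  then show ?case by simp
next
  case (step1 i)
  have "1 + real_of_int i = real_of_int (i + 1)" "1/2 + real_of_int i / 2 = real_of_int (i + 1) / 2" by simp_all
  then show ?case unfolding kernel_moment_Suc[OF assms] step1 xq_mult_left by (simp only:)
next
  case (step2 i)
  have "xq \<tau> z 1 (1/2) * kernel_moment \<tau> z (i - 1) = xq \<tau> z 1 (1/2) * (xq \<tau> z (of_int (i - 1)) (of_int (i - 1) / 2) * kernel_moment \<tau> z 0)"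
  proof -
    have "1 + real_of_int (i - 1) = real_of_int i" "1/2 + real_of_int (i - 1) / 2 = real_of_int i / 2"
      by (simp_all add: field_simps)
    then show ?thesis using kernel_moment_Suc[OF assms, of "i - 1"] step2(2) unfolding xq_mult_left by (simp only: diff_add_cancel)
  qed
  then show ?case by simp
qed

section \<open>The reciprocal of a theta function\<close>

lemma minus_one_powi_diff: "(-1) powi k * (-1) powi n = ((-1) powi (n - k) :: complex)"
  by (simp add: minus_one_powi)

text \<open>The general term of the vanishing series \<open>\<Sum> (-1)^p q^(p^2 + p)\<close>.\<close>

definition alt_pronic :: "complex \<Rightarrow> int \<Rightarrow> complex" where
  "alt_pronic \<tau> p = (-1) powi p * xq \<tau> 0 0 (of_int p ^ 2 + of_int p)"

lemma alt_pronic_reflect: "alt_pronic \<tau> (- 1 - p) = - alt_pronic \<tau> p"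
  by (auto simp: alt_pronic_def minus_one_powi power2_eq_square algebra_simps)

lemma alt_pronic_abs_summable:
  assumes "Im \<tau> > 0"
  shows "(\<lambda>p. norm (alt_pronic \<tau> p)) summable_on UNIV"
  using xq_abs_summable[of \<tau> 1 "\<lambda>_. 0" 0 0 "\<lambda>n. of_int n ^ 2 + of_int n" 1 0 0] assms
  by (simp add: alt_pronic_def norm_mult)

lemma alt_pronic_total: "infsum (alt_pronic \<tau>) UNIV = 0"
  by (rule infsum_antisym[of _ "-1"]) (rule alt_pronic_reflect)

text \<open>The terms of index \<open>p\<close> and \<open>-1 - p\<close> cancel, so the stretch from \<open>-k\<close> to \<open>k - 1\<close> contributes nothing.\<close>

lemma alt_pronic_tail:
  assumes "Im \<tau> > 0"
  shows "infsum (alt_pronic \<tau>) {- k..} = infsum (alt_pronic \<tau>) {\<bar>k\<bar>..}"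
proof (cases "k \<ge> 0")
  case True
  have sm: "alt_pronic \<tau> summable_on A" for A
    using summable_on_subset_banach[OF abs_summable_summable[OF alt_pronic_abs_summable[OF assms]]] by blast
  have "{- k..} = {- k..k - 1} \<union> {k..}" using True by auto
  then have "infsum (alt_pronic \<tau>) {- k..} = infsum (alt_pronic \<tau>) {- k..k - 1} + infsum (alt_pronic \<tau>) {k..}"
    by (simp add: infsum_Un_disjoint[OF sm sm])
  moreover have "(\<Sum>p\<in>{- k..k - 1}. alt_pronic \<tau> p) = (\<Sum>p\<in>{- k..k - 1}. - alt_pronic \<tau> p)"
    by (rule sum.reindex_bij_witness[of _ "\<lambda>p. - 1 - p" "\<lambda>p. - 1 - p"])
       (auto simp: alt_pronic_reflect)
  then have "(\<Sum>p\<in>{- k..k - 1}. alt_pronic \<tau> p) = 0" by (simp add: sum_negf)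
  ultimately show ?thesis using True by simp
qed simp

text \<open>The term of index \<open>p \<ge> 0\<close> belongs to the tails with \<open>-p \<le> k \<le> p\<close>, which gives the weight \<open>2p + 1\<close> of Jacobi's series.\<close>

lemma alt_pronic_tails_sum:
  assumes "Im \<tau> > 0"
  shows "(\<lambda>k. infsum (alt_pronic \<tau>) {\<bar>k\<bar>..}) summable_on UNIV"
    and "(\<Sum>\<^sub>\<infinity>k\<in>UNIV. infsum (alt_pronic \<tau>) {\<bar>k\<bar>..}) = (\<Prod>n. 1 - xq \<tau> 0 0 2 ^ Suc n) ^ 3"
proof -
  let ?q = "xq \<tau> 0 0 2"
  define f where "f k p = (if \<bar>k\<bar> \<le> p then alt_pronic \<tau> p else 0)" for k p :: int
  \<comment> \<open>the exponent is shared out by \<open>p^2 \<ge> k^2 / 2 + p^2 / 2\<close>, valid where \<open>\<bar>k\<bar> \<le> p\<close>\<close>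
  define u where "u k = norm (xq \<tau> 0 0 (of_int k ^ 2 / 2))" for k :: int
  have u: "u summable_on UNIV"
    unfolding u_def using xq_abs_summable[of \<tau> "1/2" "\<lambda>_. 0" 0 0 "\<lambda>n. of_int n ^ 2 / 2" 0 0 0] assms by simp
  have bound: "norm (f k p) \<le> u k * u p" for k p
  proof (cases "\<bar>k\<bar> \<le> p")
    case True
    then have "k ^ 2 \<le> p ^ 2" by (simp add: abs_le_square_iff[symmetric])
    then have "real_of_int k ^ 2 \<le> of_int p ^ 2" by (metis of_int_le_iff of_int_power)
    moreover have "real_of_int p \<ge> 0" using True by simp
    ultimately have "(of_int k ^ 2 / 2 + of_int p ^ 2 / 2) * Im \<tau> \<le> (of_int p ^ 2 + of_int p) * Im \<tau>"
      using assms by (intro mult_right_mono) auto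
    then have "2 * pi * ((of_int k ^ 2 / 2 + of_int p ^ 2 / 2) * Im \<tau>) \<le> 2 * pi * ((of_int p ^ 2 + of_int p) * Im \<tau>)"
      by (intro mult_left_mono) auto
    moreover have "norm (f k p) = exp (- (2 * pi * ((of_int p ^ 2 + of_int p) * Im \<tau>)))"
      using True by (simp add: f_def alt_pronic_def norm_mult norm_xq)
    moreover have "u k * u p = exp (- (2 * pi * ((of_int k ^ 2 / 2 + of_int p ^ 2 / 2) * Im \<tau>)))"
      by (simp add: u_def norm_mult[symmetric] xq_mult) (simp add: norm_xq)
    ultimately show ?thesis by simp
  qed (simp add: f_def u_def)
  have "(\<lambda>(k, p). f k p) summable_on UNIV"
    by (rule product_summable[OF bij_id u u]) (use bound in \<open>auto simp: u_def\<close>)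
  then have fs: "(\<lambda>(k, p). f k p) summable_on UNIV \<times> UNIV" by simp
  have tail: "infsum (f k) UNIV = infsum (alt_pronic \<tau>) {\<bar>k\<bar>..}" for k
    by (rule infsum_cong_neutral) (auto simp: f_def)
  show "(\<lambda>k. infsum (alt_pronic \<tau>) {\<bar>k\<bar>..}) summable_on UNIV"
    using summable_on_Sigma_banach[of f UNIV "\<lambda>_. UNIV"] fs by (simp add: tail)
  have "(\<Sum>\<^sub>\<infinity>k\<in>UNIV. infsum (alt_pronic \<tau>) {\<bar>k\<bar>..}) = (\<Sum>\<^sub>\<infinity>p\<in>UNIV. \<Sum>\<^sub>\<infinity>k\<in>UNIV. f k p)"
    unfolding tail[symmetric] by (rule infsum_swap_banach[OF fs])
  also have "\<dots> = (\<Sum>\<^sub>\<infinity>p\<in>range int. of_int (2 * p + 1) * alt_pronic \<tau> p)"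
  proof (rule infsum_cong_neutral)
    fix p :: int
    have e: "(\<Sum>\<^sub>\<infinity>k\<in>UNIV. f k p) = (\<Sum>\<^sub>\<infinity>k\<in>{- p..p}. alt_pronic \<tau> p)"
      by (rule infsum_cong_neutral) (auto simp: f_def)
    show "(\<Sum>\<^sub>\<infinity>k\<in>UNIV. f k p) = of_int (2 * p + 1) * alt_pronic \<tau> p" if "p \<in> UNIV \<inter> range int"
      using that by (auto simp: e)
    show "(\<Sum>\<^sub>\<infinity>k\<in>UNIV. f k p) = 0" if "p \<in> UNIV - range int"
    proof -
      have "p < 0" using that by (metis DiffD2 nonneg_int_cases not_le rangeI)
      then show ?thesis by (simp add: e)
    qed
  qed auto
  also have "\<dots> = (\<Sum>\<^sub>\<infinity>p\<in>UNIV. of_nat (2 * p + 1) * alt_pronic \<tau> (int p))"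
    by (subst infsum_reindex) (auto simp: o_def add.commute)
  also have "\<dots> = (\<Sum>\<^sub>\<infinity>p\<in>UNIV. (-1) ^ p * of_nat (2 * p + 1) * ?q ^ (Suc p choose 2))"
  proof (rule infsum_cong)
    fix p :: nat
    have "?q ^ k = xq \<tau> 0 0 (2 * k)" for k by (induction k) (simp_all add: xq_mult algebra_simps)
    moreover have "2 * real (Suc p choose 2) = real p ^ 2 + real p"
      using arg_cong[OF twice_choose_two[of p], of real] by (simp add: power2_eq_square algebra_simps)
    ultimately show "of_nat (2 * p + 1) * alt_pronic \<tau> (int p) = (-1) ^ p * of_nat (2 * p + 1) * ?q ^ (Suc p choose 2)"
      by (simp add: alt_pronic_def)
  qed
  also have "\<dots> = (\<Prod>n. 1 - ?q ^ Suc n) ^ 3"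
  proof -
    have q: "norm ?q < 1" "?q \<noteq> 0" using assms by (auto simp: norm_xq)
    show ?thesis
      unfolding jacobi_cube(2)[OF q]
      by (rule infsumI norm_summable_imp_has_sum jacobi_cube(1)[OF q] summable_sums summable_norm_cancel)+
  qed
  finally show "(\<Sum>\<^sub>\<infinity>k\<in>UNIV. infsum (alt_pronic \<tau>) {\<bar>k\<bar>..}) = (\<Prod>n. 1 - ?q ^ Suc n) ^ 3" .
qed

lemma xq_const: "xq \<tau> z 0 b = xq \<tau> 0 0 b"
  by (simp add: xq_def)

text \<open>The function \<open>1 / (1 - y)\<close> tends to \<open>1\<close> on one side and to \<open>0\<close> on the other.  After subtraction of the step
function the rest is the kernel times \<open>y^(1/2)\<close> or \<open>y^(-1/2)\<close>, whichever is small.\<close>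

lemma geometric_remainder_summable:
  assumes "Im \<tau> > 0" "pole_free \<tau> z"
  shows "(\<lambda>n. norm (1 / (1 - xq \<tau> z 1 (2 * of_int n + 1/2)) - (if n \<ge> 0 then 1 else 0))) summable_on UNIV"
proof -
  obtain K where K: "K > 0" "\<And>n. norm (appell_kernel \<tau> z n) \<le> K" by (rule appell_kernel_bounded[OF assms(1), of z]) blast
  define \<rho> where "\<rho> = exp (- (2 * pi * Im \<tau>))"
  define c where "c = norm (xq \<tau> z (1/2) (1/4)) + norm (xq \<tau> z (-1/2) (-1/4))"
  have "norm (1 / (1 - xq \<tau> z 1 (2 * of_int n + 1/2)) - (if n \<ge> 0 then 1 else 0)) \<le> c * K * \<rho> ^ nat \<bar>n\<bar>" for n
  proof -
    define y where "y = xq \<tau> z 1 (2 * of_int n + 1/2)"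
    have y: "1 - y \<noteq> 0" using assms(2) by (metis eq_iff_diff_eq_0 pole_free_def y_def)
    define e :: real where "e = (if n \<ge> 0 then 1/2 else -1/2)"
    have "1 / (1 - y) - (if n \<ge> 0 then 1 else 0) = xq \<tau> z e (2 * e * (of_int n + 1/4)) * appell_kernel \<tau> z n"
    proof (cases "n \<ge> 0")
      case True
      then have "1 / (1 - y) - (if n \<ge> 0 then 1 else 0) = y / (1 - y)" using y by (simp add: field_simps)
      also have "\<dots> = xq \<tau> z e (2 * e * (of_int n + 1/4)) * appell_kernel \<tau> z n"
        using True by (simp add: appell_kernel_def y_def e_def xq_mult)
      finally show ?thesis .
    next
      case False
      then show ?thesis by (simp add: appell_kernel_def y_def e_def xq_mult)
    qed
    moreover have "norm (xq \<tau> z e (2 * e * (of_int n + 1/4))) \<le> c * \<rho> ^ nat \<bar>n\<bar>"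
    proof -
      have "\<rho> ^ nat \<bar>n\<bar> = norm (xq \<tau> z 0 (of_int \<bar>n\<bar>))"
        by (simp add: \<rho>_def norm_xq exp_of_nat_mult[symmetric])
      moreover have "xq \<tau> z e (2 * e * (of_int n + 1/4)) = xq \<tau> z e (e / 2) * xq \<tau> z 0 (of_int \<bar>n\<bar>)"
        by (auto simp: xq_mult e_def algebra_simps)
      moreover have "norm (xq \<tau> z e (e / 2)) \<le> c" by (auto simp: c_def e_def)
      ultimately show ?thesis by (simp add: norm_mult mult_right_mono)
    qed
    ultimately show ?thesis
      using K mult_mono[of "norm (xq \<tau> z e (2 * e * (of_int n + 1/4)))" "c * \<rho> ^ nat \<bar>n\<bar>" "norm (appell_kernel \<tau> z n)" K]
      unfolding y_def by (simp add: norm_mult c_def \<rho>_def mult_ac)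
  qed
  moreover have "(\<lambda>n::int. c * K * \<rho> ^ nat \<bar>n\<bar>) summable_on UNIV"
    by (intro summable_on_cmult_right geometric_int_summable) (use assms in \<open>auto simp: \<rho>_def\<close>)
  ultimately show ?thesis
    by (intro Infinite_Sum.abs_summable_on_comparison_test'[where g = "\<lambda>n. c * K * \<rho> ^ nat \<bar>n\<bar>"]) auto
qed

definition theta_denominator :: "complex \<Rightarrow> complex \<Rightarrow> complex" where
  "theta_denominator \<tau> z = (\<Sum>\<^sub>\<infinity>k::int\<in>UNIV. (-1) powi k * xq \<tau> z (of_int k) (of_int k ^ 2 - of_int k / 2))"

text \<open>By \<open>kernel_moment_shift\<close> the product is \<open>x^(1/2) q^(1/4)\<close> times the double sum over \<open>k\<close> and \<open>n\<close> of
\<open>(-1)^(n-k) q^((n-k)^2 + (n-k)) / (1 - y\<^sub>n)\<close>.  This is not absolutely convergent, because \<open>1 / (1 - y\<^sub>n)\<close> tends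
to \<open>1\<close> as \<open>n\<close> grows; so the step function is split off.  The remainder sums to zero over \<open>k\<close>
first, and the step function contributes the tails of \<open>alt_pronic\<close>.\<close>

theorem theta_reciprocal:
  assumes "Im \<tau> > 0" "pole_free \<tau> z"
  shows "theta_denominator \<tau> z * kernel_moment \<tau> z 0 = xq \<tau> z (1/2) (1/4) * (\<Prod>n. 1 - xq \<tau> 0 0 2 ^ Suc n) ^ 3"
proof -
  define w where "w n = 1 / (1 - xq \<tau> z 1 (2 * of_int n + 1/2))" for n :: int
  define r where "r n = w n - (if n \<ge> 0 then 1 else 0)" for n
  let ?a = "alt_pronic \<tau>"
  have r: "(\<lambda>n. norm (r n)) summable_on UNIV"
    unfolding r_def w_def by (rule geometric_remainder_summable[OF assms])
  have "bij (\<lambda>(k, n). (n - k, n :: int))"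
    by (rule bij_betw_byWitness[where f' = "\<lambda>(k, n). (n - k, n)"]) auto
  then have "(\<lambda>(k, n). ?a (n - k) * r n) summable_on UNIV"
    by (rule product_summable[OF _ alt_pronic_abs_summable[OF assms(1)] r])
       (auto simp: norm_mult)
  then have F: "(\<lambda>(k, n). ?a (n - k) * r n) summable_on UNIV \<times> UNIV" by simp
  have shift: "bij_betw (\<lambda>n. n - k) A ((\<lambda>n. n - k) ` A)" for k :: int and A
    by (intro inj_on_imp_bij_betw) (auto simp: inj_on_def)
  have inner: "(-1) powi k * xq \<tau> z (of_int k) (of_int k ^ 2 - of_int k / 2) * kernel_moment \<tau> z 0
      = xq \<tau> z (1/2) (1/4) * ((\<Sum>\<^sub>\<infinity>n\<in>UNIV. ?a (n - k) * r n) + infsum ?a {\<bar>k\<bar>..})" for k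
  proof -
    have "xq \<tau> z (of_int k) (of_int k ^ 2 - of_int k / 2) * kernel_moment \<tau> z 0
        = xq \<tau> z 0 (of_int k ^ 2 - of_int k) * kernel_moment \<tau> z k"
      unfolding kernel_moment_shift[OF assms, of k] xq_mult_left by (simp add: field_simps)
    then have "(-1) powi k * xq \<tau> z (of_int k) (of_int k ^ 2 - of_int k / 2) * kernel_moment \<tau> z 0
       = ((-1) powi k * xq \<tau> z 0 (of_int k ^ 2 - of_int k)) * kernel_moment \<tau> z k"
      by (simp only: mult.assoc)
    also have "\<dots> = (\<Sum>\<^sub>\<infinity>n\<in>UNIV. xq \<tau> z (1/2) (1/4) * (?a (n - k) * w n))"
      unfolding kernel_moment_def infsum_cmult_right'[symmetric]
    proof (rule infsum_cong)
      fix n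
      have "((-1) powi k * xq \<tau> z 0 (of_int k ^ 2 - of_int k)) * ((-1) powi n * xq \<tau> z 0 (of_int n ^ 2 - 2 * of_int n * of_int k) * appell_kernel \<tau> z n)
        = ((-1) powi k * (-1) powi n) * (xq \<tau> z 0 (of_int k ^ 2 - of_int k) * (xq \<tau> z 0 (of_int n ^ 2 - 2 * of_int n * of_int k)
            * (xq \<tau> z (1/2) (of_int n + 1/4) * w n)))"
        by (simp add: appell_kernel_def w_def)
      also have "\<dots> = ((-1) powi (n - k)) * (xq \<tau> z (1/2) (1/4) * (xq \<tau> z 0 (of_int (n - k) ^ 2 + of_int (n - k)) * w n))"
        unfolding minus_one_powi_diff xq_mult_left by (simp add: power2_eq_square algebra_simps)
      also have "\<dots> = xq \<tau> z (1/2) (1/4) * (?a (n - k) * w n)"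
        by (simp add: alt_pronic_def xq_const[of \<tau> z])
      finally show "((-1) powi k * xq \<tau> z 0 (of_int k ^ 2 - of_int k)) * ((-1) powi n * xq \<tau> z 0 (of_int n ^ 2 - 2 * of_int n * of_int k) * appell_kernel \<tau> z n)
        = xq \<tau> z (1/2) (1/4) * (?a (n - k) * w n)" .
    qed
    also have "\<dots> = xq \<tau> z (1/2) (1/4) * (\<Sum>\<^sub>\<infinity>n\<in>UNIV. ?a (n - k) * r n + (if n \<ge> 0 then ?a (n - k) else 0))"
      unfolding infsum_cmult_right' by (intro arg_cong2[of _ _ _ _ "(*)"] refl infsum_cong) (auto simp: r_def algebra_simps)
    also have "(\<Sum>\<^sub>\<infinity>n\<in>UNIV. ?a (n - k) * r n + (if n \<ge> 0 then ?a (n - k) else 0))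
        = (\<Sum>\<^sub>\<infinity>n\<in>UNIV. ?a (n - k) * r n) + (\<Sum>\<^sub>\<infinity>n\<in>UNIV. (if n \<ge> 0 then ?a (n - k) else 0))"
    proof (rule infsum_add)
      show "(\<lambda>n. ?a (n - k) * r n) summable_on UNIV"
        using summable_on_SigmaD1[OF F, of k] by simp
      have "?a summable_on (\<lambda>n. n - k) ` {0..}"
        by (rule summable_on_subset_banach[OF abs_summable_summable[OF alt_pronic_abs_summable[OF assms(1)]]]) simp
      then have "(\<lambda>n. ?a (n - k)) summable_on {0..}"
        by (subst summable_on_reindex_bij_betw[OF shift])
      then show "(\<lambda>n. if n \<ge> 0 then ?a (n - k) else 0) summable_on UNIV"
        by (rule summable_on_cong_neutral[THEN iffD1, rotated -1]) auto
    qed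
    also have "(\<Sum>\<^sub>\<infinity>n\<in>UNIV. (if n \<ge> 0 then ?a (n - k) else 0)) = (\<Sum>\<^sub>\<infinity>n\<in>{0..}. ?a (n - k))"
      by (rule infsum_cong_neutral) auto
    also have "\<dots> = infsum ?a {- k..}"
      by (rule infsum_reindex_bij_witness[of _ "\<lambda>n. n + k" "\<lambda>n. n - k"]) auto
    finally show ?thesis unfolding alt_pronic_tail[OF assms(1)] .
  qed
  have "theta_denominator \<tau> z * kernel_moment \<tau> z 0
      = xq \<tau> z (1/2) (1/4) * (\<Sum>\<^sub>\<infinity>k\<in>UNIV. (\<Sum>\<^sub>\<infinity>n\<in>UNIV. ?a (n - k) * r n) + infsum ?a {\<bar>k\<bar>..})"
    unfolding theta_denominator_def infsum_cmult_left'[symmetric] inner infsum_cmult_right' ..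
  also have "(\<Sum>\<^sub>\<infinity>k\<in>UNIV. (\<Sum>\<^sub>\<infinity>n\<in>UNIV. ?a (n - k) * r n) + infsum ?a {\<bar>k\<bar>..})
     = (\<Sum>\<^sub>\<infinity>k\<in>UNIV. \<Sum>\<^sub>\<infinity>n\<in>UNIV. ?a (n - k) * r n) + (\<Sum>\<^sub>\<infinity>k\<in>UNIV. infsum ?a {\<bar>k\<bar>..})"
    by (rule infsum_add[OF summable_on_Sigma_banach[OF F] alt_pronic_tails_sum(1)[OF assms(1)]])
  also have "(\<Sum>\<^sub>\<infinity>k\<in>UNIV. \<Sum>\<^sub>\<infinity>n\<in>UNIV. ?a (n - k) * r n) = (\<Sum>\<^sub>\<infinity>n\<in>UNIV. \<Sum>\<^sub>\<infinity>k\<in>UNIV. ?a (n - k) * r n)"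
    by (rule infsum_swap_banach[OF F])
  also have "\<dots> = 0"
  proof (rule infsum_0)
    fix n :: int
    have "(\<Sum>\<^sub>\<infinity>k\<in>UNIV. ?a (n - k)) = infsum ?a UNIV"
      by (rule infsum_reindex_bij_witness[of _ "\<lambda>k. n - k" "\<lambda>k. n - k"]) auto
    then show "(\<Sum>\<^sub>\<infinity>k\<in>UNIV. ?a (n - k) * r n) = 0"
      by (simp add: infsum_cmult_left' alt_pronic_total)
  qed
  finally show ?thesis by (simp add: alt_pronic_tails_sum(2)[OF assms(1)])
qed

text \<open>The product with \<open>kernel_moment\<close> is a monomial times an Euler product, neither of which vanishes.\<close>

corollary theta_denominator_nonzero:
  assumes "Im \<tau> > 0" "pole_free \<tau> z"
  shows "theta_denominator \<tau> z \<noteq> 0"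
proof -
  have "norm (xq \<tau> 0 0 2) < 1" using assms by (simp add: norm_xq)
  from qpoch_LIMSEQ(2)[OF this] show ?thesis using theta_reciprocal[OF assms] by auto
qed

section \<open>A theta series times the kernel sum\<close>

text \<open>Up to a monomial, \<open>theta_minus (1/2) (M + 1)\<close>.\<close>

definition theta_numerator :: "real \<Rightarrow> complex \<Rightarrow> complex \<Rightarrow> complex" where
  "theta_numerator M \<tau> z = (\<Sum>\<^sub>\<infinity>l::int\<in>UNIV. (-1) powi l * xq \<tau> z ((M + 1) * of_int l) ((M + 1) * of_int l ^ 2 + of_int l / 2))"

text \<open>At \<open>j = 0\<close> this is \<open>Phi1\<close>; for other \<open>j\<close> the Gaussian factor is displaced by \<open>j\<close> against the poles.\<close>

definition appell_sum :: "real \<Rightarrow> int \<Rightarrow> complex \<Rightarrow> complex \<Rightarrow> complex" where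
  "appell_sum M j \<tau> z = (\<Sum>\<^sub>\<infinity>n::int\<in>UNIV. xq \<tau> z (M * of_int (n - j)) (M * of_int (n - j) ^ 2) * appell_kernel \<tau> z n)"

text \<open>The \<open>l\<close>-th term of the theta series contains \<open>(x q^(1/2))^l\<close>, which turns \<open>G\<^sub>0\<close> into \<open>G\<^sub>l\<close>.  Completing the
square in \<open>q^(l^2 + n^2 - 2nl)\<close> leaves \<open>q^((n-l)^2)\<close>, and \<open>j = n - l\<close> is the new outer index.\<close>

theorem theta_numerator_times_kernel:
  assumes "Im \<tau> > 0" "pole_free \<tau> z" "M > 0"
  shows "(\<lambda>j. (-1) powi j * xq \<tau> z 0 (of_int j ^ 2) * appell_sum M j \<tau> z) summable_on UNIV"
    and "theta_numerator M \<tau> z * kernel_moment \<tau> z 0 = (\<Sum>\<^sub>\<infinity>j\<in>UNIV. (-1) powi j * xq \<tau> z 0 (of_int j ^ 2) * appell_sum M j \<tau> z)"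
proof -
  define u where "u j = norm (xq \<tau> z 0 (of_int j ^ 2))" for j :: int
  define v where "v l = norm (xq \<tau> z (M * of_int l) (M * of_int l ^ 2))" for l :: int
  define H where "H j n = (-1) powi j * xq \<tau> z 0 (of_int j ^ 2) * (xq \<tau> z (M * of_int (n - j)) (M * of_int (n - j) ^ 2) * appell_kernel \<tau> z n)" for j n
  obtain K where K: "K > 0" "\<And>n. norm (appell_kernel \<tau> z n) \<le> K" by (rule appell_kernel_bounded[OF assms(1), of z]) blast
  have u: "u summable_on UNIV"
    unfolding u_def using xq_abs_summable[of \<tau> 1 "\<lambda>_. 0" 0 0 "\<lambda>n. of_int n ^ 2" 0 0] assms by simp
  have v: "v summable_on UNIV"
    unfolding v_def using xq_abs_summable[of \<tau> M "\<lambda>l. M * of_int l" M 0 "\<lambda>l. M * of_int l ^ 2" 0 0] assms by simp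
  have vK: "(\<lambda>l. v l * K) summable_on UNIV" by (intro summable_on_cmult_left v)
  have bound: "norm (H j n) \<le> u j * (v (n - j) * K)" for j n
    using K(2)[of n] by (auto simp: H_def u_def v_def norm_mult intro!: mult_left_mono)
  have bound2: "norm (H (n - l) n) \<le> u (n - l) * (v l * K)" for l n
    using bound[of "n - l" n] by simp
  have "bij (\<lambda>(j, n). (j, n - j :: int))"
    by (rule bij_betw_byWitness[where f' = "\<lambda>(j, l). (j, l + j)"]) auto
  then have "(\<lambda>(j, n). H j n) summable_on UNIV"
    by (rule product_summable[OF _ u vK]) (use bound K in \<open>auto simp: u_def v_def\<close>)
  then have HH: "(\<lambda>(j, n). H j n) summable_on UNIV \<times> UNIV" by simp
  have "bij (\<lambda>(l, n). (n - l, l :: int))"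
    by (rule bij_betw_byWitness[where f' = "\<lambda>(j, l). (l, l + j)"]) auto
  then have "(\<lambda>(l, n). H (n - l) n) summable_on UNIV"
    by (rule product_summable[OF _ u vK]) (use bound2 K in \<open>auto simp: u_def v_def\<close>)
  then have FF: "(\<lambda>(l, n). H (n - l) n) summable_on UNIV \<times> UNIV" by simp
  have inner: "(-1) powi j * xq \<tau> z 0 (of_int j ^ 2) * appell_sum M j \<tau> z = infsum (H j) UNIV" for j
    unfolding appell_sum_def H_def infsum_cmult_right' ..
  show "(\<lambda>j. (-1) powi j * xq \<tau> z 0 (of_int j ^ 2) * appell_sum M j \<tau> z) summable_on UNIV"
    unfolding inner by (rule summable_on_Sigma_banach[OF HH])
  have "theta_numerator M \<tau> z * kernel_moment \<tau> z 0 = (\<Sum>\<^sub>\<infinity>l\<in>UNIV. \<Sum>\<^sub>\<infinity>n\<in>UNIV. H (n - l) n)"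
    unfolding theta_numerator_def infsum_cmult_left'[symmetric]
  proof (rule infsum_cong)
    fix l :: int
    have "xq \<tau> z ((M + 1) * of_int l) ((M + 1) * of_int l ^ 2 + of_int l / 2) * kernel_moment \<tau> z 0
       = xq \<tau> z (M * of_int l) ((M + 1) * of_int l ^ 2) * kernel_moment \<tau> z l"
      unfolding kernel_moment_shift[OF assms(1,2), of l] xq_mult_left by (simp add: algebra_simps)
    then have "(-1) powi l * xq \<tau> z ((M + 1) * of_int l) ((M + 1) * of_int l ^ 2 + of_int l / 2) * kernel_moment \<tau> z 0
       = ((-1) powi l * xq \<tau> z (M * of_int l) ((M + 1) * of_int l ^ 2)) * kernel_moment \<tau> z l"
      by (simp only: mult.assoc)
    also have "\<dots> = (\<Sum>\<^sub>\<infinity>n\<in>UNIV. H (n - l) n)"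
      unfolding kernel_moment_def infsum_cmult_right'[symmetric]
    proof (rule infsum_cong)
      fix n
      have "(-1) powi l * xq \<tau> z (M * of_int l) ((M + 1) * of_int l ^ 2) *
          ((-1) powi n * xq \<tau> z 0 (of_int n ^ 2 - 2 * of_int n * of_int l) * appell_kernel \<tau> z n)
        = ((-1) powi l * (-1) powi n) * (xq \<tau> z (M * of_int l) ((M + 1) * of_int l ^ 2) *
            (xq \<tau> z 0 (of_int n ^ 2 - 2 * of_int n * of_int l) * appell_kernel \<tau> z n))"
        by (simp only: mult_ac)
      also have "\<dots> = H (n - l) n"
        unfolding minus_one_powi_diff H_def mult.assoc xq_mult_left by (simp add: power2_eq_square algebra_simps)
      finally show "(-1) powi l * xq \<tau> z (M * of_int l) ((M + 1) * of_int l ^ 2) *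
          ((-1) powi n * xq \<tau> z 0 (of_int n ^ 2 - 2 * of_int n * of_int l) * appell_kernel \<tau> z n) = H (n - l) n" .
    qed
    finally show "(-1) powi l * xq \<tau> z ((M + 1) * of_int l) ((M + 1) * of_int l ^ 2 + of_int l / 2) * kernel_moment \<tau> z 0
        = (\<Sum>\<^sub>\<infinity>n\<in>UNIV. H (n - l) n)" .
  qed
  also have "\<dots> = (\<Sum>\<^sub>\<infinity>n\<in>UNIV. \<Sum>\<^sub>\<infinity>l\<in>UNIV. H (n - l) n)"
    by (rule infsum_swap_banach[OF FF])
  also have "\<dots> = (\<Sum>\<^sub>\<infinity>n\<in>UNIV. \<Sum>\<^sub>\<infinity>j\<in>UNIV. H j n)"
    by (intro infsum_cong infsum_reindex_bij_witness[of _ "\<lambda>j. n - j" "\<lambda>l. n - l" for n]) auto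
  also have "\<dots> = (\<Sum>\<^sub>\<infinity>j\<in>UNIV. infsum (H j) UNIV)"
    by (rule infsum_swap_banach[OF HH, symmetric])
  finally show "theta_numerator M \<tau> z * kernel_moment \<tau> z 0 = (\<Sum>\<^sub>\<infinity>j\<in>UNIV. (-1) powi j * xq \<tau> z 0 (of_int j ^ 2) * appell_sum M j \<tau> z)"
    unfolding inner .
qed

section \<open>Changing the characteristic of an Appell sum\<close>

text \<open>The Appell sum with the kernel multiplied by \<open>y^s\<close>.\<close>

definition appell_sum_char :: "real \<Rightarrow> real \<Rightarrow> complex \<Rightarrow> complex \<Rightarrow> complex" where
  "appell_sum_char M s \<tau> z = (\<Sum>\<^sub>\<infinity>n::int\<in>UNIV. xq \<tau> z (M * of_int n + s) (M * of_int n ^ 2 + 2 * of_int n * s + s / 2) * appell_kernel \<tau> z n)"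

text \<open>Expanding \<open>(n - j)^2\<close> produces the factor \<open>(x q^(2n))^(-Mj)\<close>, a power of \<open>y\<close> up to a power of \<open>q\<close>.\<close>

lemma appell_sum_eq_char: "appell_sum M j \<tau> z = xq \<tau> z 0 (M * of_int j ^ 2 + M * of_int j / 2) * appell_sum_char M (- (M * of_int j)) \<tau> z"
  unfolding appell_sum_def appell_sum_char_def infsum_cmult_right'[symmetric] xq_mult_left
  by (intro infsum_cong arg_cong2[of _ _ _ _ "(*)"] arg_cong2[of _ _ _ _ "xq \<tau> z"])
     (auto simp: power2_eq_square algebra_simps)

lemma xq_split: "xq \<tau> z a b = exp (2 * of_real pi * \<i> * of_real a * z) * qpow \<tau> b"
  by (simp add: xq_def qpow_def exp_add[symmetric] algebra_simps)

lemma theta_xq: "theta k m \<tau> z = (\<Sum>\<^sub>\<infinity>j::int\<in>UNIV. xq \<tau> z (m * (of_int j + k / (2 * m))) (m * (of_int j + k / (2 * m)) ^ 2))"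
  unfolding theta_def xq_split ..

lemma complete_square:
  fixes M :: real
  assumes "M \<noteq> 0"
  shows "M * (x + k / (2 * M)) = M * x + k / 2"
    and "M * (x + k / (2 * M)) ^ 2 = M * x ^ 2 + k * x + k ^ 2 / (4 * M)"
  using assms by (simp_all add: power2_eq_square field_simps)

text \<open>Here \<open>y^s - y^(s+1) = y^s (1 - y)\<close> cancels the denominator, and the poles disappear.\<close>

lemma appell_sum_char_step:
  assumes "Im \<tau> > 0" "pole_free \<tau> z" "M > 0"
  shows "appell_sum_char M s \<tau> z - appell_sum_char M (s + 1) \<tau> z
    = xq \<tau> z 0 ((2 * s + 1) / 4 - (2 * s + 1) ^ 2 / (4 * M)) * theta (2 * s + 1) M \<tau> z"
proof -
  define f where "f s n = xq \<tau> z (M * of_int n + s) (M * of_int n ^ 2 + 2 * of_int n * s + s / 2) * appell_kernel \<tau> z n" for s n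
  have sm: "f s summable_on UNIV" for s
    unfolding f_def
    by (rule abs_summable_summable[OF appell_kernel_sum_summable[OF assms(1)
          xq_abs_summable[OF assms(1,3), of _ M s _ "2 * s" "s / 2"]]]) simp_all
  have "appell_sum_char M s \<tau> z - appell_sum_char M (s + 1) \<tau> z = infsum (\<lambda>n. f s n + - f (s + 1) n) UNIV"
    unfolding appell_sum_char_def f_def[symmetric]
    by (subst infsum_add[OF sm]) (simp_all add: sm infsum_uminus summable_on_uminus)
  also have "\<dots> = (\<Sum>\<^sub>\<infinity>n\<in>UNIV. xq \<tau> z 0 ((2 * s + 1) / 4 - (2 * s + 1) ^ 2 / (4 * M)) *
      xq \<tau> z (M * (of_int n + (2 * s + 1) / (2 * M))) (M * (of_int n + (2 * s + 1) / (2 * M)) ^ 2))"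
  proof (rule infsum_cong)
    fix n :: int
    let ?x = "xq \<tau> z (M * of_int n + s) (M * of_int n ^ 2 + 2 * of_int n * s + s / 2)"
    have "f (s + 1) n = ?x * (xq \<tau> z 1 (2 * of_int n + 1/2) * appell_kernel \<tau> z n)"
      unfolding xq_mult_left f_def by (simp add: algebra_simps add_divide_distrib)
    then have "f s n + - f (s + 1) n = ?x * appell_kernel \<tau> z n + - (?x * (xq \<tau> z 1 (2 * of_int n + 1/2) * appell_kernel \<tau> z n))"
      by (simp only: f_def)
    also have "\<dots> = ?x * (appell_kernel \<tau> z n * (1 - xq \<tau> z 1 (2 * of_int n + 1/2)))"
      by (simp add: right_diff_distrib)
    also have "\<dots> = xq \<tau> z (M * of_int n + s + 1/2) (M * of_int n ^ 2 + (2 * s + 1) * of_int n + (2 * s + 1) / 4)"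
      unfolding appell_kernel_denominator[OF assms(2)] by (simp add: xq_mult algebra_simps add_divide_distrib)
    also have "\<dots> = xq \<tau> z 0 ((2 * s + 1) / 4 - (2 * s + 1) ^ 2 / (4 * M)) *
      xq \<tau> z (M * (of_int n + (2 * s + 1) / (2 * M))) (M * (of_int n + (2 * s + 1) / (2 * M)) ^ 2)"
    proof -
      have "M \<noteq> 0" using assms(3) by simp
      show ?thesis
        unfolding complete_square[OF \<open>M \<noteq> 0\<close>] xq_mult by (intro arg_cong2[of _ _ _ _ "xq \<tau> z"]) (auto simp: field_simps)
    qed
    finally show "f s n + - f (s + 1) n = xq \<tau> z 0 ((2 * s + 1) / 4 - (2 * s + 1) ^ 2 / (4 * M)) *
      xq \<tau> z (M * (of_int n + (2 * s + 1) / (2 * M))) (M * (of_int n + (2 * s + 1) / (2 * M)) ^ 2)" .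
  qed
  also have "\<dots> = xq \<tau> z 0 ((2 * s + 1) / 4 - (2 * s + 1) ^ 2 / (4 * M)) * theta (2 * s + 1) M \<tau> z"
    by (simp add: theta_xq infsum_cmult_right')
  finally show ?thesis .
qed

lemma appell_sum_char_up:
  assumes "Im \<tau> > 0" "pole_free \<tau> z" "M > 0"
  shows "appell_sum_char M (real n) \<tau> z = appell_sum_char M 0 \<tau> z
    - (\<Sum>i<n. xq \<tau> z 0 (real (2 * i + 1) / 4 - real (2 * i + 1) ^ 2 / (4 * M)) * theta (real (2 * i + 1)) M \<tau> z)"
proof (induction n)
  case (Suc n)
  then show ?case using appell_sum_char_step[OF assms, of "real n"] by (simp add: algebra_simps)
qed simp

lemma appell_sum_char_down:
  assumes "Im \<tau> > 0" "pole_free \<tau> z" "M > 0"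
  shows "appell_sum_char M (- real n) \<tau> z = appell_sum_char M 0 \<tau> z
    + (\<Sum>i<n. xq \<tau> z 0 (- real (2 * i + 1) / 4 - real (2 * i + 1) ^ 2 / (4 * M)) * theta (- real (2 * i + 1)) M \<tau> z)"
proof (induction n)
  case (Suc n)
  have e: "2 * (- real (Suc n)) + 1 = - real (2 * n + 1)" "- real (Suc n) + 1 = - real n" by simp_all
  have "appell_sum_char M (- real (Suc n)) \<tau> z = appell_sum_char M (- real n) \<tau> z
    + xq \<tau> z 0 (- real (2 * n + 1) / 4 - real (2 * n + 1) ^ 2 / (4 * M)) * theta (- real (2 * n + 1)) M \<tau> z"
    using appell_sum_char_step[OF assms, of "- real (Suc n)"] unfolding e power2_minus by (metis add.commute diff_add_cancel)
  then show ?case unfolding Suc sum.lessThan_Suc by (simp only: add.assoc)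
qed simp

lemma theta_uminus: "theta k m \<tau> (- z) = theta (- k) m \<tau> z"
proof -
  have "m * (of_int (- j) + - k / (2 * m)) = - (m * (of_int j + k / (2 * m)))"
    and "(of_int (- j) + - k / (2 * m))\<^sup>2 = (of_int j + k / (2 * m))\<^sup>2" for j :: int
    by (simp_all add: power2_eq_square algebra_simps)
  then show ?thesis
    unfolding theta_xq xq_uminus
    by (intro infsum_reindex_bij_witness[of _ uminus uminus]) (simp_all only: minus_minus UNIV_I)
qed

lemma theta_period:
  assumes "m \<noteq> 0"
  shows "theta (k + 2 * m * of_int r) m \<tau> z = theta k m \<tau> z"
proof -
  have "of_int j + (k + 2 * m * of_int r) / (2 * m) = of_int (j + r) + k / (2 * m)" for j :: int
    using assms by (simp add: field_simps)
  then show ?thesis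
    unfolding theta_xq
    by (intro infsum_reindex_bij_witness[of _ "\<lambda>j. j - r" "\<lambda>j. j + r"]) (auto simp: add.assoc)
qed

lemma theta_diff_uminus: "theta_diff (- k) m \<tau> z = - theta_diff k m \<tau> z"
  by (simp add: theta_diff_def)

lemma theta_diff_period:
  assumes "m \<noteq> 0"
  shows "theta_diff (k + 2 * m * of_int r) m \<tau> z = theta_diff k m \<tau> z"
proof -
  have "- (k + 2 * m * of_int r) = - k + 2 * m * of_int (- r)" by simp
  then show ?thesis unfolding theta_diff_def using theta_period[OF assms] by metis
qed

lemma theta_diff_reflect:
  assumes "m \<noteq> 0"
  shows "theta_diff (2 * m * of_int r - k) m \<tau> z = - theta_diff k m \<tau> z"
  using theta_diff_period[OF assms, of "- k" r] by (simp add: theta_diff_uminus add.commute)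

text \<open>At \<open>j = 0\<close> this is \<open>Phi\<close>.\<close>

definition appell_diff :: "real \<Rightarrow> int \<Rightarrow> complex \<Rightarrow> complex \<Rightarrow> complex" where
  "appell_diff M j \<tau> z = appell_sum M j \<tau> z - appell_sum M j \<tau> (- z)"

text \<open>The two signs of \<open>j\<close> are treated together through \<open>\<sigma>\<close>.  The steps from characteristic \<open>-mj\<close> to \<open>0\<close> produce
theta functions whose indices are the odd numbers \<open>N\<close> below \<open>2mJ\<close>.  The reflection \<open>N \<mapsto> 2mJ - N\<close>, under
which \<open>theta_diff\<close> changes sign, absorbs the prefactor into the exponents.\<close>

lemma appell_diff_expansion:
  fixes m J :: nat and \<sigma> :: real
  assumes "Im \<tau> > 0" "pole_free \<tau> z" "pole_free \<tau> (- z)" "m > 0"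
    and \<sigma>: "(\<sigma> = 1 \<and> j = int J) \<or> (\<sigma> = -1 \<and> j = - int J)"
  shows "appell_diff (real m) j \<tau> z = qpow \<tau> (real m * real J ^ 2 + \<sigma> * (real m * real J / 2)) * appell_diff (real m) 0 \<tau> z
    + (\<Sum>i<m*J. qpow \<tau> ((real J + \<sigma> / 4) * real (2 * i + 1) - real (2 * i + 1) ^ 2 / (4 * real m)) * theta_diff (real (2 * i + 1)) (real m) \<tau> z)"
proof -
  let ?M = "real m"
  let ?N = "\<lambda>i. real (2 * i + 1)"
  let ?c = "qpow \<tau> (?M * real J ^ 2 + \<sigma> * (?M * real J / 2))"
  define V where "V s = appell_sum_char ?M s \<tau> z - appell_sum_char ?M s \<tau> (- z)" for s
  define E where "E i = qpow \<tau> (- \<sigma> * ?N i / 4 - ?N i ^ 2 / (4 * ?M)) * theta_diff (?N i) ?M \<tau> z" for i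
  have D: "appell_diff ?M 0 \<tau> z = V 0" by (simp add: appell_diff_def appell_sum_eq_char V_def)
  have e: "- (?M * of_int j) = - \<sigma> * real (m * J)"
    and e': "?M * of_int j ^ 2 + ?M * of_int j / 2 = ?M * real J ^ 2 + \<sigma> * (?M * real J / 2)"
    using \<sigma> by auto
  have "appell_diff ?M j \<tau> z = ?c * V (- \<sigma> * real (m * J))"
    unfolding appell_diff_def appell_sum_eq_char V_def e e' qpow_xq[symmetric] by (simp only: right_diff_distrib)
  also have "V (- \<sigma> * real (m * J)) = V 0 - (\<Sum>i<m*J. E i)"
  proof -
    have M: "?M > 0" using assms(4) by simp
    note up = appell_sum_char_up[OF assms(1) _ M] and down = appell_sum_char_down[OF assms(1) _ M]
    have "V (real n) = V 0 - (\<Sum>i<n. qpow \<tau> (?N i / 4 - ?N i ^ 2 / (4 * ?M)) * theta_diff (?N i) ?M \<tau> z)" for n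
      unfolding V_def up[OF assms(2)] up[OF assms(3)] theta_diff_def theta_uminus qpow_xq[symmetric]
        right_diff_distrib sum_subtractf by simp
    moreover have "V (- real n) = V 0 - (\<Sum>i<n. qpow \<tau> (- ?N i / 4 - ?N i ^ 2 / (4 * ?M)) * theta_diff (?N i) ?M \<tau> z)" for n
      unfolding V_def down[OF assms(2)] down[OF assms(3)] theta_diff_def theta_uminus qpow_xq[symmetric]
        right_diff_distrib sum_subtractf minus_minus by simp
    ultimately show ?thesis using \<sigma> unfolding E_def by (elim disjE) (simp_all only: mult_minus1 mult_1_left minus_minus)
  qed
  also have "(\<Sum>i<m*J. E i) = (\<Sum>i<m*J. E (m * J - Suc i))"
    by (rule sum.nat_diff_reindex[symmetric])
  also have "?c * (V 0 - (\<Sum>i<m*J. E (m * J - Suc i)))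
     = ?c * V 0 + (\<Sum>i<m*J. - (?c * E (m * J - Suc i)))"
    by (simp add: right_diff_distrib sum_distrib_left sum_negf)
  also have "(\<Sum>i<m*J. - (?c * E (m * J - Suc i)))
    = (\<Sum>i<m*J. qpow \<tau> ((real J + \<sigma> / 4) * ?N i - ?N i ^ 2 / (4 * ?M)) * theta_diff (?N i) ?M \<tau> z)"
  proof (rule sum.cong)
    fix i assume "i \<in> {..<m * J}"
    then have N: "?N (m * J - Suc i) = 2 * ?M * of_int (int J) - ?N i"
      by (auto simp: of_nat_diff)
    have "?M * real J ^ 2 + \<sigma> * (?M * real J / 2) + (- \<sigma> * (2 * ?M * of_int (int J) - ?N i) / 4 - (2 * ?M * of_int (int J) - ?N i) ^ 2 / (4 * ?M))
        = (real J + \<sigma> / 4) * ?N i - ?N i ^ 2 / (4 * ?M)"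
      using assms(4) by (simp add: field_simps power2_eq_square)
    then have "?c * qpow \<tau> (- \<sigma> * (2 * ?M * of_int (int J) - ?N i) / 4 - (2 * ?M * of_int (int J) - ?N i) ^ 2 / (4 * ?M))
       = qpow \<tau> ((real J + \<sigma> / 4) * ?N i - ?N i ^ 2 / (4 * ?M))"
      unfolding qpow_xq[of _ _ z] by (simp only: xq_mult add_0)
    then show "- (?c * E (m * J - Suc i))
      = qpow \<tau> ((real J + \<sigma> / 4) * ?N i - ?N i ^ 2 / (4 * ?M)) * theta_diff (?N i) ?M \<tau> z"
      unfolding E_def N using theta_diff_reflect[of ?M "int J" "?N i" \<tau> z] assms(4) by simp
  qed simp
  finally show ?thesis unfolding D .
qed

section \<open>Odd indices and convergence of the triple sums\<close>

lemma infsum_int_fold: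
  fixes f :: "int \<Rightarrow> complex"
  assumes f: "f summable_on UNIV" and "f 0 = 0"
  shows "infsum f UNIV = (\<Sum>\<^sub>\<infinity>J\<in>{1::nat..}. f (int J) + f (- int J))"
proof -
  have sm: "f summable_on A" for A using f summable_on_subset_banach by blast
  have "infsum f UNIV = infsum f ({1..} \<union> {..-1})"
  proof (rule infsum_cong_neutral)
    fix x :: int assume "x \<in> UNIV - ({1..} \<union> {..-1})"
    then have "x = 0" by auto
    then show "f x = 0" by (simp add: assms(2))
  qed auto
  also have "\<dots> = infsum f {1..} + infsum f {..-1}"
    by (rule infsum_Un_disjoint[OF sm sm]) auto
  also have "infsum f {1..} = (\<Sum>\<^sub>\<infinity>J\<in>{1::nat..}. f (int J))"
    by (rule infsum_reindex_bij_witness[of _ int nat]) auto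
  also have "infsum f {..-1} = (\<Sum>\<^sub>\<infinity>J\<in>{1::nat..}. f (- int J))"
    by (rule infsum_reindex_bij_witness[of _ "\<lambda>J. - int J" "\<lambda>j. nat (- j)"]) auto
  also have "(\<Sum>\<^sub>\<infinity>J\<in>{1::nat..}. f (int J)) + (\<Sum>\<^sub>\<infinity>J\<in>{1::nat..}. f (- int J)) = (\<Sum>\<^sub>\<infinity>J\<in>{1::nat..}. f (int J) + f (- int J))"
  proof (rule infsum_add[symmetric])
    show "(\<lambda>J. f (int J)) summable_on {1..}"
      using sm[of "{1..}"] by (rule summable_on_reindex_bij_witness[of _ int nat, THEN iffD1, rotated -1]) auto
    show "(\<lambda>J. f (- int J)) summable_on {1..}"
      using sm[of "{..-1}"]
      by (rule summable_on_reindex_bij_witness[of _ "\<lambda>J. - int J" "\<lambda>j. nat (- j)", THEN iffD1, rotated -1]) auto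
  qed
  finally show ?thesis .
qed

text \<open>The odd numbers below \<open>2m\<close> other than \<open>m\<close> are paired by \<open>k \<mapsto> 2m - k\<close>.\<close>

lemma sum_odd_block:
  fixes h :: "nat \<Rightarrow> complex"
  assumes "h m = 0"
  shows "(\<Sum>i<m. h (2 * i + 1)) = (\<Sum>k\<in>odd_upto (m - 1). h (2 * m - k)) + (\<Sum>k\<in>odd_upto (m - 1). h k)"
proof -
  have fin: "finite (odd_upto n)" for n by (simp add: odd_upto_def)
  have "(\<Sum>i<m. h (2 * i + 1)) = (\<Sum>N\<in>odd_upto (2 * m - 1). h N)"
    by (rule sum.reindex_bij_witness[of _ "\<lambda>N. (N - 1) div 2" "\<lambda>i. 2 * i + 1"])
       (auto simp: odd_upto_def elim!: oddE)
  also have "\<dots> = (\<Sum>N\<in>(\<lambda>k. 2 * m - k) ` odd_upto (m - 1) \<union> odd_upto (m - 1). h N)"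
  proof (rule sum.mono_neutral_right)
    show "\<forall>N\<in>odd_upto (2 * m - 1) - ((\<lambda>k. 2 * m - k) ` odd_upto (m - 1) \<union> odd_upto (m - 1)). h N = 0"
    proof
      fix N assume N: "N \<in> odd_upto (2 * m - 1) - ((\<lambda>k. 2 * m - k) ` odd_upto (m - 1) \<union> odd_upto (m - 1))"
      have "\<not> N > m"
      proof
        assume "N > m"
        with N have "2 * m - N \<in> odd_upto (m - 1)" "N = 2 * m - (2 * m - N)" by (auto simp: odd_upto_def)
        with N show False by blast
      qed
      moreover have "\<not> N < m" using N by (auto simp: odd_upto_def)
      ultimately show "h N = 0" using assms by simp
    qed
  qed (auto simp: odd_upto_def)
  also have "\<dots> = (\<Sum>N\<in>(\<lambda>k. 2 * m - k) ` odd_upto (m - 1). h N) + (\<Sum>k\<in>odd_upto (m - 1). h k)"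
    by (rule sum.union_disjoint) (auto simp: odd_upto_def)
  also have "(\<Sum>N\<in>(\<lambda>k. 2 * m - k) ` odd_upto (m - 1). h N) = (\<Sum>k\<in>odd_upto (m - 1). h (2 * m - k))"
    by (subst sum.reindex) (auto simp: inj_on_def odd_upto_def)
  finally show ?thesis .
qed

text \<open>Every odd number below \<open>2mJ\<close> that is not an odd multiple of \<open>m\<close> is uniquely \<open>2mr - k\<close> or \<open>2mr + k\<close> with \<open>k\<close> odd and below \<open>m\<close>.\<close>

lemma sum_odd_blocks:
  fixes g :: "nat \<Rightarrow> complex"
  assumes "\<And>r. g (2 * m * r + m) = 0"
  shows "(\<Sum>i<m*J. g (2 * i + 1)) = (\<Sum>r=1..J. \<Sum>k\<in>odd_upto (m - 1). g (2 * m * r - k))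
      + (\<Sum>r<J. \<Sum>k\<in>odd_upto (m - 1). g (2 * m * r + k))"
proof (induction J)
  case (Suc J)
  have "(\<Sum>i<m * Suc J. g (2 * i + 1)) = (\<Sum>i<m*J. g (2 * i + 1)) + (\<Sum>i<m. g (2 * m * J + (2 * i + 1)))"
  proof -
    have "(\<Sum>i\<in>{..<m*J} \<union> {m*J..<m*J+m}. g (2 * i + 1)) = (\<Sum>i<m*J. g (2 * i + 1)) + (\<Sum>i=m*J..<m*J+m. g (2 * i + 1))"
      by (rule sum.union_disjoint) auto
    moreover have "{..<m*J} \<union> {m*J..<m*J+m} = {..<m * Suc J}" by auto
    moreover have "(\<Sum>i=m*J..<m*J+m. g (2 * i + 1)) = (\<Sum>i<m. g (2 * m * J + (2 * i + 1)))"
      by (rule sum.reindex_bij_witness[of _ "\<lambda>i. m * J + i" "\<lambda>i. i - m * J"]) (auto simp: algebra_simps)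
    ultimately show ?thesis by simp
  qed
  also have "(\<Sum>i<m. g (2 * m * J + (2 * i + 1)))
     = (\<Sum>k\<in>odd_upto (m - 1). g (2 * m * J + (2 * m - k))) + (\<Sum>k\<in>odd_upto (m - 1). g (2 * m * J + k))"
    by (rule sum_odd_block) (rule assms)
  also have "(\<Sum>k\<in>odd_upto (m - 1). g (2 * m * J + (2 * m - k))) = (\<Sum>k\<in>odd_upto (m - 1). g (2 * m * Suc J - k))"
    by (rule sum.cong) (auto simp: odd_upto_def intro!: arg_cong[of _ _ g])
  finally show ?case unfolding Suc.IH by (simp add: add_ac)
qed simp

lemma norm_qpow: "norm (qpow \<tau> b) = exp (- (2 * pi * (b * Im \<tau>)))"
  by (simp add: qpow_xq[of _ _ 0] norm_xq)

lemma norm_qpow_antimono: "Im \<tau> > 0 \<Longrightarrow> a \<le> b \<Longrightarrow> norm (qpow \<tau> b) \<le> norm (qpow \<tau> a)"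
  by (simp add: norm_qpow)

lemma qpow_add: "qpow \<tau> (a + b) = qpow \<tau> a * qpow \<tau> b"
  by (simp add: qpow_xq[of _ _ 0] xq_mult)

text \<open>In the range \<open>0 \<le> N \<le> 2MJ\<close>, the negative term \<open>- N^2 / (4M)\<close> of the exponent is compensated by \<open>(J - 1/4) N\<close>, so that \<open>q^(J^2)\<close> alone controls the growth.\<close>

lemma triple_sum_weight_bound:
  assumes "Im \<tau> > 0" "M > 0" "J \<ge> (1::nat)" "0 \<le> N" "N \<le> 2 * M * real J"
  shows "norm (qpow \<tau> (real J ^ 2 - 1 / (4 * M) * N ^ 2 - c) * (qpow \<tau> ((real J + 1/4) * N) + qpow \<tau> ((real J - 1/4) * N)))
    \<le> 2 * norm (qpow \<tau> (real J ^ 2 - c))"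
proof -
  have "1 / (4 * M) * N ^ 2 = N * (N / (4 * M))" by (simp add: power2_eq_square)
  also have "\<dots> \<le> N * (real J / 2)"
    using assms by (intro mult_left_mono) (auto simp: field_simps)
  finally have 1: "1 / (4 * M) * N ^ 2 \<le> N * (real J / 2)" .
  have "N * (real J / 2) \<le> N * (real J - 1/4)" using assms by (intro mult_left_mono) auto
  with 1 have 2: "1 / (4 * M) * N ^ 2 \<le> (real J - 1/4) * N" by (simp add: mult.commute)
  also have "\<dots> \<le> (real J + 1/4) * N" using assms by (intro mult_right_mono) auto
  finally have 3: "1 / (4 * M) * N ^ 2 \<le> (real J + 1/4) * N" .
  have "norm (qpow \<tau> (real J ^ 2 - 1 / (4 * M) * N ^ 2 - c + (real J + 1/4) * N)) \<le> norm (qpow \<tau> (real J ^ 2 - c))"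
       "norm (qpow \<tau> (real J ^ 2 - 1 / (4 * M) * N ^ 2 - c + (real J - 1/4) * N)) \<le> norm (qpow \<tau> (real J ^ 2 - c))"
    using 2 3 by (auto intro!: norm_qpow_antimono[OF assms(1)])
  then show ?thesis
    unfolding distrib_left qpow_add[symmetric]
    by (intro order_trans[OF norm_triangle_ineq]) linarith
qed

lemma weighted_sum_summable:
  fixes f :: "nat \<Rightarrow> complex"
  assumes "Im \<tau> > 0" and "\<And>J. J \<ge> 1 \<Longrightarrow> norm (f J) \<le> real J * (C * norm (qpow \<tau> (real J ^ 2 - c)))"
  shows "f summable_on {1..}"
proof (rule abs_summable_summable, rule Infinite_Sum.abs_summable_on_comparison_test')
  define a where "a = 2 * pi * Im \<tau>"
  have "a > 0" using assms by (simp add: a_def)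
  then have "(\<lambda>j::int. exp (- a * of_int j ^ 2 + 1 * of_int j)) summable_on UNIV"
    by (rule gaussian_int_summable)
  then have "(\<lambda>j::int. exp (- a * of_int j ^ 2 + 1 * of_int j)) summable_on (int ` {1..})"
    by (rule summable_on_subset_banach) simp
  then have "(\<lambda>J::nat. exp (- a * real J ^ 2 + real J)) summable_on {1..}"
    by (subst (asm) summable_on_reindex) (auto simp: o_def)
  then show "(\<lambda>J::nat. \<bar>C\<bar> * exp (a * c) * exp (- a * real J ^ 2 + real J)) summable_on {1..}"
    by (rule summable_on_cmult_right)
  fix J :: nat assume "J \<in> {1..}"
  then have "norm (f J) \<le> real J * (C * norm (qpow \<tau> (real J ^ 2 - c)))" using assms by simp
  also have "\<dots> \<le> real J * (\<bar>C\<bar> * norm (qpow \<tau> (real J ^ 2 - c)))"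
    by (intro mult_left_mono mult_right_mono) auto
  also have "real J \<le> exp (real J)" using exp_ge_add_one_self[of "real J"] by linarith
  then have "real J * (\<bar>C\<bar> * norm (qpow \<tau> (real J ^ 2 - c))) \<le> exp (real J) * (\<bar>C\<bar> * norm (qpow \<tau> (real J ^ 2 - c)))"
    by (rule mult_right_mono) simp
  also have "\<dots> = \<bar>C\<bar> * exp (a * c) * exp (- a * real J ^ 2 + real J)"
    by (simp add: norm_qpow a_def exp_add[symmetric] algebra_simps)
  finally show "norm (f J) \<le> \<bar>C\<bar> * exp (a * c) * exp (- a * real J ^ 2 + real J)" .
qed

text \<open>The index \<open>m\<close> is a fixed point of the reflection \<open>k \<mapsto> 2m - k\<close>.\<close>

lemma theta_diff_odd_multiple:
  assumes "m > 0"
  shows "theta_diff (2 * m * of_int r + m) m \<tau> z = 0"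
proof -
  have "theta_diff m m \<tau> z = - theta_diff m m \<tau> z"
    using theta_diff_reflect[of m 1 m \<tau> z] assms by simp
  then have "theta_diff m m \<tau> z = 0" by simp
  then show ?thesis using theta_diff_period[of m m r \<tau> z] assms by (simp add: add.commute)
qed

definition triple_sum_term :: "nat \<Rightarrow> complex \<Rightarrow> nat \<Rightarrow> real \<Rightarrow> complex" where
  "triple_sum_term m \<tau> j N = (-1) ^ j * qpow \<tau> (real j ^ 2 - 1 / (4 * real m) * N ^ 2 - real m / 16)
     * (qpow \<tau> ((real j + 1/4) * N) + qpow \<tau> ((real j - 1/4) * N))"

text \<open>Stated for arbitrary ranges of \<open>r\<close> and index maps \<open>N\<close>, to serve both triple sums.\<close>

lemma triple_sum_summable:
  assumes "Im \<tau> > 0" "m \<ge> 1" and R: "\<And>J. finite (R J) \<and> card (R J) \<le> J"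
    and N: "\<And>J r k. J \<ge> 1 \<Longrightarrow> r \<in> R J \<Longrightarrow> k \<in> odd_upto (m - 1) \<Longrightarrow> 0 \<le> N r k \<and> N r k \<le> 2 * real m * real J"
  shows "(\<lambda>J. \<Sum>r\<in>R J. \<Sum>k\<in>odd_upto (m - 1). triple_sum_term m \<tau> J (N r k) * theta_diff (real k) (real m) \<tau> z) summable_on {1..}"
proof (rule weighted_sum_summable[OF assms(1)])
  fix J :: nat assume J: "J \<ge> 1"
  let ?C = "\<Sum>k\<in>odd_upto (m - 1). norm (theta_diff (real k) (real m) \<tau> z)"
  let ?b = "2 * norm (qpow \<tau> (real J ^ 2 - real m / 16))"
  have "norm (\<Sum>k\<in>odd_upto (m - 1). triple_sum_term m \<tau> J (N r k) * theta_diff (real k) (real m) \<tau> z) \<le> ?b * ?C" if r: "r \<in> R J" for r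
    unfolding sum_distrib_left
  proof (rule sum_norm_le)
    fix k assume "k \<in> odd_upto (m - 1)"
    with N[OF J r] have "norm (triple_sum_term m \<tau> J (N r k)) \<le> ?b"
      using triple_sum_weight_bound[of \<tau> "real m" J "N r k" "real m / 16"] assms J
      by (simp add: triple_sum_term_def norm_mult norm_power)
    then show "norm (triple_sum_term m \<tau> J (N r k) * theta_diff (real k) (real m) \<tau> z) \<le> ?b * norm (theta_diff (real k) (real m) \<tau> z)"
      unfolding norm_mult by (rule mult_right_mono) simp
  qed
  then have "norm (\<Sum>r\<in>R J. \<Sum>k\<in>odd_upto (m - 1). triple_sum_term m \<tau> J (N r k) * theta_diff (real k) (real m) \<tau> z) \<le> (\<Sum>r\<in>R J. ?b * ?C)"
    by (rule sum_norm_le)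
  also have "\<dots> = real (card (R J)) * (?b * ?C)" by simp
  also have "\<dots> \<le> real J * (?b * ?C)" using R[of J] by (intro mult_right_mono) (auto simp: sum_nonneg)
  finally show "norm (\<Sum>r\<in>R J. \<Sum>k\<in>odd_upto (m - 1). triple_sum_term m \<tau> J (N r k) * theta_diff (real k) (real m) \<tau> z)
      \<le> real J * ((2 * ?C) * norm (qpow \<tau> (real J ^ 2 - real m / 16)))"
    by (simp add: mult_ac)
qed

section \<open>Theta, eta and Appell functions as series of monomials\<close>

lemma theta_minus_xq:
  "theta_minus k m \<tau> z = (\<Sum>\<^sub>\<infinity>j::int\<in>UNIV. (-1) powi j * xq \<tau> z (m * (of_int j + k / (2 * m))) (m * (of_int j + k / (2 * m)) ^ 2))"
  unfolding theta_minus_def xq_split mult.assoc ..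

lemma theta_minus_uminus: "theta_minus k m \<tau> (- z) = theta_minus (- k) m \<tau> z"
proof -
  have "m * (of_int (- j) + - k / (2 * m)) = - (m * (of_int j + k / (2 * m)))"
    and "(of_int (- j) + - k / (2 * m))\<^sup>2 = (of_int j + k / (2 * m))\<^sup>2"
    and "(-1) powi (- j) = ((-1) powi j :: complex)" for j :: int
    by (simp_all add: power2_eq_square algebra_simps minus_one_powi)
  then show ?thesis
    unfolding theta_minus_xq xq_uminus
    by (intro infsum_reindex_bij_witness[of _ uminus uminus]) (simp_all only: minus_minus UNIV_I)
qed

lemma theta_minus_eq_numerator:
  assumes "M > 0"
  shows "theta_minus (1/2) (M + 1) \<tau> z = xq \<tau> z (1/4) (1 / (16 * (M + 1))) * theta_numerator M \<tau> z"
proof -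
  have nz: "M + 1 \<noteq> 0" using assms by simp
  have "xq \<tau> z ((M + 1) * (of_int j + (1/2) / (2 * (M + 1)))) ((M + 1) * (of_int j + (1/2) / (2 * (M + 1))) ^ 2)
    = xq \<tau> z (1/4) (1 / (16 * (M + 1))) * xq \<tau> z ((M + 1) * of_int j) ((M + 1) * of_int j ^ 2 + of_int j / 2)" for j :: int
    unfolding complete_square[OF nz] xq_mult by (intro arg_cong2[of _ _ _ _ "xq \<tau> z"]) (auto simp: power2_eq_square)
  then show ?thesis
    unfolding theta_minus_xq theta_numerator_def infsum_cmult_right'[symmetric] by (intro infsum_cong) simp
qed

lemma theta_minus_eq_denominator:
  "theta_minus (- 1/2) 1 \<tau> z = xq \<tau> z (- 1/4) (1/16) * theta_denominator \<tau> z"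
proof -
  have "xq \<tau> z (1 * (of_int j + (- 1/2) / (2 * 1))) (1 * (of_int j + (- 1/2) / (2 * 1)) ^ 2)
    = xq \<tau> z (- 1/4) (1/16) * xq \<tau> z (of_int j) (of_int j ^ 2 - of_int j / 2)" for j :: int
    unfolding xq_mult by (intro arg_cong2[of _ _ _ _ "xq \<tau> z"]) (auto simp: field_simps power2_eq_square)
  then show ?thesis
    unfolding theta_minus_xq theta_denominator_def infsum_cmult_right'[symmetric] by (intro infsum_cong) simp
qed

lemma theta_minus_at_0:
  assumes "M \<ge> 0"
  shows "theta_minus (M / 2) (M + 1) \<tau> 0
    = qpow \<tau> (M ^ 2 / (16 * (M + 1))) * (\<Sum>\<^sub>\<infinity>j::int\<in>UNIV. (-1) powi j * qpow \<tau> ((M + 1) * of_int j ^ 2 + M * of_int j / 2))"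
proof -
  have nz: "M + 1 \<noteq> 0" using assms by simp
  have "(M + 1) * (of_int j + M / 2 / (2 * (M + 1))) ^ 2 = M ^ 2 / (16 * (M + 1)) + ((M + 1) * of_int j ^ 2 + M * of_int j / 2)" for j :: int
    unfolding complete_square[OF nz] by (simp add: power2_eq_square)
  then show ?thesis
    unfolding theta_minus_def infsum_cmult_right'[symmetric] by (intro infsum_cong) (simp add: qpow_add)
qed

text \<open>After the substitution of \<open>(m + 1) \<tau>\<close> for \<open>\<tau>\<close> and \<open>(m + 1/2) \<tau>\<close> for \<open>z\<close>, the series is the denominator theta series
of \<open>theta_reciprocal\<close>.  That point is \<open>pole_free\<close>, because \<open>3m + 2\<close> is not a multiple of \<open>4 (m + 1)\<close>.\<close>

lemma theta_minus_at_0_nonzero: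
  fixes m :: nat
  assumes "Im \<tau> > 0"
  shows "theta_minus (real m / 2) (real m + 1) \<tau> 0 \<noteq> 0"
proof -
  let ?M = "real m"
  define \<tau>' where "\<tau>' = of_real (?M + 1) * \<tau>"
  define z' where "z' = of_real (?M + 1/2) * \<tau>"
  have xq: "xq \<tau>' z' a b = qpow \<tau> (a * (?M + 1/2) + b * (?M + 1))" for a b
    by (simp add: xq_def qpow_def \<tau>'_def z'_def algebra_simps)
  have "pole_free \<tau>' z'"
    unfolding pole_free_def
  proof (intro allI notI)
    fix n :: int
    assume "xq \<tau>' z' 1 (2 * of_int n + 1/2) = 1"
    then have "norm (qpow \<tau> (1 * (?M + 1/2) + (2 * of_int n + 1/2) * (?M + 1))) = 1" by (simp add: xq)
    then have "1 * (?M + 1/2) + (2 * of_int n + 1/2) * (?M + 1) = 0" using assms by (simp add: norm_qpow)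
    then have "real_of_int (3 * int m + 2 + 4 * n * (int m + 1)) = 0" by (simp add: field_simps)
    then have e: "3 * int m + 2 + 4 * n * (int m + 1) = 0" by (simp only: of_int_eq_0_iff)
    show False
    proof (cases "n \<ge> 0")
      case True
      then have "4 * n * (int m + 1) \<ge> 0" by simp
      with e show False by (simp add: algebra_simps)
    next
      case False
      then have "n * (int m + 1) \<le> (- 1) * (int m + 1)" by (intro mult_right_mono) auto
      with e show False by (simp add: algebra_simps)
    qed
  qed
  moreover have "Im \<tau>' > 0" using assms by (simp add: \<tau>'_def)
  ultimately have "theta_denominator \<tau>' z' \<noteq> 0" by (intro theta_denominator_nonzero)
  moreover have "theta_denominator \<tau>' z' = (\<Sum>\<^sub>\<infinity>j::int\<in>UNIV. (-1) powi j * qpow \<tau> ((?M + 1) * of_int j ^ 2 + ?M * of_int j / 2))"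
    unfolding theta_denominator_def xq
    by (intro infsum_cong arg_cong2[of _ _ _ _ "(*)"] arg_cong[of _ _ "qpow \<tau>"]) (auto simp: field_simps power2_eq_square)
  ultimately show ?thesis
    by (subst theta_minus_at_0) (auto simp: qpow_def)
qed

lemma qpow_power: "qpow \<tau> (c * real n) = qpow \<tau> c ^ n"
  unfolding qpow_def exp_of_nat_mult[symmetric] by (simp add: mult_ac)

lemma dedekind_eta_nonzero:
  assumes "Im \<tau> > 0"
  shows "dedekind_eta \<tau> \<noteq> 0"
proof -
  have p: "qpow \<tau> (real (Suc n)) = qpow \<tau> 1 ^ Suc n" for n using qpow_power[of \<tau> 1 "Suc n"] by simp
  have "norm (qpow \<tau> 1) < 1" using assms by (simp add: norm_qpow)
  from qpoch_LIMSEQ(2)[OF this] show ?thesis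
    unfolding dedekind_eta_def p by (auto simp: qpow_def)
qed

lemma dedekind_eta_cube: "dedekind_eta (2 * \<tau>) ^ 3 = qpow \<tau> (1/4) * (\<Prod>n. 1 - xq \<tau> 0 0 2 ^ Suc n) ^ 3"
proof -
  have q: "qpow (2 * \<tau>) a = qpow \<tau> (2 * a)" for a by (simp add: qpow_def mult_ac)
  have p: "qpow \<tau> (2 * real (Suc n)) = xq \<tau> 0 0 2 ^ Suc n" for n
    using qpow_power[of \<tau> 2 "Suc n"] unfolding qpow_xq[of _ _ 0] .
  have "qpow \<tau> (1/12) ^ 3 = qpow \<tau> (1/4)"
    by (simp add: power3_eq_cube qpow_add[symmetric])
  then show ?thesis
    unfolding dedekind_eta_def q power_mult_distrib p by simp
qed

lemma mumford_theta_01_xq: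
  "mumford_theta 0 1 \<tau> z = (\<Sum>\<^sub>\<infinity>n\<in>UNIV. (-1) powi n * xq \<tau> z (of_int n) (of_int n ^ 2 / 2))"
  unfolding mumford_theta_def
proof (rule infsum_cong)
  fix n :: int
  have e: "exp (of_real pi * \<i> * of_int n) = ((-1) powi n :: complex)"
    using cis_power_int[of pi n] by (simp add: cis_conv_exp mult_ac)
  have "of_real pi * \<i> * of_real ((of_int n + real 0 / 2)^2) * \<tau>
        + 2 * of_real pi * \<i> * of_real (of_int n + real 0 / 2) * (z + of_real (real 1 / 2))
    = of_real pi * \<i> * of_int n + 2 * of_real pi * \<i> * (of_real (of_int n) * z + of_real (of_int n ^ 2 / 2) * \<tau>)"
    by (simp add: algebra_simps)
  then show "exp (of_real pi * \<i> * of_real ((of_int n + real 0 / 2)^2) * \<tau>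
        + 2 * of_real pi * \<i> * of_real (of_int n + real 0 / 2) * (z + of_real (real 1 / 2)))
    = (-1) powi n * xq \<tau> z (of_int n) (of_int n ^ 2 / 2)"
    unfolding xq_def by (simp only: exp_add e)
qed

lemma mumford_theta_01_uminus: "mumford_theta 0 1 \<tau> (- z) = mumford_theta 0 1 \<tau> z"
  unfolding mumford_theta_01_xq xq_uminus
  by (rule infsum_reindex_bij_witness[of _ uminus uminus]) (auto simp: minus_one_powi)

text \<open>At a pole of the kernel the terms of index \<open>n\<close> and \<open>4N + 1 - n\<close> of \<open>\<vartheta>\<^sub>0\<^sub>1\<close> cancel, so \<open>\<vartheta>\<^sub>0\<^sub>1\<close> vanishes there.\<close>

lemma mumford_01_pole_free:
  assumes "mumford_theta 0 1 \<tau> z \<noteq> 0"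
  shows "pole_free \<tau> z"
  unfolding pole_free_def
proof (intro allI notI)
  fix N :: int
  assume p: "xq \<tau> z 1 (2 * of_int N + 1/2) = 1"
  have "(\<Sum>\<^sub>\<infinity>n\<in>UNIV. (-1) powi n * xq \<tau> z (of_int n) (of_int n ^ 2 / 2)) = 0"
  proof (rule infsum_antisym[of _ "4 * N + 1"])
    fix n :: int
    define a :: real where "a = 2 * of_int N + 1/2"
    define k where "k = 4 * N + 1 - 2 * n"
    have "xq \<tau> z (of_int k) (a * of_int k) = xq \<tau> z 1 a powi k"
      by (simp add: xq_def exp_power_int mult_ac distrib_left)
    then have "xq \<tau> z (of_int k) (a * of_int k) = 1" using p by (simp add: a_def)
    then have "xq \<tau> z (of_int n) (of_int n ^ 2 / 2) = xq \<tau> z (of_int n) (of_int n ^ 2 / 2) * xq \<tau> z (of_int k) (a * of_int k)"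
      by simp
    also have "\<dots> = xq \<tau> z (of_int (4 * N + 1 - n)) (of_int (4 * N + 1 - n) ^ 2 / 2)"
      unfolding xq_mult by (intro arg_cong2[of _ _ _ _ "xq \<tau> z"]) (auto simp: k_def a_def power2_eq_square field_simps)
    finally show "(-1) powi (4 * N + 1 - n) * xq \<tau> z (of_int (4 * N + 1 - n)) (of_int (4 * N + 1 - n) ^ 2 / 2)
      = - ((-1) powi n * xq \<tau> z (of_int n) (of_int n ^ 2 / 2))"
      by (simp add: minus_one_powi)
  qed
  with assms show False unfolding mumford_theta_01_xq by simp
qed

lemma Phi1_eq_appell_sum:
  "Phi1 (M / 2) (1/2) (2 * \<tau>) (z + \<tau>/2) (z - \<tau>/2) 0 = appell_sum M 0 \<tau> z"
proof -
  have "exp (2 * of_real pi * \<i> * of_real (M / 2 * of_int j) * (z + \<tau>/2 + (z - \<tau>/2)) + 2 * of_real pi * \<i> * of_real (1/2) * (z + \<tau>/2))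
      * qpow (2 * \<tau>) (M / 2 * (of_int j)^2 + 1/2 * of_int j)
      / (1 - exp (2 * of_real pi * \<i> * (z + \<tau>/2)) * qpow (2 * \<tau>) (of_int j))
    = xq \<tau> z (M * of_int (j - 0)) (M * of_int (j - 0) ^ 2) * appell_kernel \<tau> z j" for j :: int
  proof -
    have "exp (2 * of_real pi * \<i> * of_real (M / 2 * of_int j) * (z + \<tau>/2 + (z - \<tau>/2)) + 2 * of_real pi * \<i> * of_real (1/2) * (z + \<tau>/2))
        * qpow (2 * \<tau>) (M / 2 * (of_int j)^2 + 1/2 * of_int j)
      = xq \<tau> z (M * of_int j + 1/2) (M * of_int j ^ 2 + (of_int j + 1/4))"
      unfolding qpow_def xq_def exp_add[symmetric] by (intro arg_cong[of _ _ exp]) (simp add: field_simps)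
    moreover have "exp (2 * of_real pi * \<i> * (z + \<tau>/2)) * qpow (2 * \<tau>) (of_int j) = xq \<tau> z 1 (2 * of_int j + 1/2)"
      unfolding qpow_def xq_def exp_add[symmetric] by (intro arg_cong[of _ _ exp]) (simp add: field_simps)
    ultimately show ?thesis
      by (simp add: appell_kernel_def xq_mult)
  qed
  then show ?thesis by (simp add: Phi1_def appell_sum_def)
qed

lemma Phi2_eq_appell_sum:
  "Phi2 (M / 2) (1/2) (2 * \<tau>) (z + \<tau>/2) (z - \<tau>/2) 0 = appell_sum M 0 \<tau> (- z)"
proof -
  have "Phi2 (M / 2) (1/2) (2 * \<tau>) (z + \<tau>/2) (z - \<tau>/2) 0 = Phi1 (M / 2) (1/2) (2 * \<tau>) (- z + \<tau>/2) (- z - \<tau>/2) 0"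
    unfolding Phi1_def Phi2_def by (simp add: algebra_simps)
  then show ?thesis by (simp only: Phi1_eq_appell_sum)
qed

lemma Phi_eq_appell_diff:
  "Phi (M / 2) (1/2) (2 * \<tau>) (z + \<tau>/2) (z - \<tau>/2) 0 = appell_diff M 0 \<tau> z"
  by (simp add: Phi_def Phi1_eq_appell_sum Phi2_eq_appell_sum appell_diff_def)

lemma eta_cube_theta_quotient:
  assumes "Im \<tau> > 0" "pole_free \<tau> z" "M > 0"
  shows "dedekind_eta (2 * \<tau>) ^ 3 * (theta_minus (1/2) (M + 1) \<tau> z / theta_minus (- 1/2) 1 \<tau> z)
    = qpow \<tau> (1 / (16 * (M + 1)) - 1/16) * (theta_numerator M \<tau> z * kernel_moment \<tau> z 0)"
proof -
  let ?c = "(\<Prod>n. 1 - xq \<tau> 0 0 2 ^ Suc n) ^ 3"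
  have T: "theta_denominator \<tau> z \<noteq> 0" by (rule theta_denominator_nonzero[OF assms(1,2)])
  have "kernel_moment \<tau> z 0 = xq \<tau> z (1/2) (1/4) * ?c / theta_denominator \<tau> z"
    using theta_reciprocal[OF assms(1,2)] T by (simp add: field_simps)
  then have "qpow \<tau> (1 / (16 * (M + 1)) - 1/16) * (theta_numerator M \<tau> z * kernel_moment \<tau> z 0) * xq \<tau> z (- 1/4) (1/16)
     = (qpow \<tau> (1 / (16 * (M + 1)) - 1/16) * (xq \<tau> z (1/2) (1/4) * xq \<tau> z (- 1/4) (1/16))) * (theta_numerator M \<tau> z * ?c / theta_denominator \<tau> z)"
    by simp
  also have "qpow \<tau> (1 / (16 * (M + 1)) - 1/16) * (xq \<tau> z (1/2) (1/4) * xq \<tau> z (- 1/4) (1/16))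
      = qpow \<tau> (1/4) * xq \<tau> z (1/4) (1 / (16 * (M + 1)))"
    unfolding qpow_xq[of _ _ z] xq_mult by (simp add: add_ac)
  finally have "qpow \<tau> (1 / (16 * (M + 1)) - 1/16) * (theta_numerator M \<tau> z * kernel_moment \<tau> z 0) * xq \<tau> z (- 1/4) (1/16)
     = dedekind_eta (2 * \<tau>) ^ 3 * (theta_minus (1/2) (M + 1) \<tau> z / theta_denominator \<tau> z)"
    unfolding dedekind_eta_cube theta_minus_eq_numerator[OF assms(3)] by simp
  then show ?thesis unfolding theta_minus_eq_denominator using T by (simp add: field_simps)
qed

section \<open>The theta constant times the Appell function\<close>

text \<open>The kernel sum is evaluated in two ways.  By \<open>theta_reciprocal\<close>, the product of numerator theta series
and kernel sum, antisymmetrised in \<open>z\<close>, is the quotient term.  By \<open>theta_numerator_times_kernel\<close> it is the sum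
of the \<open>appell_diff\<close>, of which the part proportional to \<open>\<Phi>\<close> adds up to the theta constant; the rest is folded onto
\<open>j \<ge> 1\<close> and regrouped into the two triple sums.\<close>

theorem theta_times_Appell:
  fixes m :: nat
  assumes \<tau>: "Im \<tau> > 0" and m: "m \<ge> 1" and nz: "mumford_theta 0 1 \<tau> z \<noteq> 0"
  shows "theta_minus (real m / 2) (real m + 1) \<tau> 0 *
      (qpow \<tau> (- real m / 16) * Phi (real m / 2) (1/2) (2 * \<tau>) (z + \<tau>/2) (z - \<tau>/2) 0)
    = dedekind_eta (2 * \<tau>) ^ 3 * (theta_minus (1/2) (real m + 1) \<tau> z / theta_minus (- 1/2) 1 \<tau> z
        - theta_minus (- 1/2) (real m + 1) \<tau> z / theta_minus (1/2) 1 \<tau> z)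
      + qpow \<tau> (real m ^ 2 / (16 * (real m + 1))) *
        ((\<Sum>\<^sub>\<infinity>j\<in>{1::nat..}. \<Sum>r=1..j. \<Sum>k\<in>odd_upto (m - 1).
            triple_sum_term m \<tau> j (2 * real m * real r - real k) * theta_diff (real k) (real m) \<tau> z)
       - (\<Sum>\<^sub>\<infinity>j\<in>{1::nat..}. \<Sum>r=0..j-1. \<Sum>k\<in>odd_upto (m - 1).
            triple_sum_term m \<tau> j (2 * real m * real r + real k) * theta_diff (real k) (real m) \<tau> z))"
proof -
  let ?M = "real m"
  let ?\<Phi> = "appell_diff ?M 0 \<tau> z"
  let ?S1 = "\<lambda>j. \<Sum>r=1..j. \<Sum>k\<in>odd_upto (m - 1). triple_sum_term m \<tau> j (2 * ?M * real r - real k) * theta_diff (real k) ?M \<tau> z"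
  let ?S2 = "\<lambda>j. \<Sum>r=0..j-1. \<Sum>k\<in>odd_upto (m - 1). triple_sum_term m \<tau> j (2 * ?M * real r + real k) * theta_diff (real k) ?M \<tau> z"
  have M: "?M > 0" using m by simp
  have pf: "pole_free \<tau> z" "pole_free \<tau> (- z)"
    using nz mumford_01_pole_free[of \<tau> z] mumford_01_pole_free[of \<tau> "- z"]
    unfolding mumford_theta_01_uminus by blast+
  define a where "a j = (-1) powi j * qpow \<tau> ((?M + 1) * of_int j ^ 2 + ?M * of_int j / 2)" for j :: int
  define w where "w j = (-1) powi j * qpow \<tau> (of_int j ^ 2) * appell_diff ?M j \<tau> z" for j :: int
  \<comment> \<open>the part of the \<open>j\<close>-th term that consists of theta functions; it vanishes at \<open>j = 0\<close>\<close>
  define f where "f j = w j - a j * ?\<Phi>" for j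
  have w_eq: "w j = (-1) powi j * xq \<tau> z 0 (of_int j ^ 2) * appell_sum ?M j \<tau> z
      + - ((-1) powi j * xq \<tau> (- z) 0 (of_int j ^ 2) * appell_sum ?M j \<tau> (- z))" for j
    by (simp add: w_def appell_diff_def qpow_xq[symmetric] right_diff_distrib)
  note products = theta_numerator_times_kernel[OF \<tau> pf(1) M] theta_numerator_times_kernel[OF \<tau> pf(2) M]
  have w_sum: "w summable_on UNIV"
    unfolding w_eq by (intro summable_on_add summable_on_uminus[THEN iffD2] products)
  have w_total: "infsum w UNIV = theta_numerator ?M \<tau> z * kernel_moment \<tau> z 0 - theta_numerator ?M \<tau> (- z) * kernel_moment \<tau> (- z) 0"
    unfolding w_eq products(2,4) by (subst infsum_add) (simp_all add: products(1,3) summable_on_uminus infsum_uminus)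
  have a_sum: "a summable_on UNIV"
  proof (rule abs_summable_summable)
    have "(\<lambda>j. norm (xq \<tau> 0 0 ((?M + 1) * of_int j ^ 2 + ?M * of_int j / 2))) summable_on UNIV"
      using M by (intro xq_abs_summable[OF \<tau>, of "?M + 1" _ 0 0 _ "?M / 2" 0]) auto
    then show "(\<lambda>j. norm (a j)) summable_on UNIV" by (simp add: a_def norm_mult qpow_xq[of _ _ 0])
  qed
  have f_sum: "f summable_on UNIV" and f_total: "infsum f UNIV = infsum w UNIV - infsum a UNIV * ?\<Phi>"
  proof -
    have f: "f = (\<lambda>j. w j + a j * (- ?\<Phi>))" by (simp add: f_def fun_eq_iff)
    have s: "(\<lambda>j. a j * (- ?\<Phi>)) summable_on UNIV" by (intro summable_on_cmult_left a_sum)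
    show "f summable_on UNIV" unfolding f by (intro summable_on_add w_sum s)
    show "infsum f UNIV = infsum w UNIV - infsum a UNIV * ?\<Phi>"
      unfolding f by (subst infsum_add[OF w_sum s], subst infsum_cmult_left') simp
  qed
  have f_val: "qpow \<tau> (- ?M / 16) * (f (int J) + f (- int J))
      = (\<Sum>i<m*J. triple_sum_term m \<tau> J (real (2 * i + 1)) * theta_diff (real (2 * i + 1)) ?M \<tau> z)" for J :: nat
  proof -
    have one: "f j = (\<Sum>i<m*J. (-1) ^ J * qpow \<tau> (real J ^ 2) * (qpow \<tau> ((real J + \<sigma> / 4) * real (2 * i + 1) - real (2 * i + 1) ^ 2 / (4 * ?M))
          * theta_diff (real (2 * i + 1)) ?M \<tau> z))"
      if \<sigma>: "(\<sigma> = 1 \<and> j = int J) \<or> (\<sigma> = -1 \<and> j = - int J)" for \<sigma> j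
    proof -
      have j: "(-1) powi j = ((-1) ^ J :: complex)" "real_of_int j ^ 2 = real J ^ 2" "?M * of_int j / 2 = \<sigma> * (?M * real J / 2)"
        using \<sigma> by (auto simp: minus_one_powi minus_one_power_iff)
      have "(-1) ^ J * qpow \<tau> (real J ^ 2) * (qpow \<tau> (?M * real J ^ 2 + \<sigma> * (?M * real J / 2)) * ?\<Phi>) = a j * ?\<Phi>"
        unfolding a_def j by (simp add: qpow_add[symmetric] algebra_simps)
      moreover have "appell_diff ?M j \<tau> z = qpow \<tau> (?M * real J ^ 2 + \<sigma> * (?M * real J / 2)) * ?\<Phi>
        + (\<Sum>i<m*J. qpow \<tau> ((real J + \<sigma> / 4) * real (2 * i + 1) - real (2 * i + 1) ^ 2 / (4 * ?M)) * theta_diff (real (2 * i + 1)) ?M \<tau> z)"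
        by (rule appell_diff_expansion[OF \<tau> pf _ \<sigma>]) (use m in simp)
      ultimately show ?thesis
        unfolding f_def w_def j by (simp only: distrib_left sum_distrib_left add_diff_cancel_left')
    qed
    have up: "f (int J) = (\<Sum>i<m*J. (-1) ^ J * qpow \<tau> (real J ^ 2) * (qpow \<tau> ((real J + 1 / 4) * real (2 * i + 1) - real (2 * i + 1) ^ 2 / (4 * ?M))
          * theta_diff (real (2 * i + 1)) ?M \<tau> z))"
      by (rule one) simp
    have down: "f (- int J) = (\<Sum>i<m*J. (-1) ^ J * qpow \<tau> (real J ^ 2) * (qpow \<tau> ((real J - 1 / 4) * real (2 * i + 1) - real (2 * i + 1) ^ 2 / (4 * ?M))
          * theta_diff (real (2 * i + 1)) ?M \<tau> z))"
      using one[of "-1" "- int J"] by simp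
    show ?thesis
      unfolding up down sum.distrib[symmetric] sum_distrib_left
    proof (rule sum.cong)
      fix i
      let ?N = "real (2 * i + 1)"
      have key: "qpow \<tau> (- ?M / 16) * ((-1) ^ J * qpow \<tau> (real J ^ 2) * (qpow \<tau> (y * ?N - ?N ^ 2 / (4 * ?M)) * theta_diff ?N ?M \<tau> z))
        = (-1) ^ J * qpow \<tau> (real J ^ 2 - 1 / (4 * ?M) * ?N ^ 2 - ?M / 16) * qpow \<tau> (y * ?N) * theta_diff ?N ?M \<tau> z" for y
      proof -
        have "qpow \<tau> (- ?M / 16) * (qpow \<tau> (real J ^ 2) * qpow \<tau> (y * ?N - ?N ^ 2 / (4 * ?M)))
          = qpow \<tau> (real J ^ 2 - 1 / (4 * ?M) * ?N ^ 2 - ?M / 16) * qpow \<tau> (y * ?N)"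
          unfolding qpow_add[symmetric] by (intro arg_cong[of _ _ "qpow \<tau>"]) simp
        then have "(-1) ^ J * (qpow \<tau> (- ?M / 16) * (qpow \<tau> (real J ^ 2) * qpow \<tau> (y * ?N - ?N ^ 2 / (4 * ?M)))) * theta_diff ?N ?M \<tau> z
          = (-1) ^ J * (qpow \<tau> (real J ^ 2 - 1 / (4 * ?M) * ?N ^ 2 - ?M / 16) * qpow \<tau> (y * ?N)) * theta_diff ?N ?M \<tau> z"
          by (simp only:)
        then show ?thesis by (simp only: mult_ac)
      qed
      have ring: "v * a * t + v * b * t = v * (a + b) * t" for v a b t :: complex
        by (simp add: algebra_simps)
      show "qpow \<tau> (- ?M / 16) * ((-1) ^ J * qpow \<tau> (real J ^ 2) * (qpow \<tau> ((real J + 1 / 4) * ?N - ?N ^ 2 / (4 * ?M)) * theta_diff ?N ?M \<tau> z)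
         + (-1) ^ J * qpow \<tau> (real J ^ 2) * (qpow \<tau> ((real J - 1 / 4) * ?N - ?N ^ 2 / (4 * ?M)) * theta_diff ?N ?M \<tau> z))
        = triple_sum_term m \<tau> J ?N * theta_diff ?N ?M \<tau> z"
        unfolding triple_sum_term_def distrib_left[of "qpow \<tau> (- ?M / 16)"] key by (rule ring)
    qed simp
  qed
  have block: "(\<Sum>i<m*J. triple_sum_term m \<tau> J (real (2 * i + 1)) * theta_diff (real (2 * i + 1)) ?M \<tau> z) = ?S2 J - ?S1 J"
    if J: "J \<ge> 1" for J
  proof -
    have "(\<Sum>i<m*J. triple_sum_term m \<tau> J (real (2 * i + 1)) * theta_diff (real (2 * i + 1)) ?M \<tau> z)
      = (\<Sum>r=1..J. \<Sum>k\<in>odd_upto (m - 1). triple_sum_term m \<tau> J (real (2 * m * r - k)) * theta_diff (real (2 * m * r - k)) ?M \<tau> z)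
        + (\<Sum>r<J. \<Sum>k\<in>odd_upto (m - 1). triple_sum_term m \<tau> J (real (2 * m * r + k)) * theta_diff (real (2 * m * r + k)) ?M \<tau> z)"
    proof (rule sum_odd_blocks)
      fix r
      show "triple_sum_term m \<tau> J (real (2 * m * r + m)) * theta_diff (real (2 * m * r + m)) ?M \<tau> z = 0"
        using theta_diff_odd_multiple[OF M, of "int r" \<tau> z] by simp
    qed
    also have "(\<Sum>r=1..J. \<Sum>k\<in>odd_upto (m - 1). triple_sum_term m \<tau> J (real (2 * m * r - k)) * theta_diff (real (2 * m * r - k)) ?M \<tau> z) = - ?S1 J"
      unfolding sum_negf[symmetric]
    proof (intro sum.cong refl)
      fix r k assume "r \<in> {1..J}" "k \<in> odd_upto (m - 1)"
      then have "k \<le> m" "1 \<le> r" by (auto simp: odd_upto_def)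
      then have "k \<le> m * r" using mult_le_mono2[of 1 r m] by linarith
      then have e: "real (2 * m * r - k) = 2 * ?M * of_int (int r) - real k" by (simp add: of_nat_diff)
      show "triple_sum_term m \<tau> J (real (2 * m * r - k)) * theta_diff (real (2 * m * r - k)) ?M \<tau> z
        = - (triple_sum_term m \<tau> J (2 * ?M * real r - real k) * theta_diff (real k) ?M \<tau> z)"
        unfolding e using theta_diff_reflect[of ?M "int r" "real k" \<tau> z] M by simp
    qed
    also have "(\<Sum>r<J. \<Sum>k\<in>odd_upto (m - 1). triple_sum_term m \<tau> J (real (2 * m * r + k)) * theta_diff (real (2 * m * r + k)) ?M \<tau> z) = ?S2 J"
    proof (intro sum.cong refl)
      show "{..<J} = {0..J - 1}" using J by auto
      fix r k
      have e: "real (2 * m * r + k) = real k + 2 * ?M * of_int (int r)" by simp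
      show "triple_sum_term m \<tau> J (real (2 * m * r + k)) * theta_diff (real (2 * m * r + k)) ?M \<tau> z
        = triple_sum_term m \<tau> J (2 * ?M * real r + real k) * theta_diff (real k) ?M \<tau> z"
        unfolding e using theta_diff_period[of ?M "real k" "int r" \<tau> z] M by (simp add: add.commute)
    qed
    finally show ?thesis by simp
  qed
  have S1: "?S1 summable_on {1..}"
  proof (rule triple_sum_summable[OF \<tau> m])
    fix J r k :: nat assume *: "J \<ge> 1" "r \<in> {1..J}" "k \<in> odd_upto (m - 1)"
    then have "real k \<le> ?M * 1" "?M * 1 \<le> ?M * real r" "?M * real r \<le> ?M * real J"
      by (auto simp: odd_upto_def simp del: mult_1_right intro!: mult_left_mono)
    then show "0 \<le> 2 * ?M * real r - real k \<and> 2 * ?M * real r - real k \<le> 2 * ?M * real J" by simp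
  qed simp
  have S2: "?S2 summable_on {1..}"
  proof -
    have "(\<lambda>j. \<Sum>r<j. \<Sum>k\<in>odd_upto (m - 1). triple_sum_term m \<tau> j (2 * ?M * real r + real k) * theta_diff (real k) ?M \<tau> z) summable_on {1..}"
    proof (rule triple_sum_summable[OF \<tau> m])
      fix J r k :: nat assume *: "J \<ge> 1" "r \<in> {..<J}" "k \<in> odd_upto (m - 1)"
      then have "real k \<le> ?M * 1" "?M * (real r + 1) \<le> ?M * real J"
        by (auto simp: odd_upto_def simp del: mult_1_right intro!: mult_left_mono)
      then show "0 \<le> 2 * ?M * real r + real k \<and> 2 * ?M * real r + real k \<le> 2 * ?M * real J"
        using M by (simp add: algebra_simps)
    qed simp
    then show ?thesis
      by (rule summable_on_cong[THEN iffD1, rotated]) (auto intro!: sum.cong)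
  qed
  have "qpow \<tau> (- ?M / 16) * infsum f UNIV = (\<Sum>\<^sub>\<infinity>J\<in>{1::nat..}. ?S2 J + - ?S1 J)"
  proof -
    have "f 0 = 0" by (simp add: f_def w_def a_def qpow_def)
    then have "qpow \<tau> (- ?M / 16) * infsum f UNIV = (\<Sum>\<^sub>\<infinity>J\<in>{1::nat..}. qpow \<tau> (- ?M / 16) * (f (int J) + f (- int J)))"
      by (simp add: infsum_int_fold[OF f_sum] infsum_cmult_right')
    also have "\<dots> = (\<Sum>\<^sub>\<infinity>J\<in>{1::nat..}. ?S2 J + - ?S1 J)"
      unfolding f_val
    proof (rule infsum_cong)
      fix J :: nat assume "J \<in> {1..}"
      then have "J \<ge> 1" by simp
      show "(\<Sum>i<m*J. triple_sum_term m \<tau> J (real (2 * i + 1)) * theta_diff (real (2 * i + 1)) ?M \<tau> z) = ?S2 J + - ?S1 J"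
        unfolding block[OF \<open>J \<ge> 1\<close>] by (rule diff_conv_add_uminus)
    qed
    finally show ?thesis .
  qed
  also have "\<dots> = infsum ?S2 {1..} - infsum ?S1 {1..}"
    by (subst infsum_add[OF S2]) (use S1 in \<open>simp_all add: summable_on_uminus infsum_uminus\<close>)
  finally have f_result: "qpow \<tau> (- ?M / 16) * infsum f UNIV = infsum ?S2 {1..} - infsum ?S1 {1..}" .
  let ?b = "?M ^ 2 / (16 * (?M + 1))"
  \<comment> \<open>the exponents left over by the theta constant and by the theta quotient agree\<close>
  have shift: "qpow \<tau> ?b * qpow \<tau> (- ?M / 16) = qpow \<tau> (1 / (16 * (?M + 1)) - 1/16)"
    unfolding qpow_add[symmetric] by (intro arg_cong[of _ _ "qpow \<tau>"]) (simp add: field_simps power2_eq_square)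
  have "theta_minus (?M / 2) (?M + 1) \<tau> 0 * (qpow \<tau> (- ?M / 16) * ?\<Phi>)
     = qpow \<tau> ?b * (qpow \<tau> (- ?M / 16) * (infsum a UNIV * ?\<Phi>))"
    unfolding theta_minus_at_0[OF of_nat_0_le_iff] a_def by simp
  also have "infsum a UNIV * ?\<Phi> = infsum w UNIV - infsum f UNIV" using f_total by simp
  also have "qpow \<tau> ?b * (qpow \<tau> (- ?M / 16) * (infsum w UNIV - infsum f UNIV))
     = (qpow \<tau> ?b * qpow \<tau> (- ?M / 16)) * infsum w UNIV + qpow \<tau> ?b * (infsum ?S1 {1..} - infsum ?S2 {1..})"
    using f_result by (simp add: right_diff_distrib mult.assoc)
  also have "(qpow \<tau> ?b * qpow \<tau> (- ?M / 16)) * infsum w UNIV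
      = dedekind_eta (2 * \<tau>) ^ 3 * (theta_minus (1/2) (?M + 1) \<tau> z / theta_minus (- 1/2) 1 \<tau> z)
      - dedekind_eta (2 * \<tau>) ^ 3 * (theta_minus (1/2) (?M + 1) \<tau> (- z) / theta_minus (- 1/2) 1 \<tau> (- z))"
    unfolding shift w_total right_diff_distrib eta_cube_theta_quotient[OF \<tau> pf(1) M] eta_cube_theta_quotient[OF \<tau> pf(2) M] ..
  finally show ?thesis
    unfolding Phi_eq_appell_diff theta_minus_uminus by (simp add: right_diff_distrib)
qed

section \<open>Translation of tau by one\<close>

text \<open>Hence \<open>qpow (-1) b\<close> serves as notation for the phase \<open>exp (- 2 \<pi> i b)\<close>.\<close>

lemma qpow_shift: "qpow (\<tau> - 1) b = qpow (- 1) b * qpow \<tau> b"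
  unfolding qpow_def exp_add[symmetric] by (intro arg_cong[of _ _ exp]) (simp add: algebra_simps)

lemma qpow_nonzero [simp]: "qpow \<tau> b \<noteq> 0"
  by (simp add: qpow_def)

lemma qpow_0 [simp]: "qpow \<tau> 0 = 1"
  by (simp add: qpow_def)

lemma qpow_minus_one_half: "qpow (- 1) (of_int n / 2) = (-1) powi n"
proof -
  have "cis (- pi) = - 1" by (simp add: complex_eq_iff)
  then have "(-1) powi n = cis (- pi) powi n" by simp
  also have "\<dots> = cis (of_int n * - pi)" by (rule cis_power_int)
  also have "\<dots> = qpow (- 1) (of_int n / 2)"
    unfolding qpow_def cis_conv_exp by (intro arg_cong[of _ _ exp]) simp
  finally show ?thesis ..
qed

lemma qpow_minus_one_int: "qpow (- 1) (of_int n) = 1"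
  using qpow_minus_one_half[of "2 * n"] by (simp add: minus_one_powi)

lemma theta_shift:
  assumes "M > (0 :: nat)"
  shows "theta (of_int k) (real M) (\<tau> - 1) z = qpow (- 1) (of_int k ^ 2 / (4 * real M)) * theta (of_int k) (real M) \<tau> z"
proof -
  have nz: "real M \<noteq> 0" using assms by simp
  have "qpow (- 1) (real M * of_int j ^ 2 + of_int k * of_int j + of_int k ^ 2 / (4 * real M)) = qpow (- 1) (of_int k ^ 2 / (4 * real M))" for j
    using qpow_minus_one_int[of "int M * j ^ 2 + k * j"] by (simp add: qpow_add)
  then show ?thesis
    unfolding theta_def infsum_cmult_right'[symmetric] complete_square(2)[OF nz] qpow_shift[of \<tau>]
    by (intro infsum_cong) simp
qed

lemma theta_diff_shift:
  assumes "M > (0 :: nat)"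
  shows "theta_diff (real k) (real M) (\<tau> - 1) z = qpow (- 1) (real k ^ 2 / (4 * real M)) * theta_diff (real k) (real M) \<tau> z"
  using theta_shift[OF assms, of "int k"] theta_shift[OF assms, of "- int k"]
  by (simp add: theta_diff_def right_diff_distrib)

text \<open>The half-integral index makes \<open>q^(cj/2)\<close> contribute \<open>(-1)^j\<close>, which cancels the alternating sign.\<close>

lemma theta_minus_shift:
  assumes "M > (0 :: nat)" "odd c"
  shows "theta_minus (of_int c / 2) (real M) (\<tau> - 1) z
    = qpow (- 1) ((of_int c / 2) ^ 2 / (4 * real M)) * theta (of_int c / 2) (real M) \<tau> z"
proof -
  have nz: "real M \<noteq> 0" using assms by simp
  have ph: "(-1) powi j * qpow (- 1) (real M * of_int j ^ 2 + of_int c / 2 * of_int j + (of_int c / 2) ^ 2 / (4 * real M))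
      = qpow (- 1) ((of_int c / 2) ^ 2 / (4 * real M))" for j
    using qpow_minus_one_int[of "int M * j ^ 2"] qpow_minus_one_half[of "c * j"] assms(2)
    by (simp add: qpow_add minus_one_powi)
  have cong: "(-1) powi j * x * (qpow (- 1) (real M * of_int j ^ 2 + of_int c / 2 * of_int j + (of_int c / 2) ^ 2 / (4 * real M)) * y)
      = qpow (- 1) ((of_int c / 2) ^ 2 / (4 * real M)) * (x * y)" for j x y
    unfolding ph[of j, symmetric] by (simp only: mult_ac)
  show ?thesis
    unfolding theta_def theta_minus_def infsum_cmult_right'[symmetric] complete_square(2)[OF nz] qpow_shift[of \<tau>]
    by (intro infsum_cong cong)
qed

text \<open>The alternating sign and the phase of \<open>q^(mj/2)\<close> combine to \<open>(-1)^((m+1)j)\<close>, which is also what evaluation of \<open>theta\<close> at \<open>1/2\<close> produces, once \<open>j\<close> is replaced by \<open>-j\<close>.\<close>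

lemma theta_minus_at_0_shift:
  fixes m :: nat
  shows "theta_minus (real m / 2) (real m + 1) (\<tau> - 1) 0
    = qpow (- 1) (real m ^ 2 / (16 * (real m + 1))) * exp (of_real pi * \<i> * of_nat m / 4) * theta (- real m / 2) (real m + 1) \<tau> (1/2)"
proof -
  let ?M = "real m"
  have nz: "?M + 1 \<noteq> 0" by simp
  have "(-1) powi j * qpow (\<tau> - 1) ((?M + 1) * of_int j ^ 2 + ?M * of_int j / 2)
    = exp (of_real pi * \<i> * of_nat m / 4) * (exp (2 * of_real pi * \<i> * of_real ((?M + 1) * (of_int (- j) + - ?M / 2 / (2 * (?M + 1)))) * (1/2))
      * qpow \<tau> (- (?M ^ 2 / (16 * (?M + 1))) + (?M + 1) * (of_int (- j) + - ?M / 2 / (2 * (?M + 1)))^2))" for j :: int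
  proof -
    have lin: "(?M + 1) * (of_int (- j) + - ?M / 2 / (2 * (?M + 1))) = - ((?M + 1) * of_int j) - ?M / 4"
      unfolding complete_square[OF nz] by simp
    have "exp (of_real pi * \<i> * of_nat m / 4) * exp (2 * of_real pi * \<i> * of_real ((?M + 1) * (of_int (- j) + - ?M / 2 / (2 * (?M + 1)))) * (1/2))
      = qpow (- 1) (of_int ((int m + 1) * j) / 2)"
      unfolding lin qpow_def exp_add[symmetric] by (intro arg_cong[of _ _ exp]) (simp add: field_simps)
    also have "\<dots> = (-1) powi j * qpow (- 1) ((?M + 1) * of_int j ^ 2 + ?M * of_int j / 2)"
      using qpow_minus_one_int[of "(int m + 1) * j ^ 2"] qpow_minus_one_half[of "int m * j"]
        qpow_minus_one_half[of "(int m + 1) * j"]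
      by (simp add: qpow_add minus_one_powi)
    finally have e: "exp (of_real pi * \<i> * of_nat m / 4) * exp (2 * of_real pi * \<i> * of_real ((?M + 1) * (of_int (- j) + - ?M / 2 / (2 * (?M + 1)))) * (1/2))
      = (-1) powi j * qpow (- 1) ((?M + 1) * of_int j ^ 2 + ?M * of_int j / 2)" .
    have f: "- (?M ^ 2 / (16 * (?M + 1))) + (?M + 1) * (of_int (- j) + - ?M / 2 / (2 * (?M + 1)))^2 = (?M + 1) * of_int j ^ 2 + ?M * of_int j / 2"
      unfolding complete_square[OF nz] by (simp add: power2_eq_square)
    show ?thesis
      unfolding f mult.assoc[symmetric] e by (simp only: qpow_shift[of \<tau>] mult.assoc)
  qed
  then have "(\<Sum>\<^sub>\<infinity>j::int\<in>UNIV. (-1) powi j * qpow (\<tau> - 1) ((?M + 1) * of_int j ^ 2 + ?M * of_int j / 2))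
    = (\<Sum>\<^sub>\<infinity>j::int\<in>UNIV. exp (of_real pi * \<i> * of_nat m / 4) * (exp (2 * of_real pi * \<i> * of_real ((?M + 1) * (of_int j + - ?M / 2 / (2 * (?M + 1)))) * (1/2))
      * qpow \<tau> (- (?M ^ 2 / (16 * (?M + 1))) + (?M + 1) * (of_int j + - ?M / 2 / (2 * (?M + 1)))^2)))"
    by (intro infsum_reindex_bij_witness[of _ uminus uminus]) simp_all
  also have "\<dots> = exp (of_real pi * \<i> * of_nat m / 4) * (qpow \<tau> (- (?M ^ 2 / (16 * (?M + 1)))) * theta (- ?M / 2) (?M + 1) \<tau> (1/2))"
    unfolding theta_def infsum_cmult_right'[symmetric] qpow_add by (simp only: mult_ac)
  finally have "theta_minus (?M / 2) (?M + 1) (\<tau> - 1) 0 = qpow (\<tau> - 1) (?M ^ 2 / (16 * (?M + 1))) *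
      (exp (of_real pi * \<i> * of_nat m / 4) * (qpow \<tau> (- (?M ^ 2 / (16 * (?M + 1)))) * theta (- ?M / 2) (?M + 1) \<tau> (1/2)))"
    unfolding theta_minus_at_0[OF of_nat_0_le_iff] by (simp only:)
  also have "\<dots> = qpow (- 1) (?M ^ 2 / (16 * (?M + 1))) * exp (of_real pi * \<i> * of_nat m / 4) * theta (- ?M / 2) (?M + 1) \<tau> (1/2)
      * (qpow \<tau> (?M ^ 2 / (16 * (?M + 1))) * qpow \<tau> (- (?M ^ 2 / (16 * (?M + 1)))))"
    unfolding qpow_shift[of \<tau>] by (simp only: mult_ac)
  also have "qpow \<tau> (?M ^ 2 / (16 * (?M + 1))) * qpow \<tau> (- (?M ^ 2 / (16 * (?M + 1)))) = 1"
    by (simp add: qpow_add[symmetric])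
  finally show ?thesis by simp
qed

lemma mumford_theta_00_shift: "mumford_theta 0 0 \<tau> z = mumford_theta 0 1 (\<tau> - 1) z"
  unfolding mumford_theta_def
proof (rule infsum_cong)
  fix n :: int
  have "even (n - n ^ 2)" by simp
  then obtain k where k: "n - n ^ 2 = 2 * k" by blast
  have "of_int n - of_int n ^ 2 = (2 * of_int k :: complex)"
    using arg_cong[OF k, of "of_int :: int \<Rightarrow> complex"] by simp
  then have "of_real pi * \<i> * (of_int n - of_int n ^ 2) = of_real pi * \<i> * (2 * of_int k)"
    by (simp only:)
  then have "of_real pi * \<i> * of_real ((of_int n + real 0 / 2)^2) * (\<tau> - 1)
        + 2 * of_real pi * \<i> * of_real (of_int n + real 0 / 2) * (z + of_real (real 1 / 2))
     = (of_real pi * \<i> * of_real ((of_int n + real 0 / 2)^2) * \<tau>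
        + 2 * of_real pi * \<i> * of_real (of_int n + real 0 / 2) * (z + of_real (real 0 / 2))) + 2 * of_real pi * \<i> * of_int k"
    by (simp add: algebra_simps)
  moreover have "exp (2 * of_real pi * \<i> * of_int k) = 1"
    using exp_integer_2pi[of "of_int k"] by (simp add: mult_ac)
  ultimately show "exp (of_real pi * \<i> * of_real ((of_int n + real 0 / 2)^2) * \<tau>
        + 2 * of_real pi * \<i> * of_real (of_int n + real 0 / 2) * (z + of_real (real 0 / 2)))
     = exp (of_real pi * \<i> * of_real ((of_int n + real 0 / 2)^2) * (\<tau> - 1)
        + 2 * of_real pi * \<i> * of_real (of_int n + real 0 / 2) * (z + of_real (real 1 / 2)))"
    by (simp only: exp_add mult_1_right)
qed

lemma dedekind_eta_cube_shift: "dedekind_eta (2 * (\<tau> - 1)) ^ 3 = - \<i> * dedekind_eta (2 * \<tau>) ^ 3"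
proof -
  have "xq (\<tau> - 1) 0 0 2 = xq \<tau> 0 0 2"
    using qpow_shift[of \<tau> 2] qpow_minus_one_int[of 2] by (simp add: qpow_xq[of _ _ 0])
  moreover have "qpow (- 1) (1/4) = - \<i>"
  proof -
    have "qpow (- 1) (1/4) = cis (- (pi / 2))"
      unfolding qpow_def cis_conv_exp by (intro arg_cong[of _ _ exp]) simp
    then show ?thesis by (simp add: complex_eq_iff)
  qed
  ultimately show ?thesis unfolding dedekind_eta_cube by (simp add: qpow_shift[of \<tau> "1/4"])
qed

text \<open>Only \<open>q^(m j^2 + j)\<close> and \<open>q^(2j)\<close> occur in \<open>Phi\<close>, with integral exponents.\<close>

lemma Phi_shift:
  fixes m :: nat
  shows "Phi (real m / 2) (1/2) (2 * (\<tau> - 1)) z1 z2 t = Phi (real m / 2) (1/2) (2 * \<tau>) z1 z2 t"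
proof -
  have 1: "qpow (2 * (\<tau> - 1)) b = qpow (- 1) (2 * b) * qpow (2 * \<tau>) b" for b
    unfolding qpow_def exp_add[symmetric] by (intro arg_cong[of _ _ exp]) (simp add: algebra_simps)
  have 2: "qpow (2 * (\<tau> - 1)) (of_int j) = qpow (2 * \<tau>) (of_int j)" for j
    unfolding 1 using qpow_minus_one_int[of "2 * j"] by simp
  have 3: "qpow (2 * (\<tau> - 1)) (real m / 2 * (of_int j)^2 + 1/2 * of_int j) = qpow (2 * \<tau>) (real m / 2 * (of_int j)^2 + 1/2 * of_int j)" for j
  proof -
    have "2 * (real m / 2 * (of_int j)^2 + 1/2 * of_int j) = of_int (int m * j ^ 2 + j)" by simp
    then show ?thesis unfolding 1 by (simp only: qpow_minus_one_int mult_1_left)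
  qed
  show ?thesis unfolding Phi_def Phi1_def Phi2_def 2 3 ..
qed

text \<open>With \<open>N = 2mr + \<kappa>\<close>, the fractional part of \<open>- N^2 / (4m)\<close> cancels against that of \<open>k^2 / (4m)\<close> from the theta
functions.  What remains is \<open>\<plusminus> N/4\<close>, and in the first phase \<open>-N\<close> may be replaced by \<open>2mr - \<kappa>\<close>, which
differs from it by a multiple of \<open>4\<close>.\<close>

lemma triple_sum_term_shift:
  fixes m r k j :: nat
  assumes m: "m \<ge> 1" and \<kappa>: "\<kappa> = real k \<or> \<kappa> = - real k"
  shows "triple_sum_term m (\<tau> - 1) j (2 * real m * real r + \<kappa>) * theta_diff (real k) (real m) (\<tau> - 1) z
    = qpow (- 1) (- real m / 16) * ((-1) ^ j
        * qpow \<tau> (real j ^ 2 - 1 / (4 * real m) * (2 * real m * real r + \<kappa>) ^ 2 - real m / 16)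
        * (qpow \<tau> ((real j + 1/4) * (2 * real m * real r + \<kappa>)) * exp (of_real pi * \<i> / 2 * of_real (2 * real m * real r - \<kappa>))
         + qpow \<tau> ((real j - 1/4) * (2 * real m * real r + \<kappa>)) * exp (of_real pi * \<i> / 2 * of_real (2 * real m * real r + \<kappa>)))
        * theta_diff (real k) (real m) \<tau> z)"
proof -
  let ?M = "real m"
  have mpos: "m > 0" using m by simp
  define N where "N = 2 * ?M * real r + \<kappa>"
  obtain i :: int where i: "\<kappa> = of_int i" using \<kappa> by (metis of_int_minus of_int_of_nat_eq)
  have \<kappa>2: "real k ^ 2 = \<kappa> ^ 2" using \<kappa> by auto
  define e where "e = real j ^ 2 - 1 / (4 * ?M) * N ^ 2 - ?M / 16"
  have ph: "qpow (- 1) e * qpow (- 1) ((real j + c) * N) * qpow (- 1) (real k ^ 2 / (4 * ?M)) = qpow (- 1) (- ?M / 16) * qpow (- 1) (c * N)" for c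
  proof -
    have "e + (real j + c) * N + real k ^ 2 / (4 * ?M)
        = of_int (int j ^ 2 + int j * (2 * int m * int r + i) - int m * int r ^ 2 - int r * i) + (- ?M / 16 + c * N)"
      unfolding \<kappa>2 using m by (simp add: e_def N_def i field_simps power2_eq_square)
    then show ?thesis
      unfolding qpow_add[symmetric] by (simp only: qpow_add qpow_minus_one_int mult_1_left)
  qed
  have ex1: "qpow (- 1) (1/4 * N) = exp (of_real pi * \<i> / 2 * of_real (2 * ?M * real r - \<kappa>))"
  proof -
    have "exp (of_real pi * \<i> / 2 * of_real (2 * ?M * real r - \<kappa>)) = qpow (- 1) (of_int (- (int m * int r)) + 1/4 * N)"
      unfolding qpow_def N_def by (intro arg_cong[of _ _ exp]) (simp add: field_simps)
    then show ?thesis by (simp only: qpow_add qpow_minus_one_int mult_1_left)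
  qed
  have ex2: "qpow (- 1) (- 1/4 * N) = exp (of_real pi * \<i> / 2 * of_real (2 * ?M * real r + \<kappa>))"
    unfolding qpow_def N_def by (intro arg_cong[of _ _ exp]) (simp add: field_simps)
  have "triple_sum_term m (\<tau> - 1) j N * theta_diff (real k) ?M (\<tau> - 1) z
    = (-1) ^ j * (qpow (- 1) e * qpow \<tau> e) * (qpow (- 1) ((real j + 1/4) * N) * qpow \<tau> ((real j + 1/4) * N)
        + qpow (- 1) ((real j + - 1/4) * N) * qpow \<tau> ((real j - 1/4) * N)) * (qpow (- 1) (real k ^ 2 / (4 * ?M)) * theta_diff (real k) ?M \<tau> z)"
    unfolding triple_sum_term_def e_def[symmetric] qpow_shift[of \<tau>] theta_diff_shift[OF mpos] by simp
  also have "\<dots> = (-1) ^ j * qpow \<tau> e * theta_diff (real k) ?M \<tau> z *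
      (qpow \<tau> ((real j + 1/4) * N) * (qpow (- 1) e * qpow (- 1) ((real j + 1/4) * N) * qpow (- 1) (real k ^ 2 / (4 * ?M)))
       + qpow \<tau> ((real j - 1/4) * N) * (qpow (- 1) e * qpow (- 1) ((real j + - 1/4) * N) * qpow (- 1) (real k ^ 2 / (4 * ?M))))"
    by (simp only: distrib_left distrib_right mult_ac)
  also have "\<dots> = qpow (- 1) (- ?M / 16) * ((-1) ^ j * qpow \<tau> e
        * (qpow \<tau> ((real j + 1/4) * N) * qpow (- 1) (1/4 * N) + qpow \<tau> ((real j - 1/4) * N) * qpow (- 1) (- 1/4 * N))
        * theta_diff (real k) (real m) \<tau> z)"
    unfolding ph by (simp only: distrib_left distrib_right mult_ac)
  finally show ?thesis unfolding ex1 ex2 unfolding e_def N_def .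
qed

lemma theta_minus_half_shift:
  fixes m :: nat
  assumes "\<kappa> = 1/2 \<or> \<kappa> = - 1/2"
  shows "theta_minus \<kappa> (real m + 1) (\<tau> - 1) z = qpow (- 1) (1 / (16 * (real m + 1))) * theta \<kappa> (real m + 1) \<tau> z"
proof (rule disjE[OF assms])
  assume \<kappa>: "\<kappa> = 1/2"
  show ?thesis unfolding \<kappa> using theta_minus_shift[of "m + 1" 1 \<tau> z] by (simp add: power2_eq_square add.commute)
next
  assume \<kappa>: "\<kappa> = - 1/2"
  show ?thesis unfolding \<kappa> using theta_minus_shift[of "m + 1" "-1" \<tau> z] by (simp add: power2_eq_square add.commute)
qed

text \<open>The identity \<open>theta_times_Appell\<close> at \<open>\<tau> - 1\<close>.  The phase \<open>exp (- 2 \<pi> i (m^2 / (16 (m+1)) - m/16))\<close> is common to all three terms.\<close>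

theorem theta_times_Appell_shifted:
  fixes m :: nat
  assumes \<tau>: "Im \<tau> > 0" and m: "m \<ge> 1" and nz: "mumford_theta 0 0 \<tau> z \<noteq> 0"
  shows "theta (- real m / 2) (real m + 1) \<tau> (1/2) *
      (qpow \<tau> (- real m / 16) * Phi (real m / 2) (1/2) (2 * \<tau>) (z + \<tau>/2 - 1/2) (z - \<tau>/2 + 1/2) 0)
    = exp (- (of_real pi * \<i> * of_nat m / 4)) *
      (- \<i> * dedekind_eta (2 * \<tau>) ^ 3 * (theta (1/2) (real m + 1) \<tau> z / theta (- 1/2) 1 \<tau> z
        - theta (- 1/2) (real m + 1) \<tau> z / theta (1/2) 1 \<tau> z)
      + qpow \<tau> (real m ^ 2 / (16 * (real m + 1))) *
        ((\<Sum>\<^sub>\<infinity>j\<in>{1::nat..}. \<Sum>r=1..j. \<Sum>k\<in>odd_upto (m-1).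
                (-1) ^ j
                * qpow \<tau> (real j ^ 2
                           - 1 / (4 * real m) * (2 * real m * real r - real k) ^ 2 - real m / 16)
                * (qpow \<tau> ((real j + 1/4) * (2 * real m * real r - real k))
                     * exp (of_real pi * \<i> / 2 * of_real (2 * real m * real r + real k))
                   + qpow \<tau> ((real j - 1/4) * (2 * real m * real r - real k))
                     * exp (of_real pi * \<i> / 2 * of_real (2 * real m * real r - real k)))
                * theta_diff (real k) (real m) \<tau> z)
         - (\<Sum>\<^sub>\<infinity>j\<in>{1::nat..}. \<Sum>r=0..j-1. \<Sum>k\<in>odd_upto (m-1).
                (-1) ^ j
                * qpow \<tau> (real j ^ 2
                           - 1 / (4 * real m) * (2 * real m * real r + real k) ^ 2 - real m / 16)
                * (qpow \<tau> ((real j + 1/4) * (2 * real m * real r + real k))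
                     * exp (of_real pi * \<i> / 2 * of_real (2 * real m * real r - real k))
                   + qpow \<tau> ((real j - 1/4) * (2 * real m * real r + real k))
                     * exp (of_real pi * \<i> / 2 * of_real (2 * real m * real r + real k)))
                * theta_diff (real k) (real m) \<tau> z)))"
    (is "?\<theta> * (?q * ?\<Phi>) = exp (- ?e) * (- \<i> * ?\<eta> * (?P / ?Q - ?P' / ?Q') + ?b * (?S1 - ?S2))")
proof -
  let ?pA = "qpow (- 1) (real m ^ 2 / (16 * (real m + 1)))"
  let ?pm = "qpow (- 1) (- real m / 16)"
  let ?pr = "qpow (- 1) (1 / (16 * (real m + 1)))"
  let ?p1 = "qpow (- 1) (1 / 16)"
  have \<tau>1: "Im (\<tau> - 1) > 0" using \<tau> by simp
  have z: "z + (\<tau> - 1)/2 = z + \<tau>/2 - 1/2" "z - (\<tau> - 1)/2 = z - \<tau>/2 + 1/2"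
    by (simp_all add: field_simps)
  have S1: "(\<Sum>\<^sub>\<infinity>j\<in>{1::nat..}. \<Sum>r=1..j. \<Sum>k\<in>odd_upto (m - 1).
            triple_sum_term m (\<tau> - 1) j (2 * real m * real r - real k) * theta_diff (real k) (real m) (\<tau> - 1) z) = ?pm * ?S1"
    unfolding infsum_cmult_right'[symmetric] sum_distrib_left
  proof (intro infsum_cong sum.cong refl)
    fix j r k :: nat
    have "- real k = real k \<or> - real k = - real k" by simp
    from triple_sum_term_shift[OF m this, of \<tau> j r z]
    show "triple_sum_term m (\<tau> - 1) j (2 * real m * real r - real k) * theta_diff (real k) (real m) (\<tau> - 1) z
      = ?pm * ((-1) ^ j * qpow \<tau> (real j ^ 2 - 1 / (4 * real m) * (2 * real m * real r - real k) ^ 2 - real m / 16)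
                * (qpow \<tau> ((real j + 1/4) * (2 * real m * real r - real k))
                     * exp (of_real pi * \<i> / 2 * of_real (2 * real m * real r + real k))
                   + qpow \<tau> ((real j - 1/4) * (2 * real m * real r - real k))
                     * exp (of_real pi * \<i> / 2 * of_real (2 * real m * real r - real k)))
                * theta_diff (real k) (real m) \<tau> z)"
      by (simp only: add_uminus_conv_diff diff_minus_eq_add)
  qed
  have S2: "(\<Sum>\<^sub>\<infinity>j\<in>{1::nat..}. \<Sum>r=0..j-1. \<Sum>k\<in>odd_upto (m - 1).
            triple_sum_term m (\<tau> - 1) j (2 * real m * real r + real k) * theta_diff (real k) (real m) (\<tau> - 1) z) = ?pm * ?S2"
    unfolding infsum_cmult_right'[symmetric] sum_distrib_left
    by (intro infsum_cong sum.cong refl triple_sum_term_shift[OF m] disjI1)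
  have "mumford_theta 0 1 (\<tau> - 1) z \<noteq> 0" using nz unfolding mumford_theta_00_shift .
  from theta_times_Appell[OF \<tau>1 m this]
  have core: "?pA * exp ?e * ?\<theta> * (?pm * ?q * ?\<Phi>)
      = - \<i> * ?\<eta> * ((?pr * ?P) / (?p1 * ?Q) - (?pr * ?P') / (?p1 * ?Q')) + (?pA * ?b) * (?pm * ?S1 - ?pm * ?S2)"
    unfolding S1 S2 z Phi_shift theta_minus_at_0_shift dedekind_eta_cube_shift qpow_shift[of \<tau>]
      theta_minus_half_shift[of "1/2" m, OF disjI1[OF refl]] theta_minus_half_shift[of "- 1/2" m, OF disjI2[OF refl]]
      theta_minus_half_shift[of "1/2" 0, OF disjI1[OF refl], simplified of_nat_0 add_0 mult_1_right]
      theta_minus_half_shift[of "- 1/2" 0, OF disjI2[OF refl], simplified of_nat_0 add_0 mult_1_right] .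
  \<comment> \<open>since \<open>1 / (16 (m + 1)) - 1/16 = m^2 / (16 (m + 1)) - m/16\<close>\<close>
  have pr: "?pr = ?pA * ?pm * ?p1"
    unfolding qpow_add[symmetric] by (intro arg_cong[of _ _ "qpow (- 1)"]) (simp add: field_simps power2_eq_square)
  have ee: "exp ?e * exp (- ?e) = 1" by (simp add: exp_add[symmetric])
  have quot: "(?pr * P) / (?p1 * Q) = ?pA * ?pm * (P / Q)" for P Q
    unfolding pr by simp
  have "?pA * ?pm * (exp ?e * (?\<theta> * (?q * ?\<Phi>)))
      = ?pA * ?pm * (- \<i> * ?\<eta> * (?P / ?Q - ?P' / ?Q') + ?b * (?S1 - ?S2))"
    using core unfolding quot by (simp only: algebra_simps)
  then have "exp ?e * (?\<theta> * (?q * ?\<Phi>)) = - \<i> * ?\<eta> * (?P / ?Q - ?P' / ?Q') + ?b * (?S1 - ?S2)"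
    by (subst (asm) mult_cancel_left) simp
  then have "exp (- ?e) * (exp ?e * (?\<theta> * (?q * ?\<Phi>))) = exp (- ?e) * (- \<i> * ?\<eta> * (?P / ?Q - ?P' / ?Q') + ?b * (?S1 - ?S2))"
    by (rule arg_cong)
  then show ?thesis unfolding mult.assoc[symmetric] using ee by (simp only: mult.commute[of "exp (- ?e)" "exp ?e"] mult_1_left)
qed

section \<open>The characters\<close>

lemma character_from_product:
  fixes ch :: complex
  assumes "h1 \<noteq> 0" "h2 \<noteq> 0" "t0 \<noteq> 0" "t1 \<noteq> 0" "\<theta> \<noteq> 0"
    and "h1 * h2 * (t1 / t0) * ch = x" and "\<theta> * x = e * (- \<i> * h2 ^ 3 * B + Q * S)"
  shows "ch = - \<i> * e * (h2 ^ 2 / h1) * (t0 / t1) * (1 / \<theta>) * B + Q * e * (1 / (h1 * h2)) * (t0 / t1) * (1 / \<theta>) * S"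
proof -
  have "ch = (\<theta> * x) * (1 / \<theta>) * (t0 / t1) * (1 / (h1 * h2))"
    using assms(1-6) by (simp add: field_simps)
  also have "\<dots> = - \<i> * e * (h2 ^ 2 / h1) * (t0 / t1) * (1 / \<theta>) * B + Q * e * (1 / (h1 * h2)) * (t0 / t1) * (1 / \<theta>) * S"
    unfolding assms(7) using assms(1-5) by (simp add: field_simps power2_eq_square power3_eq_cube)
  finally show ?thesis .
qed

lemma supercharacter_from_product:
  fixes ch :: complex
  assumes "h \<noteq> 0" "h1 \<noteq> 0" "t0 \<noteq> 0" "t1 \<noteq> 0" "\<theta> \<noteq> 0"
    and "h ^ 3 / h1 * (t1 / t0) * ch = x" and "\<theta> * x = h2 ^ 3 * B + Q * S"
  shows "ch = h1 * h2 ^ 3 / h ^ 3 * (t0 / t1) * (1 / \<theta>) * B + Q * (h1 / h ^ 3) * (t0 / t1) * (1 / \<theta>) * S"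
proof -
  have "ch = (\<theta> * x) * (1 / \<theta>) * (t0 / t1) * (h1 / h ^ 3)"
    using assms(1-6) by (simp add: field_simps)
  also have "\<dots> = h1 * h2 ^ 3 / h ^ 3 * (t0 / t1) * (1 / \<theta>) * B + Q * (h1 / h ^ 3) * (t0 / t1) * (1 / \<theta>) * S"
    unfolding assms(7) using assms(1-5) by (simp add: field_simps)
  finally show ?thesis .
qed

lemma theta_at_half_nonzero:
  fixes m :: nat
  assumes "Im \<tau> > 0"
  shows "theta (- real m / 2) (real m + 1) \<tau> (1/2) \<noteq> 0"
proof
  assume "theta (- real m / 2) (real m + 1) \<tau> (1/2) = 0"
  then have "theta_minus (real m / 2) (real m + 1) (\<tau> - 1) 0 = 0"
    unfolding theta_minus_at_0_shift by simp
  then show False using theta_minus_at_0_nonzero[of "\<tau> - 1" m] assms by simp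
qed

theorem proposition4p1:
  fixes m :: nat
    and ch_plus ch_minus :: "weight \<Rightarrow> complex \<Rightarrow> complex \<Rightarrow> complex"
  assumes m: "m \<ge> 1"
    and ch_plus: "\<And>m2 \<tau> z. m2 \<le> m \<Longrightarrow> Im \<tau> > 0 \<Longrightarrow>
      mumford_theta 0 0 \<tau> z \<noteq> 0 \<Longrightarrow> mumford_theta 1 1 \<tau> z \<noteq> 0 \<Longrightarrow>
      R_plus \<tau> z * ch_plus (Lambda m m2) \<tau> z =
        qpow \<tau> (- real m / 16) *
        Phi (real m / 2) ((real m2 + 1) / 2) (2 * \<tau>) (z + \<tau>/2 - 1/2) (z - \<tau>/2 + 1/2) 0"
    and ch_minus: "\<And>m2 \<tau> z. m2 \<le> m \<Longrightarrow> Im \<tau> > 0 \<Longrightarrow>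
      mumford_theta 0 1 \<tau> z \<noteq> 0 \<Longrightarrow> mumford_theta 1 1 \<tau> z \<noteq> 0 \<Longrightarrow>
      R_minus \<tau> z * ch_minus (Lambda m m2) \<tau> z =
        qpow \<tau> (- real m / 16) *
        Phi (real m / 2) ((real m2 + 1) / 2) (2 * \<tau>) (z + \<tau>/2) (z - \<tau>/2) 0"
  shows
   "(\<forall>\<tau> z. Im \<tau> > 0 \<longrightarrow> mumford_theta 0 0 \<tau> z \<noteq> 0 \<longrightarrow> mumford_theta 1 1 \<tau> z \<noteq> 0 \<longrightarrow>
      ch_plus (Lambda m 0) \<tau> z =
        - \<i> * exp (- (of_real pi * \<i> * of_nat m / 4))
          * (dedekind_eta (2*\<tau>) ^ 2 / dedekind_eta (\<tau>/2))
          * (mumford_theta 0 0 \<tau> z / mumford_theta 1 1 \<tau> z)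
          * (1 / theta (- real m / 2) (real m + 1) \<tau> (1/2))
          * (theta (1/2) (real m + 1) \<tau> z / theta (-1/2) 1 \<tau> z
             - theta (-1/2) (real m + 1) \<tau> z / theta (1/2) 1 \<tau> z)
        + qpow \<tau> (real m ^ 2 / (16 * (real m + 1)))
          * exp (- (of_real pi * \<i> * of_nat m / 4))
          * (1 / (dedekind_eta (\<tau>/2) * dedekind_eta (2*\<tau>)))
          * (mumford_theta 0 0 \<tau> z / mumford_theta 1 1 \<tau> z)
          * (1 / theta (- real m / 2) (real m + 1) \<tau> (1/2))
          * ((\<Sum>\<^sub>\<infinity>j\<in>{1::nat..}. \<Sum>r=1..j. \<Sum>k\<in>odd_upto (m-1).
                (-1) ^ j
                * qpow \<tau> (real j ^ 2
                           - 1 / (4 * real m) * (2 * real m * real r - real k) ^ 2 - real m / 16)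
                * (qpow \<tau> ((real j + 1/4) * (2 * real m * real r - real k))
                     * exp (of_real pi * \<i> / 2 * of_real (2 * real m * real r + real k))
                   + qpow \<tau> ((real j - 1/4) * (2 * real m * real r - real k))
                     * exp (of_real pi * \<i> / 2 * of_real (2 * real m * real r - real k)))
                * theta_diff (real k) (real m) \<tau> z)
             - (\<Sum>\<^sub>\<infinity>j\<in>{1::nat..}. \<Sum>r=0..j-1. \<Sum>k\<in>odd_upto (m-1).
                (-1) ^ j
                * qpow \<tau> (real j ^ 2
                           - 1 / (4 * real m) * (2 * real m * real r + real k) ^ 2 - real m / 16)
                * (qpow \<tau> ((real j + 1/4) * (2 * real m * real r + real k))
                     * exp (of_real pi * \<i> / 2 * of_real (2 * real m * real r - real k))
                   + qpow \<tau> ((real j - 1/4) * (2 * real m * real r + real k))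
                     * exp (of_real pi * \<i> / 2 * of_real (2 * real m * real r + real k)))
                * theta_diff (real k) (real m) \<tau> z)))
    \<and>
    (\<forall>\<tau> z. Im \<tau> > 0 \<longrightarrow> mumford_theta 0 1 \<tau> z \<noteq> 0 \<longrightarrow> mumford_theta 1 1 \<tau> z \<noteq> 0 \<longrightarrow>
      ch_minus (Lambda m 0) \<tau> z =
        dedekind_eta (\<tau>/2) * dedekind_eta (2*\<tau>) ^ 3 / dedekind_eta \<tau> ^ 3
          * (mumford_theta 0 1 \<tau> z / mumford_theta 1 1 \<tau> z)
          * (1 / theta_minus (real m / 2) (real m + 1) \<tau> 0)
          * (theta_minus (1/2) (real m + 1) \<tau> z / theta_minus (-1/2) 1 \<tau> z
             - theta_minus (-1/2) (real m + 1) \<tau> z / theta_minus (1/2) 1 \<tau> z)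
        + qpow \<tau> (real m ^ 2 / (16 * (real m + 1)))
          * (dedekind_eta (\<tau>/2) / dedekind_eta \<tau> ^ 3)
          * (mumford_theta 0 1 \<tau> z / mumford_theta 1 1 \<tau> z)
          * (1 / theta_minus (real m / 2) (real m + 1) \<tau> 0)
          * ((\<Sum>\<^sub>\<infinity>j\<in>{1::nat..}. \<Sum>r=1..j. \<Sum>k\<in>odd_upto (m-1).
                (-1) ^ j
                * qpow \<tau> (real j ^ 2
                           - 1 / (4 * real m) * (2 * real m * real r - real k) ^ 2 - real m / 16)
                * (qpow \<tau> ((real j + 1/4) * (2 * real m * real r - real k))
                   + qpow \<tau> ((real j - 1/4) * (2 * real m * real r - real k)))
                * theta_diff (real k) (real m) \<tau> z)
             - (\<Sum>\<^sub>\<infinity>j\<in>{1::nat..}. \<Sum>r=0..j-1. \<Sum>k\<in>odd_upto (m-1).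
                (-1) ^ j
                * qpow \<tau> (real j ^ 2
                           - 1 / (4 * real m) * (2 * real m * real r + real k) ^ 2 - real m / 16)
                * (qpow \<tau> ((real j + 1/4) * (2 * real m * real r + real k))
                   + qpow \<tau> ((real j - 1/4) * (2 * real m * real r + real k)))
                * theta_diff (real k) (real m) \<tau> z)))"
proof (intro conjI allI impI, goal_cases)
  case (1 \<tau> z)
  have "0 < Im (\<tau> / 2)" "0 < Im (2 * \<tau>)" using 1(1) by simp_all
  note eta = this[THEN dedekind_eta_nonzero]
  have "(real 0 + 1) / 2 = (1 / 2 :: real)" by simp
  note numerator = ch_plus[of 0, unfolded this R_plus_def, OF le0 1]
  show ?case
    by (rule character_from_product[OF eta 1(2,3) theta_at_half_nonzero[OF 1(1)] numerator theta_times_Appell_shifted[OF 1(1) m 1(2)]])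
next
  case (2 \<tau> z)
  have "0 < Im \<tau>" "0 < Im (\<tau> / 2)" using 2(1) by simp_all
  note eta = this[THEN dedekind_eta_nonzero]
  have "(real 0 + 1) / 2 = (1 / 2 :: real)" by simp
  note numerator = ch_minus[of 0, unfolded this R_minus_def, OF le0 2]
  show ?case
    by (rule supercharacter_from_product[OF eta 2(2,3) theta_minus_at_0_nonzero[OF 2(1)] numerator
          theta_times_Appell[OF 2(1) m 2(2), unfolded triple_sum_term_def]])
qed

end
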